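(* Let $K$ be a field. For any graph $G$, we have $$\operatorname{depth} S/I(G)^{(k)}\geq\operatorname{depth} S/I(G)^{k}\quad\text{for }k=2,3.$$
   Context: All graphs are finite, without loops and multiple edges. For a graph $G$ on vertex set $[n]=\{1,\dots,n\}$ and the polynomial ring $S=K[x_1,\dots,x_n]$, the edge ideal is $I(G)=(x_ix_j : \{i,j\}\in E(G))\subset S$. For a squarefree monomial ideal $I$, the $k$-th symbolic power is $I^{(k)}=\bigcap_{P\in\operatorname{Min}(I)}P^k$, where $\operatorname{Min}(I)$ is the set of minimal primes of $I$; $I^k$ is the ordinary power. $\operatorname{depth}$ is taken with respect to the homogeneous maximal ideal $(x_1,\dots,x_n)$. *)

theory Defs
  imports
    "HOL-Algebra.Algebra"
    "HOL-Library.Poly_Mapping"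
    "HOL-Library.Extended_Nat"
begin

text \<open>
  The polynomial ring \<open>K[x\<^sub>v : v \<in> V]\<close>. A monomial is a finitely supported exponent function
  \<open>'v \<Rightarrow>\<^sub>0 nat\<close>, a polynomial is a finitely supported coefficient function on monomials, and
  the multiplication of \<^type>\<open>poly_mapping\<close> is the convolution product.
\<close>

type_synonym ('v, 'k) mpoly = "('v \<Rightarrow>\<^sub>0 nat) \<Rightarrow>\<^sub>0 'k"

definition mpoly_ring :: "'v set \<Rightarrow> ('v, 'k::comm_ring_1) mpoly ring" where
  "mpoly_ring V =
     \<lparr>carrier = {p. \<forall>m \<in> Poly_Mapping.keys p. Poly_Mapping.keys m \<subseteq> V},
      monoid.mult = (*), one = 1, ring.zero = 0, add = (+)\<rparr>"

definition mpoly_var :: "'v \<Rightarrow> ('v, 'k::comm_ring_1) mpoly" where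
  "mpoly_var v = Poly_Mapping.single (Poly_Mapping.single v 1) 1"

definition homogeneous_maximal_ideal :: "'v set \<Rightarrow> ('v, 'k::comm_ring_1) mpoly set" where
  "homogeneous_maximal_ideal V = Idl\<^bsub>mpoly_ring V\<^esub> (mpoly_var ` V)"

text \<open>Finite graphs without loops and multiple edges; an edge is a two-element set of vertices.\<close>

definition simple_graph :: "'v set \<Rightarrow> 'v set set \<Rightarrow> bool" where
  "simple_graph V E \<longleftrightarrow> finite V \<and> (\<forall>e \<in> E. e \<subseteq> V \<and> card e = 2)"

definition edge_ideal :: "'v set \<Rightarrow> 'v set set \<Rightarrow> ('v, 'k::comm_ring_1) mpoly set" where
  "edge_ideal V E = Idl\<^bsub>mpoly_ring V\<^esub> {mpoly_var i * mpoly_var j | i j. {i, j} \<in> E}"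

definition minimal_primes :: "('a, 'b) ring_scheme \<Rightarrow> 'a set \<Rightarrow> 'a set set" where
  "minimal_primes R I =
     {P. primeideal P R \<and> I \<subseteq> P \<and> (\<forall>Q. primeideal Q R \<and> I \<subseteq> Q \<and> Q \<subseteq> P \<longrightarrow> Q = P)}"

text \<open>The power in the monoid of ideals is the usual power of an ideal.\<close>

definition ideal_power :: "('a, 'b) ring_scheme \<Rightarrow> 'a set \<Rightarrow> nat \<Rightarrow> 'a set" where
  "ideal_power R I k = I [^]\<^bsub>ideals_set R\<^esub> k"

definition symbolic_power :: "('a, 'b) ring_scheme \<Rightarrow> 'a set \<Rightarrow> nat \<Rightarrow> 'a set" where
  "symbolic_power R I k = {f \<in> carrier R. \<forall>P \<in> minimal_primes R I. f \<in> ideal_power R P k}"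

text \<open>The quotient ring \<open>R/J\<close>, viewed as an \<open>R\<close>-module.\<close>

definition quotient_module :: "('a, 'b) ring_scheme \<Rightarrow> 'a set \<Rightarrow> ('a, 'a set) module" where
  "quotient_module R J =
     \<lparr>carrier = carrier (R Quot J), monoid.mult = monoid.mult (R Quot J), one = one (R Quot J),
      ring.zero = ring.zero (R Quot J), add = add (R Quot J),
      smult = (\<lambda>r A. (J +>\<^bsub>R\<^esub> r) \<otimes>\<^bsub>R Quot J\<^esub> A)\<rparr>"

text \<open>The submodule \<open>(f\<^sub>1, \<dots>, f\<^sub>r) M\<close> of \<open>M\<close>.\<close>

definition list_smult :: "('a, 'm, 'c) module_scheme \<Rightarrow> 'a list \<Rightarrow> 'm set" where
  "list_smult M fs =
     {\<Oplus>\<^bsub>M\<^esub>j \<in> {..<length fs}. (fs ! j) \<odot>\<^bsub>M\<^esub> x j | x. x \<in> {..<length fs} \<rightarrow> carrier M}"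

text \<open>
  Each \<open>f\<^sub>i\<close> is a nonzerodivisor on \<open>M/(f\<^sub>1, \<dots>, f\<^bsub>i-1\<^esub>)M\<close>, which is expressed by
  representatives in \<open>M\<close>, and \<open>M \<noteq> (f\<^sub>1, \<dots>, f\<^sub>r)M\<close>.
\<close>

definition regular_sequence :: "('a, 'm, 'c) module_scheme \<Rightarrow> 'a list \<Rightarrow> bool" where
  "regular_sequence M fs \<longleftrightarrow>
     (\<forall>i < length fs. \<forall>x \<in> carrier M.
        (fs ! i) \<odot>\<^bsub>M\<^esub> x \<in> list_smult M (take i fs) \<longrightarrow> x \<in> list_smult M (take i fs)) \<and>
     list_smult M fs \<noteq> carrier M"

text \<open>
  The depth of \<open>M\<close> with respect to the ideal \<open>P\<close>, as the supremum of the lengths of the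
  \<open>M\<close>-regular sequences in \<open>P\<close>. The empty sequence is regular unless \<open>M = 0\<close>; for \<open>M = 0\<close>
  the value is \<open>0\<close>.
\<close>

definition depth :: "'a set \<Rightarrow> ('a, 'm, 'c) module_scheme \<Rightarrow> enat" where
  "depth P M = (SUP fs \<in> {fs. set fs \<subseteq> P \<and> regular_sequence M fs}. enat (length fs))"

end

theory Submission
  imports Defs
begin

text \<open>
  Write \<open>J = I\<^sup>k\<close> and \<open>J'\<close> for the symbolic power. Both are monomial ideals: a monomial lies in \<open>J\<close>
  iff it is divisible by a product of \<open>k\<close> edges, and in \<open>J'\<close> iff every vertex cover of the graph
  has weight at least \<open>k\<close> in it, because the minimal primes of \<open>I\<close> are generated by the minimal
  vertex covers.

  Depth is detected by the Koszul cohomology of the powers \<open>x\<^sub>v\<^sup>4\<close> of the variables: \<open>S/L\<close> has a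
  regular sequence of length \<open>d\<close> in the maximal ideal iff this cohomology vanishes in all degrees
  below \<open>d\<close> (\<open>regseq_imp_koszul_vanishes\<close> and \<open>koszul_vanishes_imp_regseq\<close>). The second direction
  needs nonzerodivisors modulo ideals that are no longer monomial; they come from prime avoidance
  in a Noetherian ring (\<open>ex_nonzerodivisor\<close>, \<open>noetherian_polys\<close>).

  For a monomial ideal the Koszul complex splits into multidegrees, and each multidegree is the
  cochain complex over \<open>K\<close> of a family of vertex sets. As the power \<open>4\<close> is large compared with
  \<open>k\<close>, such a family is given by an exponent vector \<open>h\<close> and a set \<open>G\<close>: it consists of the
  sets \<open>F \<supseteq> G\<close> for which \<open>x\<^sup>h\<close>, multiplied by high powers of the variables in \<open>F - G\<close>, is not
  in the ideal. It suffices to show that every family of \<open>J'\<close> is acyclic or is also a family of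
  \<open>J\<close> (\<open>symbolic_exponent_complex_cases\<close>). Suppose that the families of \<open>J\<close> and \<open>J'\<close> for
  \<open>h\<close> differ at \<open>F\<close> and \<open>x\<^sup>h \<notin> J'\<close>. The neighbours of \<open>F\<close> contribute equally to both ideals, and what
  remains is a graph in which at most two edges have to be found. For so few edges the only obstruction to the equality
  of matching number and covering number is a triangle. This forces \<open>k = 3\<close>, a triangle
  \<open>abc\<close> on which \<open>h = 1\<close>, and a further vertex in the support of \<open>h\<close>
  (\<open>ordinary_symbolic_discrepancy\<close>). But then a cover of weight at most \<open>2\<close> spends all its weight
  on \<open>abc\<close>, so it avoids the rest of the support. If that rest contains a vertex outside \<open>G\<close>, the
  family of \<open>J'\<close> is a cone over it and is acyclic. Otherwise the exponents on the rest can be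
  raised and the new vector has no discrepancy, since it leaves no room for the further vertex; so
  the family is one of \<open>J\<close>.
\<close>

abbreviation (input) "lookup \<equiv> Poly_Mapping.lookup"
abbreviation (input) "keys \<equiv> Poly_Mapping.keys"
abbreviation (input) "single \<equiv> Poly_Mapping.single"

section \<open>Koszul cohomology and regular sequences\<close>

text \<open>
  The sign of moving \<open>v\<close> past the smaller elements of \<open>F\<close> when \<open>F \<union> {v}\<close> is listed increasingly.
\<close>

definition ksgn :: "'v::linorder \<Rightarrow> 'v set \<Rightarrow> 'a::comm_ring_1" where
  "ksgn v F = (- 1) ^ card {u \<in> F. u < v}"

text \<open>
  The Koszul differential of the family \<open>x\<close>. A cochain is a function on finite sets, and the
  cardinality of the set is the cohomological degree, so that one function carries components of
  all degrees. For \<open>x = 1\<close> this is the simplicial coboundary.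
\<close>

definition koszul :: "('v::linorder \<Rightarrow> 'a::comm_ring_1) \<Rightarrow> ('v set \<Rightarrow> 'a) \<Rightarrow> 'v set \<Rightarrow> 'a" where
  "koszul x z F = (\<Sum>v\<in>F. ksgn v (F - {v}) * x v * z (F - {v}))"

lemma ksgn_square [simp]: "ksgn v F * ksgn v F = 1"
  unfolding ksgn_def by (simp add: power2_eq_square[symmetric] power_mult[symmetric] mult.commute)

lemma ksgn_square_left [simp]: "ksgn v F * (ksgn v F * a) = a"
  by (simp add: mult.assoc[symmetric])

lemma ksgn_insert_ge: "v \<le> w \<Longrightarrow> ksgn v (insert w F) = ksgn v F"
proof -
  assume "v \<le> w"
  then have "{u \<in> insert w F. u < v} = {u \<in> F. u < v}" by auto
  then show ?thesis by (simp add: ksgn_def)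
qed

lemma ksgn_insert_less:
  assumes "w < v" "w \<notin> F" "finite F"
  shows "ksgn v (insert w F) = - ksgn v F"
proof -
  have "{u \<in> insert w F. u < v} = insert w {u \<in> F. u < v}" using assms by auto
  then show ?thesis using assms by (simp add: ksgn_def)
qed

text \<open>
  Both the vanishing of the square of the differential and the homotopy formula reduce to this
  identity of signs.
\<close>

lemma ksgn_exchange:
  assumes "v \<noteq> w" "v \<notin> F" "w \<notin> F" "finite F"
  shows "ksgn v F * ksgn w (insert v F) = - (ksgn w F * ksgn v (insert w F))"
proof (cases "v < w")
  case True
  then show ?thesis
    using assms by (simp add: ksgn_insert_ge ksgn_insert_less mult.commute)
next
  case False
  then have "w < v" using assms(1) by auto
  then show ?thesis
    using assms by (simp add: ksgn_insert_ge ksgn_insert_less mult.commute)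
qed

lemma ksgn_exchange_insert:
  assumes "v \<noteq> w" "v \<notin> F" "w \<notin> F" "finite F"
  shows "ksgn v (insert w F) * ksgn w (insert v F) = - (ksgn w F * ksgn v F)"
proof (cases "v < w")
  case True
  then show ?thesis
    using assms by (simp add: ksgn_insert_ge ksgn_insert_less mult.commute)
next
  case False
  then have "w < v" using assms(1) by auto
  then show ?thesis
    using assms by (simp add: ksgn_insert_ge ksgn_insert_less mult.commute)
qed

text \<open>
  Antisymmetry of a sum does not make it zero in characteristic two; the pairs \<open>(v, w)\<close> and
  \<open>(w, v)\<close> have to be matched.
\<close>

lemma sum_offdiagonal_antisym:
  fixes t :: "'v::linorder \<Rightarrow> 'v \<Rightarrow> 'a::comm_ring_1"
  assumes "finite F" and "\<And>v w. v \<in> F \<Longrightarrow> w \<in> F \<Longrightarrow> v < w \<Longrightarrow> t v w + t w v = 0"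
  shows "(\<Sum>v\<in>F. \<Sum>w\<in>F - {v}. t v w) = 0"
proof -
  have "(\<Sum>v\<in>F. \<Sum>w\<in>F - {v}. t v w)
      = (\<Sum>v\<in>F. \<Sum>w\<in>F. (if v < w then t v w else 0) + (if w < v then t v w else 0))"
  proof (rule sum.cong[OF refl])
    fix v assume "v \<in> F"
    have "(\<Sum>w\<in>F. (if v < w then t v w else 0) + (if w < v then t v w else 0))
       = (\<Sum>w\<in>F - {v}. (if v < w then t v w else 0) + (if w < v then t v w else 0))"
      by (rule sum.mono_neutral_right) (use assms(1) in auto)
    also have "\<dots> = (\<Sum>w\<in>F - {v}. t v w)"
      by (rule sum.cong) auto
    finally show "(\<Sum>w\<in>F - {v}. t v w)
       = (\<Sum>w\<in>F. (if v < w then t v w else 0) + (if w < v then t v w else 0))" by simp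
  qed
  also have "\<dots> = (\<Sum>v\<in>F. \<Sum>w\<in>F. if v < w then t v w else 0)
      + (\<Sum>v\<in>F. \<Sum>w\<in>F. if w < v then t v w else 0)"
    by (simp add: sum.distrib)
  also have "(\<Sum>v\<in>F. \<Sum>w\<in>F. if w < v then t v w else 0)
      = (\<Sum>v\<in>F. \<Sum>w\<in>F. if v < w then t w v else 0)"
    by (rule sum.swap)
  also have "(\<Sum>v\<in>F. \<Sum>w\<in>F. if v < w then t v w else 0) + \<dots>
      = (\<Sum>v\<in>F. \<Sum>w\<in>F. if v < w then t v w + t w v else 0)"
    unfolding sum.distrib[symmetric] by (intro sum.cong refl) auto
  also have "\<dots> = 0"
    by (intro sum.neutral ballI) (use assms(2) in auto)
  finally show ?thesis .
qed

lemma koszul_koszul: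
  assumes "finite F"
  shows "koszul x (koszul x z) F = 0"
proof -
  define t where "t v w = ksgn v (F - {v}) * ksgn w (F - {v} - {w}) * (x v * x w * z (F - {v} - {w}))" for v w
  have "koszul x (koszul x z) F = (\<Sum>v\<in>F. \<Sum>w\<in>F - {v}. t v w)"
    unfolding koszul_def t_def by (simp add: sum_distrib_left mult_ac)
  also have "\<dots> = 0"
  proof (rule sum_offdiagonal_antisym[OF assms])
    fix v w assume vw: "v \<in> F" "w \<in> F" "v < w"
    define F' where "F' = F - {v} - {w}"
    have eqs: "F - {v} = insert w F'" "F - {w} = insert v F'" "F - {w} - {v} = F'"
      "F - {v} - {w} = F'" "v \<notin> F'" "w \<notin> F'" "finite F'"
      using vw assms unfolding F'_def by auto
    have s: "ksgn w F' * ksgn v (insert w F') = - (ksgn v F' * ksgn w (insert v F') :: 'b)"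
      by (rule ksgn_exchange) (use eqs vw in auto)
    have "t v w + t w v = (ksgn w F' * ksgn v (insert w F') + ksgn v F' * ksgn w (insert v F'))
        * (x v * x w * z F')"
    proof -
      have "t v w = ksgn v (insert w F') * ksgn w F' * (x v * x w * z F')"
        unfolding t_def eqs(4) unfolding eqs(1) ..
      moreover have "t w v = ksgn w (insert v F') * ksgn v F' * (x w * x v * z F')"
        unfolding t_def eqs(3) unfolding eqs(2) ..
      ultimately show ?thesis by (simp add: algebra_simps)
    qed
    also have "\<dots> = 0" unfolding s by simp
    finally show "t v w + t w v = 0" .
  qed
  finally show ?thesis .
qed

lemma koszul_diff: "koszul x (\<lambda>F. y F - z F) F = koszul x y F - koszul x z F"
  by (simp add: koszul_def right_diff_distrib sum_subtractf)

lemma koszul_add: "koszul x (\<lambda>F. y F + z F) F = koszul x y F + koszul x z F"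
  by (simp add: koszul_def distrib_left sum.distrib)

lemma koszul_scale: "koszul x (\<lambda>F. f * z F) F = f * koszul x z F"
  by (simp add: koszul_def sum_distrib_left mult_ac)

lemma koszul_empty [simp]: "koszul x z {} = 0"
  by (simp add: koszul_def)

text \<open>
  Contraction of a cochain against \<open>g\<close>, which lowers the degree by one.
\<close>

definition contraction :: "'v::linorder set \<Rightarrow> ('v \<Rightarrow> 'a::comm_ring_1) \<Rightarrow> ('v set \<Rightarrow> 'a) \<Rightarrow> 'v set \<Rightarrow> 'a" where
  "contraction V g z F = (\<Sum>v\<in>V - F. ksgn v F * g v * z (insert v F))"

text \<open>
  The contraction is a homotopy between zero and multiplication by \<open>\<Sum>\<^sub>v g\<^sub>v x\<^sub>v\<close>. Hence every
  element of the ideal generated by \<open>x\<close> annihilates Koszul cohomology.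
\<close>

lemma koszul_contraction:
  assumes "finite V" "F \<subseteq> V"
  shows "koszul x (contraction V g z) F + contraction V g (koszul x z) F
      = (\<Sum>v\<in>V. g v * x v) * z F"
proof -
  have finF: "finite F" using assms finite_subset by blast
  let ?A = "\<lambda>w v. ksgn w (F - {w}) * ksgn v (F - {w}) * (x w * g v * z (insert v (F - {w})))"
  have "koszul x (contraction V g z) F
      = (\<Sum>w\<in>F. \<Sum>v\<in>V - (F - {w}). ?A w v)"
    unfolding koszul_def contraction_def by (simp add: sum_distrib_left mult_ac)
  also have "\<dots> = (\<Sum>w\<in>F. ?A w w + (\<Sum>v\<in>V - F. ?A w v))"
  proof (rule sum.cong[OF refl])
    fix w assume w: "w \<in> F"
    then have "V - (F - {w}) = insert w (V - F)" using assms by auto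
    then show "(\<Sum>v\<in>V - (F - {w}). ?A w v) = ?A w w + (\<Sum>v\<in>V - F. ?A w v)"
      using assms w by (simp add: sum.insert)
  qed
  also have "\<dots> = (\<Sum>w\<in>F. g w * x w * z F) + (\<Sum>w\<in>F. \<Sum>v\<in>V - F. ?A w v)"
    by (simp add: sum.distrib insert_absorb mult_ac cong: sum.cong)
  finally have 1: "koszul x (contraction V g z) F
     = (\<Sum>w\<in>F. g w * x w * z F) + (\<Sum>w\<in>F. \<Sum>v\<in>V - F. ?A w v)" .
  let ?B = "\<lambda>v w. ksgn v F * ksgn w (insert v F - {w}) * (g v * x w * z (insert v F - {w}))"
  have "contraction V g (koszul x z) F = (\<Sum>v\<in>V - F. \<Sum>w\<in>insert v F. ?B v w)"
    unfolding koszul_def contraction_def by (simp add: sum_distrib_left mult_ac)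
  also have "\<dots> = (\<Sum>v\<in>V - F. g v * x v * z F - (\<Sum>w\<in>F. ?A w v))"
  proof (rule sum.cong[OF refl])
    fix v assume v: "v \<in> V - F"
    have "(\<Sum>w\<in>insert v F. ?B v w) = ?B v v + (\<Sum>w\<in>F. ?B v w)"
      using v finF by (simp add: sum.insert)
    also have "?B v v = g v * x v * z F" using v by (simp add: mult_ac)
    also have "(\<Sum>w\<in>F. ?B v w) = (\<Sum>w\<in>F. - ?A w v)"
    proof (rule sum.cong[OF refl])
      fix w assume w: "w \<in> F"
      define F' where "F' = F - {w}"
      have F': "F = insert w F'" "w \<notin> F'" "v \<notin> F'" "v \<noteq> w" "finite F'"
        using w v finF unfolding F'_def by auto
      have e: "insert v F - {w} = insert v F'" using F' by auto
      have k: "ksgn w (insert v F') * ksgn v (insert w F') = - (ksgn v F' * ksgn w F' :: 'b)"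
        by (rule ksgn_exchange_insert) (use F' in auto)
      have "?B v w = (ksgn w (insert v F') * ksgn v (insert w F')) * (g v * x w * z (insert v F'))"
        by (simp only: e F'(1)[symmetric]) (simp add: mult_ac)
      also have "\<dots> = - ?A w v"
        unfolding k F'_def[symmetric] by (simp add: mult_ac)
      finally show "?B v w = - ?A w v" .
    qed
    finally show "(\<Sum>w\<in>insert v F. ?B v w) = g v * x v * z F - (\<Sum>w\<in>F. ?A w v)"
      by (simp add: sum_negf)
  qed
  also have "\<dots> = (\<Sum>v\<in>V - F. g v * x v * z F) - (\<Sum>w\<in>F. \<Sum>v\<in>V - F. ?A w v)"
    by (simp add: sum_subtractf) (rule sum.swap)
  finally have 2: "contraction V g (koszul x z) F
     = (\<Sum>v\<in>V - F. g v * x v * z F) - (\<Sum>w\<in>F. \<Sum>v\<in>V - F. ?A w v)" .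
  have "(\<Sum>w\<in>F. g w * x w * z F) + (\<Sum>v\<in>V - F. g v * x v * z F) = (\<Sum>v\<in>V. g v * x v * z F)"
    using sum.subset_diff[OF assms(2,1), of "\<lambda>v. g v * x v * z F"] by (simp only: add.commute)
  then show ?thesis unfolding 1 2 sum_distrib_right by simp
qed

text \<open>
  A subring given as a subset of a type: polynomials in a fixed finite set of variables form such a
  subset, and their arithmetic is that of the ambient type.
\<close>

locale carrier_ring =
  fixes R :: "'a::comm_ring_1 set"
  assumes one_closed [simp, intro]: "1 \<in> R"
    and add_closed [simp, intro]: "a \<in> R \<Longrightarrow> b \<in> R \<Longrightarrow> a + b \<in> R"
    and mult_closed [simp, intro]: "a \<in> R \<Longrightarrow> b \<in> R \<Longrightarrow> a * b \<in> R"
    and uminus_closed [simp, intro]: "a \<in> R \<Longrightarrow> - a \<in> R"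
begin

lemma zero_closed [simp, intro]: "0 \<in> R"
  using add_closed[OF one_closed uminus_closed[OF one_closed]] by simp

lemma diff_closed [simp, intro]: "a \<in> R \<Longrightarrow> b \<in> R \<Longrightarrow> a - b \<in> R"
  using add_closed[of a "- b"] by simp

lemma sum_closed [intro]: "(\<And>i. i \<in> A \<Longrightarrow> f i \<in> R) \<Longrightarrow> sum f A \<in> R"
  by (induction A rule: infinite_finite_induct) auto

lemma power_closed [simp, intro]: "a \<in> R \<Longrightarrow> a ^ m \<in> R"
  by (induction m) auto

lemma ksgn_closed [simp, intro]: "ksgn v F \<in> R"
  by (simp add: ksgn_def)

lemma koszul_closed:
  "(\<And>v. v \<in> F \<Longrightarrow> x v \<in> R) \<Longrightarrow> (\<And>F. z F \<in> R) \<Longrightarrow> koszul x z F \<in> R"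
  unfolding koszul_def by (intro sum_closed mult_closed) auto

lemma contraction_closed:
  "(\<And>v. v \<in> V \<Longrightarrow> g v \<in> R) \<Longrightarrow> (\<And>F. z F \<in> R) \<Longrightarrow> contraction V g z F \<in> R"
  unfolding contraction_def by (intro sum_closed mult_closed) auto

definition ideal_in :: "'a set \<Rightarrow> bool" where
  "ideal_in L \<longleftrightarrow> L \<subseteq> R \<and> 0 \<in> L \<and> (\<forall>a\<in>L. \<forall>b\<in>L. a + b \<in> L) \<and> (\<forall>r\<in>R. \<forall>a\<in>L. r * a \<in> L)"

lemma ideal_inD:
  assumes "ideal_in L"
  shows "L \<subseteq> R" "0 \<in> L" "\<And>a b. a \<in> L \<Longrightarrow> b \<in> L \<Longrightarrow> a + b \<in> L"
    "\<And>r a. r \<in> R \<Longrightarrow> a \<in> L \<Longrightarrow> r * a \<in> L" "\<And>a. a \<in> L \<Longrightarrow> - a \<in> L"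
    "\<And>a b. a \<in> L \<Longrightarrow> b \<in> L \<Longrightarrow> a - b \<in> L"
proof -
  show L: "L \<subseteq> R" "0 \<in> L" "\<And>a b. a \<in> L \<Longrightarrow> b \<in> L \<Longrightarrow> a + b \<in> L"
    "\<And>r a. r \<in> R \<Longrightarrow> a \<in> L \<Longrightarrow> r * a \<in> L"
    using assms unfolding ideal_in_def by auto
  show m: "\<And>a. a \<in> L \<Longrightarrow> - a \<in> L" using L(4)[of "-1"] by simp
  show "\<And>a b. a \<in> L \<Longrightarrow> b \<in> L \<Longrightarrow> a - b \<in> L" using L(3) m by fastforce
qed

lemma ideal_in_sum:
  assumes "ideal_in L" "\<And>i. i \<in> A \<Longrightarrow> f i \<in> L"
  shows "sum f A \<in> L"
  using assms(2) by (induction A rule: infinite_finite_induct)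
    (auto intro: ideal_inD[OF assms(1)])

lemma koszul_in_ideal:
  assumes "ideal_in L" "\<And>v. v \<in> F \<Longrightarrow> x v \<in> R" "\<And>v. v \<in> F \<Longrightarrow> z (F - {v}) \<in> L"
  shows "koszul x z F \<in> L"
  unfolding koszul_def
  by (intro ideal_in_sum[OF assms(1)] ideal_inD(4)[OF assms(1)] mult_closed)
    (use assms in auto)

definition adjoin :: "'a set \<Rightarrow> 'a \<Rightarrow> 'a set" where
  "adjoin L f = {a + f * r | a r. a \<in> L \<and> r \<in> R}"

lemma adjoinI: "a \<in> L \<Longrightarrow> r \<in> R \<Longrightarrow> a + f * r \<in> adjoin L f"
  unfolding adjoin_def by auto

lemma subset_adjoin: "L \<subseteq> adjoin L f"
  using adjoinI[of _ L 0 f] by auto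

lemma ideal_in_adjoin:
  assumes L: "ideal_in L" and f: "f \<in> R"
  shows "ideal_in (adjoin L f)"
  unfolding ideal_in_def
proof (intro conjI ballI)
  show "adjoin L f \<subseteq> R" using ideal_inD(1)[OF L] f unfolding adjoin_def by auto
  show "0 \<in> adjoin L f" using ideal_inD(2)[OF L] subset_adjoin by auto
next
  fix a b assume "a \<in> adjoin L f" "b \<in> adjoin L f"
  then obtain a' r b' s where "a = a' + f * r" "b = b' + f * s" "a' \<in> L" "b' \<in> L" "r \<in> R" "s \<in> R"
    unfolding adjoin_def by auto
  then have "a + b = (a' + b') + f * (r + s)" "a' + b' \<in> L" "r + s \<in> R"
    using ideal_inD(3)[OF L] by (auto simp: algebra_simps)
  then show "a + b \<in> adjoin L f" using adjoinI by metis
next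
  fix s a assume s: "s \<in> R" and "a \<in> adjoin L f"
  then obtain a' r where "a = a' + f * r" "a' \<in> L" "r \<in> R"
    unfolding adjoin_def by auto
  then have "s * a = s * a' + f * (s * r)" "s * a' \<in> L" "s * r \<in> R"
    using ideal_inD(4)[OF L s, of a'] s mult_closed[OF s, of r] by (auto simp only: distrib_left mult.left_commute)
  then show "s * a \<in> adjoin L f" using adjoinI by metis
qed

text \<open>
  Regularity of a sequence modulo \<open>L\<close>, in the recursive form that suits induction: the first element
  is moved into the modulus.
\<close>

primrec regseq :: "'a set \<Rightarrow> 'a list \<Rightarrow> bool" where
  "regseq L [] \<longleftrightarrow> L \<noteq> R"
| "regseq L (f # fs) \<longleftrightarrow> (\<forall>p\<in>R. f * p \<in> L \<longrightarrow> p \<in> L) \<and> regseq (adjoin L f) fs"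

text \<open>
  The cohomology group \<open>H\<^sup>i(x; R/L)\<close> is zero. Cochains of \<open>R/L\<close> are represented by cochains of
  \<open>R\<close>, and all equations hold modulo \<open>L\<close>.
\<close>

definition koszul_vanishes :: "('v::linorder \<Rightarrow> 'a) \<Rightarrow> 'v set \<Rightarrow> 'a set \<Rightarrow> nat \<Rightarrow> bool" where
  "koszul_vanishes x V L i \<longleftrightarrow>
     (\<forall>z. (\<forall>F. z F \<in> R) \<longrightarrow> (\<forall>F. F \<subseteq> V \<and> card F = Suc i \<longrightarrow> koszul x z F \<in> L) \<longrightarrow>
       (\<exists>y. (\<forall>F. y F \<in> R) \<and> (\<forall>F. F \<subseteq> V \<and> card F = i \<longrightarrow> z F - koszul x y F \<in> L)))"

lemma koszul_vanishesD:
  assumes "koszul_vanishes x V L i" "\<And>F. z F \<in> R"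
    "\<And>F. F \<subseteq> V \<Longrightarrow> card F = Suc i \<Longrightarrow> koszul x z F \<in> L"
  obtains y where "\<And>F. y F \<in> R" "\<And>F. F \<subseteq> V \<Longrightarrow> card F = i \<Longrightarrow> z F - koszul x y F \<in> L"
  using assms unfolding koszul_vanishes_def by metis

context
  fixes V :: "'v::linorder set" and x :: "'v \<Rightarrow> 'a"
  assumes finV: "finite V" and xR: "\<And>v. v \<in> V \<Longrightarrow> x v \<in> R"
begin

text \<open>
  This is exactness of \<open>H\<^sup>i\<^sup>-\<^sup>1(R/(L, f)) \<rightarrow> H\<^sup>i(R/L) \<rightarrow> H\<^sup>i(R/L)\<close>, the second map being
  multiplication by \<open>f\<close>: it is injective if the left group is zero. In terms of representatives,
  if \<open>f z = \<partial>w\<close> modulo \<open>L\<close>, then \<open>w\<close> is a cocycle modulo \<open>(L, f)\<close>, so \<open>w = \<partial>u + f t\<close> and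
  \<open>f (z - \<partial>t) \<in> L\<close>.
\<close>

lemma koszul_multiple_boundary:
  assumes L: "ideal_in L" and fR: "f \<in> R" and reg: "\<And>p. p \<in> R \<Longrightarrow> f * p \<in> L \<Longrightarrow> p \<in> L"
    and van: "\<And>j. Suc j = i \<Longrightarrow> koszul_vanishes x V (adjoin L f) j"
    and z: "\<And>F. z F \<in> R" and w: "\<And>F. w F \<in> R"
    and fz: "\<And>F. F \<subseteq> V \<Longrightarrow> card F = i \<Longrightarrow> f * z F - koszul x w F \<in> L"
  shows "\<exists>y. (\<forall>F. y F \<in> R) \<and> (\<forall>F. F \<subseteq> V \<and> card F = i \<longrightarrow> z F - koszul x y F \<in> L)"
proof (cases i)
  case 0
  have "z {} \<in> L" using fz[of "{}"] 0 reg z by auto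
  moreover have "F = {}" if "F \<subseteq> V" "card F = i" for F
  proof -
    have "finite F" using that(1) finV by (rule finite_subset)
    then show ?thesis using that(2) 0 by simp
  qed
  ultimately have "\<forall>F. F \<subseteq> V \<and> card F = i \<longrightarrow> z F - koszul x (\<lambda>_. 0) F \<in> L"
    by (auto simp: koszul_def)
  then show ?thesis by (intro exI[of _ "\<lambda>_. 0"]) auto
next
  case (Suc j)
  have cyc: "koszul x w F \<in> adjoin L f" if F: "F \<subseteq> V" "card F = Suc j" for F
  proof -
    have "- (f * z F - koszul x w F) + f * z F \<in> adjoin L f"
    proof (rule adjoinI)
      show "- (f * z F - koszul x w F) \<in> L" using F Suc by (simp only: ideal_inD(5)[OF L] fz)
      show "z F \<in> R" by (rule z)
    qed
    then show ?thesis by simp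
  qed
  obtain u where u: "\<And>F. u F \<in> R"
    "\<And>F. F \<subseteq> V \<Longrightarrow> card F = j \<Longrightarrow> w F - koszul x u F \<in> adjoin L f"
    using koszul_vanishesD[OF van[OF Suc[symmetric]] w cyc] by blast
  have "\<exists>a t. a \<in> L \<and> t \<in> R \<and> (F \<subseteq> V \<and> card F = j \<longrightarrow> w F - koszul x u F = a + f * t)" for F
  proof (cases "F \<subseteq> V \<and> card F = j")
    case True
    then have "w F - koszul x u F \<in> adjoin L f" using u(2) by blast
    then show ?thesis unfolding adjoin_def by blast
  next
    case False
    then show ?thesis using ideal_inD(2)[OF L] by blast
  qed
  then obtain a t where at: "\<And>F. a F \<in> L" "\<And>F. t F \<in> R"
    "\<And>F. F \<subseteq> V \<Longrightarrow> card F = j \<Longrightarrow> w F - koszul x u F = a F + f * t F"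
    by metis
  have "z F - koszul x t F \<in> L" if F: "F \<subseteq> V" "card F = i" for F
  proof -
    have finF: "finite F" using F finV finite_subset by blast
    have xF: "\<And>v. v \<in> F \<Longrightarrow> x v \<in> R" using xR F by auto
    have "koszul x w F = koszul x (\<lambda>F. koszul x u F + (a F + f * t F)) F"
      unfolding koszul_def[of x _ F]
    proof (rule sum.cong[OF refl])
      fix v assume v: "v \<in> F"
      then have "F - {v} \<subseteq> V" "card (F - {v}) = j" using F Suc finF by auto
      then have "w (F - {v}) = koszul x u (F - {v}) + (a (F - {v}) + f * t (F - {v}))"
        using at(3)[of "F - {v}"] by (simp add: algebra_simps)
      then show "ksgn v (F - {v}) * x v * w (F - {v}) = ksgn v (F - {v}) * x v *
        (koszul x u (F - {v}) + (a (F - {v}) + f * t (F - {v})))" by simp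
    qed
    also have "\<dots> = koszul x a F + f * koszul x t F"
      by (simp add: koszul_add koszul_koszul[OF finF] koszul_scale)
    finally have "f * (z F - koszul x t F) = (f * z F - koszul x w F) + koszul x a F"
      by (simp add: algebra_simps)
    also have "\<dots> \<in> L"
      by (intro ideal_inD(3)[OF L] fz F koszul_in_ideal[OF L]) (use xF at in auto)
    finally have "f * (z F - koszul x t F) \<in> L" .
    moreover have "z F - koszul x t F \<in> R"
      by (intro diff_closed z koszul_closed xF at(2))
    ultimately show ?thesis using reg by simp
  qed
  then show ?thesis using at(2) by blast
qed

text \<open>
  The first element \<open>f\<close> of the sequence acts injectively on \<open>H\<^sup>i\<close> by induction and the previous
  lemma. A power of \<open>f\<close> lies in the ideal generated by \<open>x\<close> and acts as zero. So \<open>H\<^sup>i = 0\<close>.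
\<close>

lemma regseq_imp_koszul_vanishes:
  assumes "regseq L fs" "ideal_in L" "i < length fs"
    and "\<And>f. f \<in> set fs \<Longrightarrow> f \<in> R \<and> (\<exists>m g. (\<forall>v\<in>V. g v \<in> R) \<and> f ^ m = (\<Sum>v\<in>V. g v * x v))"
  shows "koszul_vanishes x V L i"
  using assms
proof (induction fs arbitrary: L i)
  case Nil
  then show ?case by simp
next
  case (Cons f fs)
  note L = Cons.prems(2)
  have fR: "f \<in> R" using Cons.prems by auto
  obtain m g where g: "\<And>v. v \<in> V \<Longrightarrow> g v \<in> R" "f ^ m = (\<Sum>v\<in>V. g v * x v)"
    using Cons.prems(4)[of f] by auto
  have reg: "\<And>p. p \<in> R \<Longrightarrow> f * p \<in> L \<Longrightarrow> p \<in> L" using Cons.prems(1) by auto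
  have van: "koszul_vanishes x V (adjoin L f) j" if "Suc j = i" for j
    using that Cons.prems by (intro Cons.IH ideal_in_adjoin) auto
  show ?case unfolding koszul_vanishes_def
  proof (intro allI impI)
    fix z assume z: "\<forall>F. z F \<in> R"
      and cyc: "\<forall>F. F \<subseteq> V \<and> card F = Suc i \<longrightarrow> koszul x z F \<in> L"
    let ?bd = "\<lambda>z. \<exists>y. (\<forall>F. y F \<in> R) \<and> (\<forall>F. F \<subseteq> V \<and> card F = i \<longrightarrow> z F - koszul x y F \<in> L)"
    have "?bd (\<lambda>F. f ^ m * z F)"
    proof (intro exI[of _ "contraction V g z"] conjI allI impI)
      show "contraction V g z F \<in> R" for F
        by (rule contraction_closed) (use g z in auto)
      fix F assume F: "F \<subseteq> V \<and> card F = i"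
      then have finF: "finite F" using finV finite_subset by blast
      have "f ^ m * z F - koszul x (contraction V g z) F = contraction V g (koszul x z) F"
        using koszul_contraction[OF finV, of F x g z] F by (simp add: g(2) algebra_simps)
      also have "\<dots> \<in> L" unfolding contraction_def
        by (intro ideal_in_sum[OF L] ideal_inD(4)[OF L] mult_closed ksgn_closed cyc[rule_format])
          (use F g finF in auto)
      finally show "f ^ m * z F - koszul x (contraction V g z) F \<in> L" .
    qed
    moreover have "?bd (\<lambda>F. f ^ m * z F) \<Longrightarrow> ?bd z"
    proof (induction m)
      case (Suc m)
      from Suc.prems obtain w where w: "\<And>F. w F \<in> R"
        "\<And>F. F \<subseteq> V \<Longrightarrow> card F = i \<Longrightarrow> f * (f ^ m * z F) - koszul x w F \<in> L"
        by (auto simp: mult.assoc)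
      have "?bd (\<lambda>F. f ^ m * z F)"
        by (rule koszul_multiple_boundary[OF L fR reg van _ w]) (use z fR in auto)
      then show ?case by (rule Suc.IH)
    qed simp
    ultimately show "?bd z" by blast
  qed
qed

text \<open>
  The next part of the same long exact sequence: \<open>H\<^sup>i(R/(L, f))\<close> lies between \<open>H\<^sup>i(R/L)\<close> and
  \<open>H\<^sup>i\<^sup>+\<^sup>1(R/L)\<close>.
\<close>

lemma koszul_vanishes_adjoin:
  assumes L: "ideal_in L" and fR: "f \<in> R" and reg: "\<And>p. p \<in> R \<Longrightarrow> f * p \<in> L \<Longrightarrow> p \<in> L"
    and van: "koszul_vanishes x V L i" "koszul_vanishes x V L (Suc i)"
  shows "koszul_vanishes x V (adjoin L f) i"
  unfolding koszul_vanishes_def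
proof (intro allI impI)
  fix z assume z: "\<forall>F. z F \<in> R"
    and cyc: "\<forall>F. F \<subseteq> V \<and> card F = Suc i \<longrightarrow> koszul x z F \<in> adjoin L f"
  have "\<exists>a t. a \<in> L \<and> t \<in> R \<and> (F \<subseteq> V \<and> card F = Suc i \<longrightarrow> koszul x z F = a + f * t)" for F
  proof (cases "F \<subseteq> V \<and> card F = Suc i")
    case True
    then have "koszul x z F \<in> adjoin L f" using cyc by blast
    then show ?thesis unfolding adjoin_def by blast
  next
    case False
    then show ?thesis using ideal_inD(2)[OF L] by blast
  qed
  then obtain a t where at: "\<And>F. a F \<in> L" "\<And>F. t F \<in> R"
    "\<And>F. F \<subseteq> V \<Longrightarrow> card F = Suc i \<Longrightarrow> koszul x z F = a F + f * t F"
    by metis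
  have "koszul x t F \<in> L" if F: "F \<subseteq> V" "card F = Suc (Suc i)" for F
  proof -
    have finF: "finite F" using F finV finite_subset by blast
    have xF: "\<And>v. v \<in> F \<Longrightarrow> x v \<in> R" using xR F by auto
    have "0 = koszul x (koszul x z) F" by (simp add: koszul_koszul[OF finF])
    also have "\<dots> = koszul x (\<lambda>F. a F + f * t F) F"
      unfolding koszul_def[of x _ F]
    proof (rule sum.cong[OF refl])
      fix v assume v: "v \<in> F"
      then have "F - {v} \<subseteq> V" "card (F - {v}) = Suc i" using F finF by auto
      then show "ksgn v (F - {v}) * x v * koszul x z (F - {v}) = ksgn v (F - {v}) * x v *
        (a (F - {v}) + f * t (F - {v}))" using at(3) by simp
    qed
    also have "\<dots> = koszul x a F + f * koszul x t F"
      by (simp add: koszul_add koszul_scale)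
    finally have "f * koszul x t F = - koszul x a F" by (simp add: algebra_simps add_eq_0_iff)
    also have "\<dots> \<in> L"
      by (intro ideal_inD(5)[OF L] koszul_in_ideal[OF L]) (use xF at in auto)
    finally have "f * koszul x t F \<in> L" .
    moreover have "koszul x t F \<in> R"
      by (intro koszul_closed xF at(2))
    ultimately show ?thesis using reg by simp
  qed
  then obtain u where u: "\<And>F. u F \<in> R"
    "\<And>F. F \<subseteq> V \<Longrightarrow> card F = Suc i \<Longrightarrow> t F - koszul x u F \<in> L"
    using koszul_vanishesD[OF van(2), of t] at(2) by blast
  have "koszul x (\<lambda>F. z F - f * u F) F \<in> L" if F: "F \<subseteq> V" "card F = Suc i" for F
  proof -
    have "koszul x (\<lambda>F. z F - f * u F) F = a F + f * (t F - koszul x u F)"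
      using at(3)[OF F] by (simp add: koszul_diff koszul_scale algebra_simps)
    also have "\<dots> \<in> L" by (intro ideal_inD(3)[OF L] ideal_inD(4)[OF L] at fR u F)
    finally show ?thesis .
  qed
  moreover have "z F - f * u F \<in> R" for F using z u(1) fR by auto
  ultimately obtain y where y: "\<And>F. y F \<in> R"
    "\<And>F. F \<subseteq> V \<Longrightarrow> card F = i \<Longrightarrow> z F - f * u F - koszul x y F \<in> L"
    using koszul_vanishesD[OF van(1), of "\<lambda>F. z F - f * u F"] by blast
  have "z F - koszul x y F \<in> adjoin L f" if "F \<subseteq> V" "card F = i" for F
    using adjoinI[OF y(2)[OF that] u(1), of f F] by (simp add: algebra_simps)
  then show "\<exists>y. (\<forall>F. y F \<in> R) \<and> (\<forall>F. F \<subseteq> V \<and> card F = i \<longrightarrow> z F - koszul x y F \<in> adjoin L f)"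
    using y(1) by blast
qed

text \<open>
  Vanishing in degree \<open>0\<close> says that no nonzero element of \<open>R/L\<close> is killed by all of \<open>x\<close>, hence none
  by \<open>A\<close>. The assumption \<open>nzd\<close> turns this into a nonzerodivisor \<open>f \<in> A\<close>, and vanishing is
  inherited by \<open>R/(L, f)\<close> in one degree less.
\<close>

lemma koszul_vanishes_imp_regseq:
  assumes nzd: "\<And>L. ideal_in L \<Longrightarrow> L \<subseteq> A \<Longrightarrow>
        (\<And>z. z \<in> R \<Longrightarrow> (\<And>f. f \<in> A \<Longrightarrow> f * z \<in> L) \<Longrightarrow> z \<in> L) \<Longrightarrow>
        \<exists>f\<in>A. \<forall>p\<in>R. f * p \<in> L \<longrightarrow> p \<in> L"
    and A: "ideal_in A" "A \<noteq> R" and xA: "\<And>v. v \<in> V \<Longrightarrow> x v \<in> A"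
    and "ideal_in L" "L \<subseteq> A" "\<And>i. i < d \<Longrightarrow> koszul_vanishes x V L i"
  shows "\<exists>fs. length fs = d \<and> set fs \<subseteq> A \<and> regseq L fs"
  using assms(5-)
proof (induction d arbitrary: L)
  case 0
  then have "L \<noteq> R" using A ideal_inD(1)[OF A(1)] by auto
  then show ?case by (intro exI[of _ "[]"]) auto
next
  case (Suc d)
  note L = Suc.prems(1)
  have "z \<in> L" if z: "z \<in> R" "\<And>f. f \<in> A \<Longrightarrow> f * z \<in> L" for z
  proof -
    have "koszul x (\<lambda>_. z) F \<in> L" if F: "F \<subseteq> V" "card F = Suc 0" for F
    proof -
      obtain v where "F = {v}" using F card_1_singletonE by (metis One_nat_def)
      then have "koszul x (\<lambda>_. z) F = x v * z" "v \<in> V" using F by (simp_all add: koszul_def ksgn_def)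
      then show ?thesis using z(2)[OF xA] by simp
    qed
    then obtain y where "\<And>F. F \<subseteq> V \<Longrightarrow> card F = 0 \<Longrightarrow> z - koszul x y F \<in> L"
      using koszul_vanishesD[of x V L 0 "\<lambda>_. z"] Suc.prems(3)[of 0] z(1) by (metis zero_less_Suc)
    from this[of "{}"] show "z \<in> L" by simp
  qed
  then obtain f where f: "f \<in> A" "\<And>p. p \<in> R \<Longrightarrow> f * p \<in> L \<Longrightarrow> p \<in> L"
    using nzd[OF L Suc.prems(2)] by blast
  have fR: "f \<in> R" using f ideal_inD(1)[OF A(1)] by auto
  have "adjoin L f \<subseteq> A"
  proof
    fix a assume "a \<in> adjoin L f"
    then obtain b r where "a = b + r * f" "b \<in> L" "r \<in> R" unfolding adjoin_def by (auto simp: mult.commute)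
    then show "a \<in> A" using Suc.prems(2) f(1) ideal_inD(3,4)[OF A(1)] by auto
  qed
  then have "\<exists>fs. length fs = d \<and> set fs \<subseteq> A \<and> regseq (adjoin L f) fs"
  proof (rule Suc.IH[OF ideal_in_adjoin[OF L fR]])
    fix i assume "i < d"
    then show "koszul_vanishes x V (adjoin L f) i"
      using Suc.prems(3) by (intro koszul_vanishes_adjoin[OF L fR f(2)]) auto
  qed
  then obtain fs where "length fs = d \<and> set fs \<subseteq> A \<and> regseq (adjoin L f) fs" by blast
  then show ?case using f by (intro exI[of _ "f # fs"]) auto
qed

end

end

section \<open>Nonzerodivisors modulo an ideal of a Noetherian ring\<close>

context carrier_ring
begin

text \<open>
  The ascending chain condition for ideals generated by initial segments of a sequence. In this form
  it gives both a maximal annihilator and the finiteness of the set of maximal annihilators.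
\<close>

definition noetherian :: bool where
  "noetherian \<longleftrightarrow> (\<forall>p :: nat \<Rightarrow> 'a. (\<forall>k. p k \<in> R) \<longrightarrow>
     (\<exists>k r. (\<forall>j. r j \<in> R) \<and> p k = (\<Sum>j<k. r j * p j)))"

lemma noetherianD:
  fixes p :: "nat \<Rightarrow> 'a"
  assumes noetherian "\<And>k. p k \<in> R"
  shows "\<exists>k r. (\<forall>j. r j \<in> R) \<and> p k = (\<Sum>j<k. r j * p j)"
  using assms unfolding noetherian_def by simp

definition prime_in :: "'a set \<Rightarrow> bool" where
  "prime_in P \<longleftrightarrow> ideal_in P \<and> 1 \<notin> P \<and> (\<forall>a\<in>R. \<forall>b\<in>R. a * b \<in> P \<longrightarrow> a \<in> P \<or> b \<in> P)"

lemma prime_in_prod: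
  assumes "prime_in P" "finite J" "\<And>j. j \<in> J \<Longrightarrow> a j \<in> R" "\<And>j. j \<in> J \<Longrightarrow> a j \<notin> P"
  shows "prod a J \<notin> P \<and> prod a J \<in> R"
  using assms(2-4)
  by (induction J rule: finite_induct) (use assms(1) in \<open>auto simp: prime_in_def\<close>)

lemma prod_closed: "(\<And>j. j \<in> J \<Longrightarrow> a j \<in> R) \<Longrightarrow> prod a J \<in> R"
  by (induction J rule: infinite_finite_induct) auto

lemma prod_in_ideal:
  assumes "ideal_in L" "finite J" "\<And>j. j \<in> J \<Longrightarrow> a j \<in> R" "i \<in> J" "a i \<in> L"
  shows "prod a J \<in> L"
proof -
  have "prod a J = prod a (J - {i}) * a i"
    using assms(2,4) by (simp add: prod.remove mult.commute)
  moreover have "prod a (J - {i}) \<in> R"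
    by (rule prod_closed) (use assms(3) in auto)
  ultimately show ?thesis using ideal_inD(4)[OF assms(1)] assms(5) by simp
qed

text \<open>
  Induction on the number of primes. If the element found for the other primes lies in \<open>P\<close>, add to it
  an element of \<open>A\<close> that is in all the other primes but not in \<open>P\<close>; a product provides it,
  as \<open>P\<close> contains neither \<open>A\<close> nor any of the other primes.
\<close>

lemma prime_avoidance:
  assumes fin: "finite \<P>" and prime: "\<And>P. P \<in> \<P> \<Longrightarrow> prime_in P"
    and incomparable: "\<And>P Q. P \<in> \<P> \<Longrightarrow> Q \<in> \<P> \<Longrightarrow> P \<subseteq> Q \<Longrightarrow> P = Q"
    and A: "ideal_in A" and not_sub: "\<And>P. P \<in> \<P> \<Longrightarrow> \<not> A \<subseteq> P"
  shows "\<exists>f\<in>A. \<forall>P\<in>\<P>. f \<notin> P"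
  using assms
proof (induction \<P> rule: finite_induct)
  case empty
  then show ?case using ideal_inD(2)[OF A] by blast
next
  case (insert P \<Q>)
  have "\<exists>f\<in>A. \<forall>Q\<in>\<Q>. f \<notin> Q"
    by (rule insert.IH) (use insert.prems in blast)+
  then obtain f where f: "f \<in> A" "\<And>Q. Q \<in> \<Q> \<Longrightarrow> f \<notin> Q" by blast
  have P: "prime_in P" "ideal_in P" using insert.prems(1)[of P] by (auto simp: prime_in_def)
  have Q: "ideal_in Q" if "Q \<in> \<Q>" for Q
    using insert.prems(1)[of Q] that by (auto simp: prime_in_def)
  show ?case
  proof (cases "f \<in> P")
    case False
    then show ?thesis using f by auto
  next
    case True
    have "\<exists>a. a \<in> Q - P" if "Q \<in> \<Q>" for Q
      using insert.prems(2)[of Q P] insert.hyps that by blast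
    then obtain a where a: "\<And>Q. Q \<in> \<Q> \<Longrightarrow> a Q \<in> Q" "\<And>Q. Q \<in> \<Q> \<Longrightarrow> a Q \<notin> P"
      by (metis DiffE)
    have aR: "\<And>Q. Q \<in> \<Q> \<Longrightarrow> a Q \<in> R" using a(1) Q ideal_inD(1) by blast
    obtain b where b: "b \<in> A" "b \<notin> P" using insert.prems(4)[of P] by auto
    have bR: "b \<in> R" using b A ideal_inD(1) by blast
    define g where "g = prod a \<Q> * b"
    have prodP: "prod a \<Q> \<notin> P" "prod a \<Q> \<in> R"
      using prime_in_prod[OF P(1) insert.hyps(1), of a] aR a(2) by simp_all
    have gP: "g \<notin> P"
    proof
      assume "g \<in> P"
      then have "prod a \<Q> \<in> P \<or> b \<in> P"
        using P(1) prodP(2) bR unfolding g_def prime_in_def by simp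
      then show False using prodP(1) b(2) by simp
    qed
    have gA: "g \<in> A" using ideal_inD(4)[OF A] prodP b unfolding g_def by blast
    have gQ: "g \<in> Q" if "Q \<in> \<Q>" for Q
    proof -
      have "prod a \<Q> \<in> Q"
        by (rule prod_in_ideal[where i = Q]) (use Q[OF that] insert.hyps(1) aR that a(1) in simp_all)
      then show ?thesis
        using ideal_inD(4)[OF Q[OF that] bR] unfolding g_def by (simp add: mult.commute[of _ b])
    qed
    have "f + g \<notin> Q" if "Q \<in> \<Q>" for Q
      using ideal_inD(6)[OF Q[OF that], of "f + g" g] gQ[OF that] f(2)[OF that] by auto
    moreover have "f + g \<notin> P"
      using ideal_inD(6)[OF P(2), of "f + g" f] True gP by auto
    moreover have "f + g \<in> A" using ideal_inD(3)[OF A] f gA by auto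
    ultimately show ?thesis by auto
  qed
qed

text \<open>
  The colon ideal \<open>L : z\<close>, which is the annihilator of the class of \<open>z\<close> in \<open>R/L\<close>.
\<close>

definition annihilator :: "'a set \<Rightarrow> 'a \<Rightarrow> 'a set" where
  "annihilator L z = {f \<in> R. f * z \<in> L}"

lemma ideal_in_annihilator:
  assumes "ideal_in L" "z \<in> R"
  shows "ideal_in (annihilator L z)"
  using assms ideal_inD[OF assms(1)]
  by (subst ideal_in_def) (auto simp: annihilator_def distrib_right mult.assoc)

definition maximal_annihilator :: "'a set \<Rightarrow> 'a \<Rightarrow> bool" where
  "maximal_annihilator L z \<longleftrightarrow> z \<in> R - L \<and>
     (\<forall>y\<in>R - L. annihilator L z \<subseteq> annihilator L y \<longrightarrow> annihilator L y = annihilator L z)"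

text \<open>
  Otherwise there is a strictly increasing sequence of annihilators, and elements witnessing its
  strictness contradict the Noetherian condition.
\<close>

lemma ex_maximal_annihilator:
  assumes noetherian and L: "ideal_in L" and z: "z \<in> R - L"
  shows "\<exists>y. maximal_annihilator L y \<and> annihilator L z \<subseteq> annihilator L y"
proof (rule ccontr)
  assume no: "\<not> ?thesis"
  let ?Q = "\<lambda>y. y \<in> R - L \<and> annihilator L z \<subseteq> annihilator L y"
  have "\<exists>s. \<forall>k. ?Q (s k) \<and> annihilator L (s k) \<subset> annihilator L (s (Suc k))"
  proof (rule dependent_nat_choice)
    show "\<exists>y. ?Q y" using z by blast
    fix y and k :: nat assume y: "?Q y"
    then have "\<not> maximal_annihilator L y" using no by blast
    then obtain y' where "y' \<in> R - L" "annihilator L y \<subset> annihilator L y'"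
      using y unfolding maximal_annihilator_def by auto
    then show "\<exists>y'. ?Q y' \<and> annihilator L y \<subset> annihilator L y'" using y by blast
  qed
  then obtain s where s': "\<And>k. ?Q (s k) \<and> annihilator L (s k) \<subset> annihilator L (s (Suc k))"
    by (metis (no_types, lifting))
  have s: "\<And>k. s k \<in> R - L" "\<And>k. annihilator L (s k) \<subset> annihilator L (s (Suc k))"
    using s' by blast+
  have mono: "annihilator L (s i) \<subseteq> annihilator L (s j)" if "i \<le> j" for i j
    using lift_Suc_mono_le[of "\<lambda>k. annihilator L (s k)", OF _ that] s(2) by blast
  have "\<exists>p. p \<in> annihilator L (s (Suc k)) - annihilator L (s k)" for k
    using s(2)[of k] by auto
  then obtain p where p: "\<And>k. p k \<in> annihilator L (s (Suc k))" "\<And>k. p k \<notin> annihilator L (s k)"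
    by (metis DiffE)
  have pR: "p k \<in> R" for k using p(1)[of k] unfolding annihilator_def by auto
  have "\<exists>k r. (\<forall>j. r j \<in> R) \<and> p k = (\<Sum>j<k. r j * p j)"
    by (rule noetherianD[OF assms(1) pR])
  then obtain k r where r: "\<And>j. r j \<in> R" "p k = (\<Sum>j<k. r j * p j)"
    by auto
  have I: "ideal_in (annihilator L (s k))" using s(1) by (intro ideal_in_annihilator L) auto
  have "(\<Sum>j<k. r j * p j) \<in> annihilator L (s k)"
  proof (intro ideal_in_sum[OF I] ideal_inD(4)[OF I] r(1))
    fix j assume "j \<in> {..<k}"
    then have "Suc j \<le> k" by auto
    then show "p j \<in> annihilator L (s k)" using mono p(1) by blast
  qed
  then show False using p(2)[of k] r(2) by simp
qed

text \<open>
  If \<open>b z \<notin> L\<close>, then \<open>L : z \<subseteq> L : b z\<close>, so the two agree by maximality and \<open>a b z \<in> L\<close> gives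
  \<open>a z \<in> L\<close>.
\<close>

lemma prime_maximal_annihilator:
  assumes L: "ideal_in L" and z: "maximal_annihilator L z"
  shows "prime_in (annihilator L z)"
  unfolding prime_in_def
proof (intro conjI ballI impI)
  have zR: "z \<in> R" "z \<notin> L" using z unfolding maximal_annihilator_def by auto
  show "ideal_in (annihilator L z)" by (rule ideal_in_annihilator[OF L zR(1)])
  show "1 \<notin> annihilator L z" using zR unfolding annihilator_def by simp
  fix a b assume ab: "a \<in> R" "b \<in> R" "a * b \<in> annihilator L z"
  show "a \<in> annihilator L z \<or> b \<in> annihilator L z"
  proof (cases "b * z \<in> L")
    case True
    then show ?thesis using ab unfolding annihilator_def by auto
  next
    case False
    have "annihilator L z \<subseteq> annihilator L (b * z)"
      unfolding annihilator_def
      using ideal_inD(4)[OF L ab(2)] by (auto simp: mult.left_commute[of _ b])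
    then have "annihilator L (b * z) = annihilator L z"
      using z False ab(2) zR unfolding maximal_annihilator_def by auto
    moreover have "a \<in> annihilator L (b * z)"
      using ab unfolding annihilator_def by (auto simp: mult.assoc)
    ultimately show ?thesis by simp
  qed
qed

text \<open>
  Given infinitely many maximal annihilators \<open>P\<^sub>k = L : s\<^sub>k\<close>, some \<open>s\<^sub>k\<close> is a combination of
  the earlier ones, so \<open>P\<^sub>k\<close> contains the product of the \<open>P\<^sub>j\<close> with \<open>j < k\<close>. As \<open>P\<^sub>k\<close> is
  prime it contains one of them, and by maximality it equals that one.
\<close>

lemma finite_maximal_annihilators:
  assumes noetherian and L: "ideal_in L"
  shows "finite {annihilator L z | z. maximal_annihilator L z}" (is "finite ?P")
proof (rule ccontr)
  assume "infinite ?P"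
  then obtain P :: "nat \<Rightarrow> 'a set" where P: "inj P" "range P \<subseteq> ?P"
    using infinite_countable_subset by blast
  then have "\<forall>k. \<exists>z. maximal_annihilator L z \<and> P k = annihilator L z" by blast
  then obtain s where s: "\<And>k. maximal_annihilator L (s k)" "\<And>k. P k = annihilator L (s k)" by metis
  have sR: "s k \<in> R" for k using s(1)[of k] unfolding maximal_annihilator_def by auto
  have "\<exists>k r. (\<forall>j. r j \<in> R) \<and> s k = (\<Sum>j<k. r j * s j)"
    by (rule noetherianD[OF assms(1) sR])
  then obtain k r where r: "\<And>j. r j \<in> R" "s k = (\<Sum>j<k. r j * s j)"
    by auto
  have "\<exists>a. a \<in> P j - P k" if "j < k" for j
  proof (rule ccontr)
    assume "\<not> ?thesis"
    then have "P j \<subseteq> P k" by auto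
    then have "P k = P j" using s unfolding maximal_annihilator_def by metis
    then show False using P(1) that by (auto dest: injD)
  qed
  then obtain a where a: "\<And>j. j < k \<Longrightarrow> a j \<in> P j" "\<And>j. j < k \<Longrightarrow> a j \<notin> P k" by (metis DiffE)
  have aR: "a j \<in> R" if "j < k" for j using a(1)[OF that] s(2) unfolding annihilator_def by auto
  define b where "b = prod a {..<k}"
  have b: "b \<notin> P k" "b \<in> R"
    unfolding b_def s(2)
    using prime_in_prod[OF prime_maximal_annihilator[OF L s(1)[of k]], of "{..<k}" a] a(2) aR s(2)
    by auto
  have "b * s j \<in> L" if "j < k" for j
  proof -
    have "b \<in> annihilator L (s j)" unfolding b_def
      by (rule prod_in_ideal[OF ideal_in_annihilator[OF L sR], of _ _ j])
        (use that a(1)[OF that] aR s(2) in auto)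
    then show ?thesis unfolding annihilator_def by auto
  qed
  then have "(\<Sum>j<k. r j * (b * s j)) \<in> L"
    by (auto intro!: ideal_in_sum[OF L] ideal_inD(4)[OF L r(1)])
  also have "(\<Sum>j<k. r j * (b * s j)) = b * s k"
    unfolding r(2) sum_distrib_left by (intro sum.cong refl) (simp add: mult_ac)
  finally show False using b s(2) unfolding annihilator_def by auto
qed

text \<open>
  Every zero divisor modulo \<open>L\<close> lies in one of the finitely many maximal annihilators. None of
  them contains \<open>A\<close>, because \<open>A z \<subseteq> L\<close> would put \<open>z\<close> into \<open>L\<close>; so prime avoidance applies.
\<close>

theorem ex_nonzerodivisor:
  assumes N: noetherian and L: "ideal_in L" and A: "ideal_in A"
    and socle: "\<And>z. z \<in> R \<Longrightarrow> (\<And>f. f \<in> A \<Longrightarrow> f * z \<in> L) \<Longrightarrow> z \<in> L"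
  shows "\<exists>f\<in>A. \<forall>p\<in>R. f * p \<in> L \<longrightarrow> p \<in> L"
proof -
  let ?P = "{annihilator L z | z. maximal_annihilator L z}"
  have "\<exists>f\<in>A. \<forall>P\<in>?P. f \<notin> P"
  proof (rule prime_avoidance[OF finite_maximal_annihilators[OF N L] _ _ A])
    show "prime_in P" if "P \<in> ?P" for P using that prime_maximal_annihilator[OF L] by auto
    show "P = Q" if "P \<in> ?P" "Q \<in> ?P" "P \<subseteq> Q" for P Q
      using that unfolding maximal_annihilator_def by auto
    show "\<not> A \<subseteq> P" if P: "P \<in> ?P" for P
    proof
      assume "A \<subseteq> P"
      obtain z where z: "maximal_annihilator L z" "P = annihilator L z" using P by blast
      have "z \<in> L"
      proof (rule socle)
        show "z \<in> R" using z(1) by (simp add: maximal_annihilator_def)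
        show "f * z \<in> L" if "f \<in> A" for f
          using that \<open>A \<subseteq> P\<close> z(2) by (auto simp: annihilator_def)
      qed
      then show False using z(1) unfolding maximal_annihilator_def by blast
    qed
  qed
  then obtain f where f: "f \<in> A" "\<And>z. maximal_annihilator L z \<Longrightarrow> f \<notin> annihilator L z" by blast
  have "p \<in> L" if p: "p \<in> R" "f * p \<in> L" for p
  proof (rule ccontr)
    assume "p \<notin> L"
    then obtain y where "maximal_annihilator L y" "annihilator L p \<subseteq> annihilator L y"
      using ex_maximal_annihilator[OF N L, of p] p by blast
    moreover have "f \<in> annihilator L p"
      using p f(1) ideal_inD(1)[OF A] unfolding annihilator_def by auto
    ultimately show False using f(2) by blast
  qed
  then show ?thesis using f(1) by blast
qed

end

section \<open>The polynomial ring is Noetherian\<close>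

text \<open>
  Dickson's lemma for sequences. For one coordinate, a monotone subsequence of natural numbers is
  increasing or eventually constant.
\<close>

lemma ex_subseq_mono_on:
  fixes s :: "nat \<Rightarrow> 'v \<Rightarrow> nat"
  assumes "finite V"
  shows "\<exists>r :: nat \<Rightarrow> nat. strict_mono r \<and> (\<forall>v\<in>V. incseq (\<lambda>i. s (r i) v))"
  using assms
proof (induction V rule: finite_induct)
  case empty
  then show ?case by (intro exI[of _ id]) (auto simp: strict_mono_def)
next
  case (insert w V)
  then obtain r :: "nat \<Rightarrow> nat" where r: "strict_mono r" "\<And>v. v \<in> V \<Longrightarrow> incseq (\<lambda>i. s (r i) v)"
    by blast
  have "\<exists>g :: nat \<Rightarrow> nat. strict_mono g \<and> incseq (\<lambda>i. s (r (g i)) w)"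
  proof -
    obtain f :: "nat \<Rightarrow> nat" where f: "strict_mono f" "monoseq (\<lambda>n. s (r (f n)) w)"
      using seq_monosub[of "\<lambda>n. s (r n) w"] by auto
    show ?thesis
    proof (cases "incseq (\<lambda>n. s (r (f n)) w)")
      case True
      then show ?thesis using f(1) by auto
    next
      case False
      let ?t = "\<lambda>n. s (r (f n)) w"
      have dec: "decseq ?t" using f(2) False unfolding monoseq_iff by auto
      define m where "m = (LEAST x. x \<in> range ?t)"
      have "m \<in> range ?t" unfolding m_def by (rule LeastI) auto
      then obtain N where N: "?t N = m" by auto
      have const: "?t (n + N) = m" for n
      proof (rule antisym)
        show "?t (n + N) \<le> m" using decseqD[OF dec, of N "n + N"] N by simp
        show "m \<le> ?t (n + N)" unfolding m_def by (rule Least_le) auto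
      qed
      have "strict_mono (\<lambda>n. f (n + N))" using f(1) by (simp add: strict_mono_def)
      then show ?thesis using const by (intro exI[of _ "\<lambda>n. f (n + N)"]) (auto simp: incseq_def)
    qed
  qed
  then obtain g :: "nat \<Rightarrow> nat" where g: "strict_mono g" "incseq (\<lambda>i. s (r (g i)) w)" by blast
  have "incseq (\<lambda>i. s ((r \<circ> g) i) v)" if "v \<in> insert w V" for v
  proof (cases "v = w")
    case False
    then have "incseq (\<lambda>i. s (r i) v)" using r(2) that by auto
    then show ?thesis using g(1) by (auto simp: incseq_def strict_mono_less_eq)
  qed (use g in auto)
  moreover have "strict_mono (r \<circ> g)" using r(1) g(1) by (auto simp: strict_mono_def)
  ultimately show ?case by blast
qed

text \<open>
  Divisibility of monomials is written additively; the order of \<^type>\<open>poly_mapping\<close> is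
  lexicographic and differs from it.
\<close>

lemma poly_mapping_le_iff_ex_add:
  fixes m m' :: "'v \<Rightarrow>\<^sub>0 nat"
  shows "(\<exists>d. m' = d + m) \<longleftrightarrow> (\<forall>v. lookup m v \<le> lookup m' v)"
proof
  assume "\<forall>v. lookup m v \<le> lookup m' v"
  then have "m' = (m' - m) + m"
    by (intro poly_mapping_eqI) (simp add: lookup_add lookup_minus)
  then show "\<exists>d. m' = d + m" by blast
qed (auto simp: lookup_add)

lemma dickson:
  fixes s :: "nat \<Rightarrow> 'v \<Rightarrow>\<^sub>0 nat"
  assumes "finite V" "\<And>i. keys (s i) \<subseteq> V"
  shows "\<exists>i j d. i < j \<and> s j = d + s i"
proof -
  obtain r :: "nat \<Rightarrow> nat" where r: "strict_mono r"
    "\<And>v. v \<in> V \<Longrightarrow> incseq (\<lambda>i. lookup (s (r i)) v)"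
    using ex_subseq_mono_on[OF assms(1), of "\<lambda>i. lookup (s i)"] by auto
  have "lookup (s (r 0)) v \<le> lookup (s (r 1)) v" for v
  proof (cases "v \<in> V")
    case True
    then show ?thesis using r(2)[OF True] by (auto simp: incseq_def)
  next
    case False
    then have "lookup (s (r 0)) v = 0" using assms(2)[of "r 0"] by (auto simp: in_keys_iff)
    then show ?thesis by simp
  qed
  then have "\<exists>d. s (r 1) = d + s (r 0)" by (simp add: poly_mapping_le_iff_ex_add)
  moreover have "r 0 < r 1" using r(1) by (simp add: strict_mono_def)
  ultimately show ?thesis by blast
qed

lemma zero_le_exponent: "(0 :: 'v::linorder \<Rightarrow>\<^sub>0 nat) \<le> d"
proof (rule ccontr)
  assume "\<not> 0 \<le> d"
  then have "d < 0" by simp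
  then show False by transfer (auto simp: less_fun_def)
qed

text \<open>
  The lexicographic order refines divisibility, so by Dickson's lemma it has no infinite descending
  sequence on monomials in finitely many variables.
\<close>

lemma wf_exponents:
  assumes "finite V"
  shows "wf {(m, m'). m < m' \<and> keys m \<subseteq> V \<and> keys (m' :: 'v::linorder \<Rightarrow>\<^sub>0 nat) \<subseteq> V}"
  unfolding wf_iff_no_infinite_down_chain
proof
  assume "\<exists>s. \<forall>i. (s (Suc i), s i) \<in> {(m, m'). m < m' \<and> keys m \<subseteq> V
     \<and> keys (m' :: 'v \<Rightarrow>\<^sub>0 nat) \<subseteq> V}"
  then obtain s where s: "\<And>i. s (Suc i) < s i" "\<And>i. keys (s i :: 'v \<Rightarrow>\<^sub>0 nat) \<subseteq> V"
    by auto
  have dec: "s j < s i" if "i < j" for i j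
    using that by (induction rule: strict_inc_induct) (use s(1) less_trans in blast)+
  obtain i j d where "i < j" "s j = d + s i" using dickson[of V s] assms s(2) by blast
  moreover have "s i \<le> d + s i" using add_right_mono[of 0 d "s i", OF zero_le_exponent] by simp
  ultimately show False using dec[of i j] by simp
qed

lemma lookup_single_mult:
  fixes p :: "('v::linorder, 'k::comm_ring_1) mpoly"
  shows "lookup (single d c * p) (d + m) = c * lookup p m"
    and "(\<And>m. m' \<noteq> d + m) \<Longrightarrow> lookup (single d c * p) m' = 0"
proof -
  have *: "lookup (single d c * p) m' =
     c * (\<Sum>q. lookup p q when m' = d + q)" for m'
    unfolding lookup_mult lookup_single when_mult
    by (subst Sum_any_when_equal') simp
  show "lookup (single d c * p) (d + m) = c * lookup p m"
    by (simp add: *)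
  show "lookup (single d c * p) m' = 0" if "\<And>m. m' \<noteq> d + m"
    by (simp add: * that)
qed


text \<open>
  The union of the ideals generated by initial segments is generated by finitely many elements, and
  these lie in one of the ideals.
\<close>

lemma (in carrier_ring) noetherian_if_finitely_generated:
  assumes fg: "\<And>L. ideal_in L \<Longrightarrow>
    \<exists>B. finite B \<and> B \<subseteq> L \<and> (\<forall>p\<in>L. \<exists>r. (\<forall>b. r b \<in> R) \<and> p = (\<Sum>b\<in>B. r b * b))"
  shows noetherian
  unfolding noetherian_def
proof (intro allI impI)
  fix p :: "nat \<Rightarrow> 'a" assume p: "\<forall>k. p k \<in> R"
  define span where "span k = {\<Sum>j<k. r j * p j | r. \<forall>j. r j \<in> R}" for k :: nat
  have spanI: "(\<Sum>j<k. r j * p j) \<in> span k" if "\<And>j. r j \<in> R" for r k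
    using that unfolding span_def by blast
  have span_ideal: "ideal_in (span k)" for k
    unfolding ideal_in_def
  proof (intro conjI ballI)
    show "span k \<subseteq> R" unfolding span_def using p by (auto intro!: sum_closed)
    show "0 \<in> span k" using spanI[of "\<lambda>_. 0" k] by simp
  next
    fix a b assume "a \<in> span k" "b \<in> span k"
    then obtain r r' where "a = (\<Sum>j<k. r j * p j)" "b = (\<Sum>j<k. r' j * p j)"
      "\<And>j. r j \<in> R" "\<And>j. r' j \<in> R" unfolding span_def by blast
    then show "a + b \<in> span k"
      using spanI[of "\<lambda>j. r j + r' j" k] by (simp add: distrib_right sum.distrib)
  next
    fix c a assume "c \<in> R" "a \<in> span k"
    then obtain r where "a = (\<Sum>j<k. r j * p j)" "\<And>j. r j \<in> R" unfolding span_def by blast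
    then show "c * a \<in> span k"
      using spanI[of "\<lambda>j. c * r j" k] \<open>c \<in> R\<close> by (simp add: sum_distrib_left mult.assoc)
  qed
  have step: "span k \<subseteq> span (Suc k)" for k
  proof
    fix a assume "a \<in> span k"
    then obtain r where r: "a = (\<Sum>j<k. r j * p j)" "\<And>j. r j \<in> R" unfolding span_def by blast
    have "(\<Sum>j<Suc k. (if j = k then 0 else r j) * p j) = a" unfolding r(1) by simp
    then show "a \<in> span (Suc k)" using spanI[of "\<lambda>j. if j = k then 0 else r j" "Suc k"] r(2) by simp
  qed
  have mono: "i \<le> j \<Longrightarrow> span i \<subseteq> span j" for i j by (rule lift_Suc_mono_le[of span, OF step])
  have "ideal_in (\<Union>k. span k)"
    unfolding ideal_in_def
  proof (intro conjI ballI)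
    show "(\<Union>k. span k) \<subseteq> R" "0 \<in> (\<Union>k. span k)"
      using ideal_inD(1,2)[OF span_ideal] by blast+
    fix a b assume "a \<in> (\<Union>k. span k)" "b \<in> (\<Union>k. span k)"
    then obtain i j where "a \<in> span i" "b \<in> span j" by auto
    then have "a \<in> span (max i j)" "b \<in> span (max i j)"
      using mono[of i "max i j"] mono[of j "max i j"] by auto
    then show "a + b \<in> (\<Union>k. span k)" using ideal_inD(3)[OF span_ideal] by blast
  next
    fix c a assume "c \<in> R" "a \<in> (\<Union>k. span k)"
    then show "c * a \<in> (\<Union>k. span k)" using ideal_inD(4)[OF span_ideal] by blast
  qed
  then obtain B where B: "finite B" "B \<subseteq> (\<Union>k. span k)"
    "\<And>q. q \<in> (\<Union>k. span k) \<Longrightarrow> \<exists>r. (\<forall>b. r b \<in> R) \<and> q = (\<Sum>b\<in>B. r b * b)"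
    using fg by metis
  obtain K where K: "B \<subseteq> span K"
    using B(1,2)
  proof (induction B arbitrary: thesis rule: finite_induct)
    case (insert b B)
    then obtain K where "B \<subseteq> span K" by blast
    moreover obtain j where "b \<in> span j" using insert.prems by blast
    ultimately have "insert b B \<subseteq> span (max K j)"
      using mono[of K "max K j"] mono[of j "max K j"] by auto
    then show ?case using insert.prems by blast
  qed simp
  have "(\<Sum>j<Suc K. (if j = K then 1 else 0) * p j) = p K" by simp
  then have "p K \<in> span (Suc K)" using spanI[of "\<lambda>j. if j = K then 1 else 0" "Suc K"] by simp
  then obtain r where r: "\<And>b. r b \<in> R" "p K = (\<Sum>b\<in>B. r b * b)" using B(3) by blast
  have "(\<Sum>b\<in>B. r b * b) \<in> span K"
    by (intro ideal_in_sum[OF span_ideal] ideal_inD(4)[OF span_ideal r(1)]) (use K in auto)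
  then show "\<exists>k r. (\<forall>j. r j \<in> R) \<and> p k = (\<Sum>j<k. r j * p j)"
    unfolding r(2)[symmetric] span_def by blast
qed

definition polys :: "'v set \<Rightarrow> ('v, 'k::comm_ring_1) mpoly set" where
  "polys V = {p. \<forall>m\<in>keys p. keys m \<subseteq> V}"

lemma keys_uminus [simp]: "keys (- p) = keys (p :: _ \<Rightarrow>\<^sub>0 'k::ab_group_add)"
  by (auto simp: in_keys_iff)

lemma keys_add_exponents: "keys (m + m') = keys m \<union> keys (m' :: 'v \<Rightarrow>\<^sub>0 nat)"
  by (auto simp: in_keys_iff lookup_add)

lemma carrier_ring_polys: "carrier_ring (polys V :: ('v, 'k::comm_ring_1) mpoly set)"
proof
  show "1 \<in> polys V" by (auto simp: polys_def)
  fix p q :: "('v, 'k) mpoly" assume pq: "p \<in> polys V" "q \<in> polys V"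
  then show "p + q \<in> polys V" using Poly_Mapping.keys_add[of p q] by (auto simp: polys_def)
  show "- p \<in> polys V" using pq by (auto simp: polys_def)
  show "p * q \<in> polys V" unfolding polys_def
  proof safe
    fix m v assume "m \<in> keys (p * q)" and v: "v \<in> keys m"
    then obtain a b where "m = a + b" "a \<in> keys p" "b \<in> keys q"
      using keys_mult[of p q] by blast
    then show "v \<in> V" using pq v unfolding polys_def by (auto simp: keys_add_exponents)
  qed
qed

lemma single_in_polys [intro]: "keys m \<subseteq> V \<Longrightarrow> single m c \<in> polys V"
  by (auto simp: polys_def)

lemma ex_finite_dividing_exponents:
  fixes M :: "('v \<Rightarrow>\<^sub>0 nat) set"
  assumes "finite V" "\<And>m. m \<in> M \<Longrightarrow> keys m \<subseteq> V"
  shows "\<exists>M0. finite M0 \<and> M0 \<subseteq> M \<and> (\<forall>m\<in>M. \<exists>m0\<in>M0. \<exists>d. m = d + m0)"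
proof -
  define M0 where "M0 = {m\<in>M. \<forall>m'\<in>M. (\<exists>d. m = d + m') \<longrightarrow> m' = m}"
  have "finite M0"
  proof (rule ccontr)
    assume "infinite M0"
    then obtain s :: "nat \<Rightarrow> 'v \<Rightarrow>\<^sub>0 nat" where s: "inj s" "range s \<subseteq> M0"
      using infinite_countable_subset by blast
    then have sM: "\<And>i. s i \<in> M0" by auto
    then have "\<And>i. keys (s i) \<subseteq> V" using assms(2) unfolding M0_def by blast
    then obtain i j d where ij: "i < j" "s j = d + s i" using dickson[OF assms(1)] by blast
    then have "s i = s j" using sM[of i] sM[of j] unfolding M0_def by blast
    then show False using s(1) ij(1) by (auto dest: injD)
  qed
  moreover have "\<exists>m0\<in>M0. \<exists>d. m = d + m0" if "m \<in> M" for m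
    using that
  proof (induction "sum (lookup m) V" arbitrary: m rule: less_induct)
    case less
    show ?case
    proof (cases "m \<in> M0")
      case True
      then show ?thesis by (intro bexI[of _ m] exI[of _ 0]) auto
    next
      case False
      then obtain m' d where m': "m' \<in> M" "m = d + m'" "m' \<noteq> m"
        using less.prems unfolding M0_def by blast
      have "d \<noteq> 0" using m' by auto
      then obtain v where v: "v \<in> keys d" by (metis ex_in_conv keys_eq_empty)
      then have vV: "v \<in> V" using assms(2)[OF less.prems] m'(2) by (auto simp: keys_add_exponents)
      have "sum (lookup m') V < sum (lookup m) V"
        by (rule sum_strict_mono_ex1[OF assms(1)]) (use v vV in \<open>auto simp: m'(2) lookup_add in_keys_iff\<close>)
      then obtain m0 d' where "m0 \<in> M0" "m' = d' + m0" using less.hyps m'(1) by blast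
      then show ?thesis using m'(2) by (intro bexI[of _ m0] exI[of _ "d + d'"]) (auto simp: add.assoc)
    qed
  qed
  ultimately show ?thesis unfolding M0_def by blast
qed

definition lead :: "('v::linorder, 'k::comm_ring_1) mpoly \<Rightarrow> 'v \<Rightarrow>\<^sub>0 nat" where
  "lead p = Max (keys p)"

lemma lead_in_keys: "p \<noteq> 0 \<Longrightarrow> lead p \<in> keys p"
  unfolding lead_def by (intro Max_in) auto

lemma le_lead: "m \<in> keys p \<Longrightarrow> m \<le> lead p"
  unfolding lead_def by simp

text \<open>
  One step of division with remainder: the leading terms of \<open>p\<close> and of a multiple of \<open>b\<close> cancel.
\<close>

lemma lead_reduction:
  fixes p b :: "('v::linorder, 'k::field) mpoly"
  assumes "p \<noteq> 0" "b \<noteq> 0" "lead p = d + lead b"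
  shows "\<exists>c. \<forall>m\<in>keys (p - single d c * b). m < lead p"
proof -
  define c where "c = lookup p (lead p) / lookup b (lead b)"
  have b0: "lookup b (lead b) \<noteq> 0" using lead_in_keys[OF assms(2)] by (simp add: in_keys_iff)
  have "m < lead p" if m: "m \<in> keys (p - single d c * b)" for m
  proof -
    have nz: "lookup p m - lookup (single d c * b) m \<noteq> 0"
      using m by (simp add: in_keys_iff lookup_minus)
    have "m \<noteq> lead p"
    proof
      assume "m = lead p"
      then have "lookup (single d c * b) m = lookup p m"
        using assms(3) b0 by (simp add: lookup_single_mult(1) c_def)
      then show False using nz by simp
    qed
    moreover have "m \<le> lead p"
    proof (cases "m \<in> keys p")
      case False
      then have "lookup (single d c * b) m \<noteq> 0" using nz by (simp add: in_keys_iff)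
      then obtain m' where m': "m = d + m'" using lookup_single_mult(2) by blast
      then have "m' \<in> keys b"
        using \<open>lookup (single d c * b) m \<noteq> 0\<close>
        by (auto simp: lookup_single_mult(1) in_keys_iff)
      then show ?thesis unfolding m' assms(3) by (intro add_left_mono le_lead)
    qed (rule le_lead)
    ultimately show ?thesis by simp
  qed
  then show ?thesis by blast
qed

text \<open>
  Hilbert's basis theorem. By Dickson's lemma finitely many elements of \<open>L\<close> have leading monomials
  dividing those of all the others, and division with remainder shows that they generate \<open>L\<close>.
\<close>

theorem noetherian_polys:
  assumes "finite V"
  shows "carrier_ring.noetherian (polys V :: ('v::linorder, 'k::field) mpoly set)"
proof -
  interpret carrier_ring "polys V :: ('v, 'k) mpoly set" by (rule carrier_ring_polys)
  show ?thesis
  proof (rule noetherian_if_finitely_generated)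
    fix L :: "('v, 'k) mpoly set" assume L: "ideal_in L"
    have keysL: "keys m \<subseteq> V" if "p \<in> L" "m \<in> keys p" for p m
      using ideal_inD(1)[OF L] that unfolding polys_def by blast
    have leadV: "keys m \<subseteq> V" if "m \<in> lead ` (L - {0})" for m
      using that keysL lead_in_keys by blast
    obtain M0 where M0: "finite M0" "M0 \<subseteq> lead ` (L - {0})"
      "\<And>m. m \<in> lead ` (L - {0}) \<Longrightarrow> \<exists>m0\<in>M0. \<exists>d. m = d + m0"
      using ex_finite_dividing_exponents[OF assms leadV] by metis
    obtain B where B: "finite B" "B \<subseteq> L - {0}" "M0 = lead ` B"
      using finite_subset_image[OF M0(1,2)] by blast
    let ?span = "\<lambda>p. \<exists>r. (\<forall>b. r b \<in> polys V) \<and> p = (\<Sum>b\<in>B. r b * b)"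
    have zero_span: "?span 0" by (intro exI[of _ "\<lambda>_. 0"]) auto
    have "p \<in> L \<Longrightarrow> p \<noteq> 0 \<longrightarrow> lead p = l \<Longrightarrow> keys l \<subseteq> V \<Longrightarrow> ?span p" for p l
    proof (induction l arbitrary: p rule: wf_induct_rule[OF wf_exponents[OF assms]])
      case (1 l)
      show ?case
      proof (cases "p = 0")
        case False
        then have "lead p \<in> lead ` (L - {0})" using 1 by blast
        then obtain b d where bd: "b \<in> B" "lead p = d + lead b" using M0(3) B(3) by blast
        have bL: "b \<in> L" "b \<noteq> 0" using bd(1) B(2) by auto
        obtain c where c: "\<And>m. m \<in> keys (p - single d c * b) \<Longrightarrow> m < lead p"
          using lead_reduction[OF False bL(2) bd(2)] by blast
        define q where "q = p - single d c * b"
        have lp: "lead p = l" using 1 False by blast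
        have "keys (d + lead b) \<subseteq> V" using 1 lp bd(2) by simp
        then have s: "single d c \<in> polys V"
          by (intro single_in_polys) (simp add: keys_add_exponents)
        have qL: "q \<in> L" unfolding q_def
          by (intro ideal_inD(6)[OF L] ideal_inD(4)[OF L] s bL(1)) (rule 1)
        have "?span q"
        proof (cases "q = 0")
          case False
          then have k: "lead q \<in> keys q" by (rule lead_in_keys)
          then have "lead q < l" using c lp unfolding q_def by blast
          moreover have "keys (lead q) \<subseteq> V" using keysL[OF qL k] .
          ultimately show ?thesis using 1(1)[of "lead q" q] qL 1(4) by blast
        qed (use zero_span in simp)
        then obtain r where r: "\<And>b. r b \<in> polys V" "q = (\<Sum>b\<in>B. r b * b)" by blast
        have "p = (\<Sum>b'\<in>B. r b' * b' + (if b' = b then single d c * b else 0))"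
          using r(2) bd(1) B(1) by (simp add: sum.distrib q_def algebra_simps)
        also have "\<dots> = (\<Sum>b'\<in>B. (r b' + (if b' = b then single d c else 0)) * b')"
          by (intro sum.cong refl) (simp add: distrib_right)
        finally show ?thesis
          using r(1) s by (intro exI[of _ "\<lambda>b'. r b' + (if b' = b then single d c else 0)"]) auto
      qed (use zero_span in simp)
    qed
    then have "?span p" if "p \<in> L" for p
      using that keysL lead_in_keys zero_span by (cases "p = 0") blast+
    then show "\<exists>B. finite B \<and> B \<subseteq> L \<and> (\<forall>p\<in>L. \<exists>r. (\<forall>b. r b \<in> polys V) \<and> p = (\<Sum>b\<in>B. r b * b))"
      using B(1,2) by blast
  qed
qed

section \<open>The multigraded pieces of the Koszul cohomology of a monomial quotient\<close>

definition monomial_ideal :: "'v set \<Rightarrow> ('v \<Rightarrow>\<^sub>0 nat) set \<Rightarrow> ('v, 'k::comm_ring_1) mpoly set" where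
  "monomial_ideal V U = {p \<in> polys V. keys p \<subseteq> U}"

definition up_closed :: "('v \<Rightarrow>\<^sub>0 nat) set \<Rightarrow> bool" where
  "up_closed U \<longleftrightarrow> (\<forall>m\<in>U. \<forall>d. d + m \<in> U)"

lemma ideal_in_monomial_ideal:
  assumes "up_closed U"
  shows "carrier_ring.ideal_in (polys V) (monomial_ideal V U :: ('v, 'k::comm_ring_1) mpoly set)"
proof -
  interpret carrier_ring "polys V :: ('v, 'k) mpoly set" by (rule carrier_ring_polys)
  show ?thesis
    unfolding ideal_in_def
  proof (intro conjI ballI)
    show "monomial_ideal V U \<subseteq> (polys V :: ('v, 'k) mpoly set)" "0 \<in> (monomial_ideal V U :: ('v, 'k) mpoly set)"
      unfolding monomial_ideal_def by auto
  next
    fix a b :: "('v, 'k) mpoly" assume "a \<in> monomial_ideal V U" "b \<in> monomial_ideal V U"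
    then show "a + b \<in> monomial_ideal V U"
      using Poly_Mapping.keys_add[of a b] unfolding monomial_ideal_def by auto
  next
    fix r a :: "('v, 'k) mpoly" assume r: "r \<in> polys V" "a \<in> monomial_ideal V U"
    then show "r * a \<in> monomial_ideal V U"
      using keys_mult[of r a] assms unfolding monomial_ideal_def up_closed_def by auto
  qed
qed

text \<open>
  The \<open>i\<close>-th cohomology of the cochain complex of a family \<open>D\<close> of sets, with cochains that are zero
  outside \<open>D\<close>. The family need not contain the empty set: it is the set of faces of a complex that
  contain a given face.
\<close>

definition cochain_vanishes :: "'k::comm_ring_1 itself \<Rightarrow> 'v::linorder set set \<Rightarrow> nat \<Rightarrow> bool" where
  "cochain_vanishes _ D i \<longleftrightarrow>
     (\<forall>c :: 'v set \<Rightarrow> 'k. (\<forall>F. F \<notin> D \<longrightarrow> c F = 0) \<longrightarrow>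
        (\<forall>F\<in>D. card F = Suc i \<longrightarrow> koszul (\<lambda>_. 1) c F = 0) \<longrightarrow>
        (\<exists>y. (\<forall>F. F \<notin> D \<longrightarrow> y F = 0) \<and> (\<forall>F\<in>D. card F = i \<longrightarrow> c F = koszul (\<lambda>_. 1) y F)))"

text \<open>
  The product of all \<open>x\<^sub>v\<^sup>M\<close> with \<open>v \<in> V - F\<close>. Multiplying the component at \<open>F\<close> of a Koszul
  cochain by it makes the differential of \<open>x\<^sub>v\<^sup>M\<close> homogeneous of degree zero.
\<close>

definition complement_exponent :: "nat \<Rightarrow> 'v set \<Rightarrow> 'v set \<Rightarrow> 'v \<Rightarrow>\<^sub>0 nat" where
  "complement_exponent M V F = (\<Sum>v\<in>V - F. single v M)"

text \<open>
  The sets \<open>F\<close> at which a Koszul cochain of multidegree \<open>a\<close> can have a nonzero component modulo the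
  monomial ideal of \<open>U\<close>. The multidegree is shifted by \<open>complement_exponent M V {}\<close>, which avoids negative exponents.
\<close>

definition degree_complex :: "nat \<Rightarrow> 'v set \<Rightarrow> ('v \<Rightarrow>\<^sub>0 nat) set \<Rightarrow> ('v \<Rightarrow>\<^sub>0 nat) \<Rightarrow> 'v set set" where
  "degree_complex M V U a = {F. F \<subseteq> V \<and> (\<exists>e. a = complement_exponent M V F + e \<and> e \<notin> U)}"

definition var_power :: "nat \<Rightarrow> 'v \<Rightarrow> ('v, 'k::comm_ring_1) mpoly" where
  "var_power M v = single (single v M) 1"

lemma lookup_complement_exponent:
  assumes "finite V"
  shows "lookup (complement_exponent M V F) v = (if v \<in> V - F then M else 0)"
proof -
  have "lookup (complement_exponent M V F) v = (\<Sum>w\<in>V - F. if w = v then M else 0)"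
    unfolding complement_exponent_def lookup_sum by (intro sum.cong refl) (simp add: lookup_single when_def)
  then show ?thesis using assms by (simp add: sum.delta)
qed

lemma complement_exponent_remove:
  assumes "finite V" "v \<in> F" "F \<subseteq> V"
  shows "complement_exponent M V (F - {v}) = complement_exponent M V F + single v M"
  by (rule poly_mapping_eqI)
    (use assms in \<open>auto simp: lookup_complement_exponent lookup_add lookup_single when_def\<close>)

lemma keys_complement_exponent: "finite V \<Longrightarrow> keys (complement_exponent M V F) \<subseteq> V"
proof
  fix v assume "finite V" "v \<in> keys (complement_exponent M V F)"
  then show "v \<in> V" by (cases "v \<in> V") (simp_all add: in_keys_iff lookup_complement_exponent)
qed

lemma lookup_ksgn_mult: "lookup (ksgn v F * p) a = ksgn v F * lookup p a"
  for p :: "('v::linorder, 'k::comm_ring_1) mpoly"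
  unfolding ksgn_def by (cases "even (card {u \<in> F. u < v})") simp_all

definition homogenize :: "nat \<Rightarrow> 'v set \<Rightarrow> ('v set \<Rightarrow> ('v::linorder, 'k::comm_ring_1) mpoly) \<Rightarrow> 'v set \<Rightarrow> ('v, 'k) mpoly" where
  "homogenize M V z F = single (complement_exponent M V F) 1 * z F"

lemma lookup_homogenize:
  "lookup (homogenize M V z F) (complement_exponent M V F + e) = lookup (z F) e"
  "(\<And>e. a \<noteq> complement_exponent M V F + e) \<Longrightarrow> lookup (homogenize M V z F) a = 0"
  unfolding homogenize_def by (simp_all add: lookup_single_mult)

lemma var_power_in_polys: "v \<in> V \<Longrightarrow> var_power M v \<in> polys V"
  unfolding var_power_def by (intro single_in_polys) auto

text \<open>
  After homogenization the coefficient at each multidegree \<open>a\<close> separately is a cochain with values in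
  \<open>K\<close>, and the Koszul differential becomes the simplicial coboundary.
\<close>

lemma lookup_homogenize_koszul:
  fixes z :: "'v::linorder set \<Rightarrow> ('v, 'k::comm_ring_1) mpoly"
  assumes "finite V" "F \<subseteq> V"
  shows "lookup (homogenize M V (koszul (var_power M) z) F) a
       = koszul (\<lambda>_. 1) (\<lambda>G. lookup (homogenize M V z G) a) F"
proof -
  have "homogenize M V (koszul (var_power M) z) F
      = (\<Sum>v\<in>F. ksgn v (F - {v}) * homogenize M V z (F - {v}))"
    unfolding homogenize_def koszul_def sum_distrib_left
  proof (intro sum.cong refl)
    fix v assume "v \<in> F"
    then have e: "single (complement_exponent M V F) 1 * var_power M v
        = (single (complement_exponent M V (F - {v})) 1 :: ('v, 'k) mpoly)"
      using complement_exponent_remove[OF assms(1) _ assms(2)] by (simp add: var_power_def mult_single)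
    have "p * (q * r * s) = q * ((p * r) * s)" for p q r s :: "('v, 'k) mpoly"
      by (simp only: mult_ac)
    from this[of "single (complement_exponent M V F) 1" _ "var_power M v"]
    show "single (complement_exponent M V F) 1 * (ksgn v (F - {v}) * var_power M v * z (F - {v}))
       = ksgn v (F - {v}) * (single (complement_exponent M V (F - {v})) 1 * z (F - {v}))"
      unfolding e .
  qed
  then show ?thesis by (simp add: lookup_sum lookup_ksgn_mult koszul_def)
qed

context
  fixes V :: "'v::linorder set" and M :: nat and U :: "('v \<Rightarrow>\<^sub>0 nat) set"
  assumes finV: "finite V" and U: "up_closed U"
begin

interpretation P: carrier_ring "polys V :: ('v, 'k::comm_ring_1) mpoly set"
  by (rule carrier_ring_polys)

text \<open>
  The degree complex is closed under removing elements, except where this would make an exponent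
  negative. In the exceptional case the Koszul component has no term in the multidegree.
\<close>

lemma lookup_homogenize_outside:
  assumes F: "F \<in> degree_complex M V U a" and v: "v \<in> F" and out: "F - {v} \<notin> degree_complex M V U a"
  shows "lookup (homogenize M V z (F - {v})) a = 0"
proof (rule lookup_homogenize(2))
  obtain e where e: "a = complement_exponent M V F + e" "e \<notin> U" and FV: "F \<subseteq> V"
    using F unfolding degree_complex_def by auto
  fix e'
  show "a \<noteq> complement_exponent M V (F - {v}) + e'"
  proof
    assume a': "a = complement_exponent M V (F - {v}) + e'"
    then have "e' \<in> U" using out FV unfolding degree_complex_def by auto
    moreover have "complement_exponent M V F + e = complement_exponent M V F + (single v M + e')"
      using a' e(1) complement_exponent_remove[OF finV v FV] by (simp add: add.assoc)
    then have "e = single v M + e'" by simp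
    ultimately show False using e(2) U unfolding up_closed_def by auto
  qed
qed

text \<open>
  A cochain \<open>c\<close> over \<open>K\<close> is the homogeneous Koszul cochain with coefficients \<open>c\<close>, and the coefficients
  of a Koszul primitive in that multidegree form a primitive of \<open>c\<close>.
\<close>

lemma cochain_vanishes_of_koszul_vanishes:
  assumes van: "P.koszul_vanishes (var_power M) V (monomial_ideal V U :: ('v, 'k::comm_ring_1) mpoly set) i"
    and a: "keys a \<subseteq> V"
  shows "cochain_vanishes TYPE('k) (degree_complex M V U a) i"
  unfolding cochain_vanishes_def
proof (intro allI impI)
  let ?D = "degree_complex M V U a"
  fix c :: "'v set \<Rightarrow> 'k"
  assume c: "\<forall>F. F \<notin> ?D \<longrightarrow> c F = 0"
    and cyc: "\<forall>F\<in>?D. card F = Suc i \<longrightarrow> koszul (\<lambda>_. 1) c F = 0"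
  define z where "z F = (if F \<in> ?D then single (a - complement_exponent M V F) (c F) else 0)" for F
  have hz: "homogenize M V z F = single a (c F)" for F
  proof (cases "F \<in> ?D")
    case True
    then obtain e where "a = complement_exponent M V F + e" unfolding degree_complex_def by auto
    then show ?thesis using True by (simp add: homogenize_def z_def mult_single)
  next
    case False
    then show ?thesis using c by (simp add: homogenize_def z_def)
  qed
  have z: "z F \<in> polys V" for F
    unfolding z_def using a by (auto intro!: single_in_polys simp: in_keys_iff lookup_minus)
  have "koszul (var_power M) z F \<in> monomial_ideal V U" if F: "F \<subseteq> V" "card F = Suc i" for F
  proof -
    have "e \<in> U" if e: "e \<in> keys (koszul (var_power M) z F)" for e
    proof -
      have "lookup (homogenize M V (koszul (var_power M) z) F) (complement_exponent M V F + e) \<noteq> 0"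
        using e by (simp add: lookup_homogenize in_keys_iff)
      then have ne: "koszul (\<lambda>_. 1) (\<lambda>G. lookup (single a (c G)) (complement_exponent M V F + e)) F \<noteq> 0"
        unfolding lookup_homogenize_koszul[OF finV F(1)] hz .
      then have ae: "a = complement_exponent M V F + e"
        by (cases "a = complement_exponent M V F + e") (simp_all add: lookup_single koszul_def)
      then have "koszul (\<lambda>_. 1) c F \<noteq> 0" using ne by (simp add: lookup_single)
      then have "F \<notin> ?D" using cyc F(2) by blast
      then show "e \<in> U" using ae F(1) unfolding degree_complex_def by blast
    qed
    moreover have "koszul (var_power M) z F \<in> polys V"
      by (intro P.koszul_closed z var_power_in_polys) (use F in auto)
    ultimately show ?thesis unfolding monomial_ideal_def by auto
  qed
  then obtain y where y: "\<And>F. y F \<in> polys V"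
    "\<And>F. F \<subseteq> V \<Longrightarrow> card F = i \<Longrightarrow> z F - koszul (var_power M) y F \<in> monomial_ideal V U"
    using P.koszul_vanishesD[OF van, of z] z by blast
  define y' where "y' F = (if F \<in> ?D then lookup (homogenize M V y F) a else 0)" for F
  have "c F = koszul (\<lambda>_. 1) y' F" if F: "F \<in> ?D" "card F = i" for F
  proof -
    obtain e where e: "a = complement_exponent M V F + e" "e \<notin> U" and FV: "F \<subseteq> V"
      using F unfolding degree_complex_def by auto
    have "lookup (z F - koszul (var_power M) y F) e = 0"
      using y(2)[OF FV F(2)] e(2) unfolding monomial_ideal_def by (auto simp: in_keys_iff)
    then have "lookup (z F) e = lookup (koszul (var_power M) y F) e"
      by (simp add: lookup_minus)
    then have "lookup (homogenize M V z F) a = lookup (homogenize M V (koszul (var_power M) y) F) a"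
      unfolding e(1) lookup_homogenize .
    then have "c F = koszul (\<lambda>_. 1) (\<lambda>G. lookup (homogenize M V y G) a) F"
      unfolding lookup_homogenize_koszul[OF finV FV] hz by simp
    also have "\<dots> = koszul (\<lambda>_. 1) y' F"
      unfolding koszul_def
    proof (intro sum.cong refl arg_cong2[of _ _ _ _ "(*)"])
      fix v assume v: "v \<in> F"
      show "lookup (homogenize M V y (F - {v})) a = y' (F - {v})"
      proof (cases "F - {v} \<in> ?D")
        case False
        then show ?thesis using lookup_homogenize_outside[OF F(1) v False] by (simp add: y'_def)
      qed (simp add: y'_def)
    qed
    finally show ?thesis .
  qed
  then show "\<exists>y. (\<forall>F. F \<notin> ?D \<longrightarrow> y F = 0) \<and> (\<forall>F\<in>?D. card F = i \<longrightarrow> c F = koszul (\<lambda>_. 1) y F)"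
    by (intro exI[of _ y']) (auto simp: y'_def)
qed

text \<open>
  A Koszul cochain has only finitely many nonzero multidegrees. Primitives chosen in each of them
  are assembled to polynomials.
\<close>

lemma koszul_vanishes_of_cochain_vanishes:
  assumes van: "\<And>a. keys a \<subseteq> V \<Longrightarrow> cochain_vanishes TYPE('k::comm_ring_1) (degree_complex M V U a) i"
  shows "P.koszul_vanishes (var_power M) V (monomial_ideal V U :: ('v, 'k) mpoly set) i"
  unfolding P.koszul_vanishes_def
proof (intro allI impI)
  let ?D = "degree_complex M V U"
  fix z :: "'v set \<Rightarrow> ('v, 'k) mpoly"
  assume z: "\<forall>F. z F \<in> polys V"
    and cyc: "\<forall>F. F \<subseteq> V \<and> card F = Suc i \<longrightarrow> koszul (var_power M) z F \<in> monomial_ideal V U"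
  define c where "c a F = (if F \<in> ?D a then lookup (homogenize M V z F) a else 0)" for a F
  have kc: "koszul (\<lambda>_. 1) (c a) F = lookup (homogenize M V (koszul (var_power M) z) F) a"
    if F: "F \<in> ?D a" for a F
  proof -
    obtain e where e: "a = complement_exponent M V F + e" "e \<notin> U" and FV: "F \<subseteq> V"
      using F unfolding degree_complex_def by auto
    show ?thesis
      unfolding lookup_homogenize_koszul[OF finV FV] koszul_def
    proof (intro sum.cong refl arg_cong2[of _ _ _ _ "(*)"])
      fix v assume v: "v \<in> F"
      show "c a (F - {v}) = lookup (homogenize M V z (F - {v})) a"
      proof (cases "F - {v} \<in> ?D a")
        case False
        then show ?thesis using lookup_homogenize_outside[OF F v False] by (simp add: c_def)
      qed (simp add: c_def)
    qed
  qed
  have "\<exists>y. (\<forall>F. F \<notin> ?D a \<longrightarrow> y F = 0) \<and> (\<forall>F\<in>?D a. card F = i \<longrightarrow> c a F = koszul (\<lambda>_. 1) y F)"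
    if a: "keys a \<subseteq> V" for a
  proof -
    have "koszul (\<lambda>_. 1) (c a) F = 0" if F: "F \<in> ?D a" "card F = Suc i" for F
    proof -
      obtain e where e: "a = complement_exponent M V F + e" "e \<notin> U" and FV: "F \<subseteq> V"
        using F unfolding degree_complex_def by auto
      have "koszul (var_power M) z F \<in> monomial_ideal V U" using cyc FV F(2) by blast
      then have "lookup (koszul (var_power M) z F) e = 0"
        using e(2) unfolding monomial_ideal_def by (auto simp: in_keys_iff)
      then show ?thesis unfolding kc[OF F(1)] unfolding e(1) lookup_homogenize .
    qed
    moreover have "\<forall>F. F \<notin> ?D a \<longrightarrow> c a F = 0" by (simp add: c_def)
    ultimately show ?thesis using van[OF a] unfolding cochain_vanishes_def by blast
  qed
  then obtain w where w: "\<And>a F. keys a \<subseteq> V \<Longrightarrow> F \<notin> ?D a \<Longrightarrow> w a F = 0"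
    "\<And>a F. keys a \<subseteq> V \<Longrightarrow> F \<in> ?D a \<Longrightarrow> card F = i \<Longrightarrow> c a F = koszul (\<lambda>_. 1) (w a) F"
    by metis
  define B where "B = (\<Union>F\<in>Pow V. keys (homogenize M V z F))"
  have finB: "finite B" unfolding B_def using finV by auto
  have BV: "keys a \<subseteq> V" if "a \<in> B" for a
  proof -
    obtain F where F: "a \<in> keys (homogenize M V z F)" using \<open>a \<in> B\<close> unfolding B_def by auto
    have "homogenize M V z F \<in> polys V"
      unfolding homogenize_def using z by (intro P.mult_closed single_in_polys keys_complement_exponent[OF finV]) auto
    then show ?thesis using F unfolding polys_def by auto
  qed
  define y where "y F = Abs_poly_mapping (\<lambda>e. if complement_exponent M V F + e \<in> B
      then w (complement_exponent M V F + e) F else 0)" for F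
  have ly: "lookup (y F) e = (if complement_exponent M V F + e \<in> B
      then w (complement_exponent M V F + e) F else 0)" for F e
  proof -
    have "finite ((\<lambda>e. complement_exponent M V F + e) -` B)"
      by (rule finite_vimageI[OF finB]) (auto simp: inj_def)
    then have "finite {e. (if complement_exponent M V F + e \<in> B then w (complement_exponent M V F + e) F else 0) \<noteq> 0}"
      by (rule rev_finite_subset) auto
    then show ?thesis unfolding y_def by simp
  qed
  have yV: "y F \<in> polys V" for F
    unfolding polys_def
  proof (intro CollectI ballI)
    fix e assume "e \<in> keys (y F)"
    then have "complement_exponent M V F + e \<in> B" unfolding in_keys_iff ly by presburger
    then have "keys (complement_exponent M V F + e) \<subseteq> V" by (rule BV)
    then show "keys e \<subseteq> V" by (simp add: keys_add_exponents)
  qed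
  have hy: "lookup (homogenize M V y F) a = (if a \<in> B then w a F else 0)" for F a
  proof (cases "\<exists>e. a = complement_exponent M V F + e")
    case True
    then show ?thesis by (auto simp: lookup_homogenize ly)
  next
    case False
    then have "F \<notin> ?D a" unfolding degree_complex_def by auto
    then have "a \<in> B \<Longrightarrow> w a F = 0" using w(1) BV by blast
    then show ?thesis using False by (simp add: lookup_homogenize(2))
  qed
  have "z F - koszul (var_power M) y F \<in> monomial_ideal V U" if F: "F \<subseteq> V" "card F = i" for F
  proof -
    have "e \<in> U" if e: "e \<in> keys (z F - koszul (var_power M) y F)" for e
    proof (rule ccontr)
      assume "e \<notin> U"
      define a where "a = complement_exponent M V F + e"
      have FD: "F \<in> ?D a" using F(1) \<open>e \<notin> U\<close> unfolding degree_complex_def a_def by auto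
      have "lookup (koszul (var_power M) y F) e
          = lookup (homogenize M V (koszul (var_power M) y) F) a"
        unfolding a_def lookup_homogenize ..
      also have "\<dots> = koszul (\<lambda>_. 1) (\<lambda>G. if a \<in> B then w a G else 0) F"
        unfolding lookup_homogenize_koszul[OF finV F(1)] hy ..
      also have "\<dots> = lookup (homogenize M V z F) a"
      proof (cases "a \<in> B")
        case True
        then have "koszul (\<lambda>_. 1) (w a) F = c a F" using w(2)[OF BV FD F(2)] by simp
        then show ?thesis using True FD by (simp add: c_def)
      next
        case False
        then have "lookup (homogenize M V z F) a = 0"
          using F(1) unfolding B_def by (auto simp: in_keys_iff)
        then show ?thesis using False by (simp add: koszul_def)
      qed
      also have "\<dots> = lookup (z F) e" unfolding a_def lookup_homogenize ..
      finally show False using e by (simp add: in_keys_iff lookup_minus)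
    qed
    moreover have "z F - koszul (var_power M) y F \<in> polys V"
      using F z by (intro P.diff_closed P.koszul_closed yV var_power_in_polys) auto
    ultimately show ?thesis unfolding monomial_ideal_def by auto
  qed
  then show "\<exists>y. (\<forall>F. y F \<in> polys V) \<and> (\<forall>F. F \<subseteq> V \<and> card F = i \<longrightarrow>
       z F - koszul (var_power M) y F \<in> monomial_ideal V U)"
    using yV by blast
qed

end

text \<open>
  The contraction against the apex \<open>v\<close> is a contracting homotopy.
\<close>

lemma cochain_vanishes_cone:
  assumes finD: "\<And>F. F \<in> D \<Longrightarrow> finite F"
    and cone: "\<And>F. F \<in> D \<longleftrightarrow> insert v F \<in> D"
  shows "cochain_vanishes TYPE('k::comm_ring_1) D i"
  unfolding cochain_vanishes_def
proof (intro allI impI)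
  fix c :: "'a set \<Rightarrow> 'k"
  assume c: "\<forall>F. F \<notin> D \<longrightarrow> c F = 0"
    and cyc: "\<forall>F\<in>D. card F = Suc i \<longrightarrow> koszul (\<lambda>_. 1) c F = 0"
  define y where "y F = (if v \<in> F then 0 else ksgn v F * c (insert v F))" for F
  have "y F = 0" if "F \<notin> D" for F
    using that c cone[of F] by (auto simp: y_def)
  moreover have "c F = koszul (\<lambda>_. 1) y F" if F: "F \<in> D" "card F = i" for F
  proof (cases "v \<in> F")
    case True
    have "koszul (\<lambda>_. 1) y F = (\<Sum>w\<in>F. if w = v then c F else 0)"
      unfolding koszul_def
      by (intro sum.cong refl) (use True in \<open>auto simp: y_def insert_absorb\<close>)
    then show ?thesis using True finD[OF F(1)] by simp
  next
    case False
    have "insert v F \<in> D" "card (insert v F) = Suc i"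
      using F False finD cone by auto
    then have "0 = koszul (\<lambda>_. 1) c (insert v F)" using cyc by simp
    also have "\<dots> = ksgn v F * c F + (\<Sum>w\<in>F. ksgn w (insert v (F - {w})) * c (insert v (F - {w})))"
    proof -
      have "(\<Sum>w\<in>F. ksgn w (insert v F - {w}) * 1 * c (insert v F - {w}))
         = (\<Sum>w\<in>F. ksgn w (insert v (F - {w})) * c (insert v (F - {w})))"
        by (intro sum.cong refl) (use False in \<open>auto simp: insert_Diff_if\<close>)
      then show ?thesis unfolding koszul_def using False finD[OF F(1)] by simp
    qed
    finally have e: "ksgn v F * c F = - (\<Sum>w\<in>F. ksgn w (insert v (F - {w})) * c (insert v (F - {w})))"
      by (simp add: eq_neg_iff_add_eq_0)
    have "c F = ksgn v F * (ksgn v F * c F)" by simp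
    also have "\<dots> = - (\<Sum>w\<in>F. ksgn v F * (ksgn w (insert v (F - {w})) * c (insert v (F - {w}))))"
      unfolding e by (simp add: sum_distrib_left)
    finally have "c F = - (\<Sum>w\<in>F. ksgn v F * (ksgn w (insert v (F - {w})) * c (insert v (F - {w}))))" .
    also have "\<dots> = koszul (\<lambda>_. 1) y F"
      unfolding koszul_def sum_negf[symmetric]
    proof (intro sum.cong refl)
      fix w assume w: "w \<in> F"
      define G where "G = F - {w}"
      have G: "F = insert w G" "w \<notin> G" "v \<notin> G" "v \<noteq> w" "finite G"
        using w False finD[OF F(1)] unfolding G_def by auto
      have "ksgn v F * ksgn w (insert v G) = - (ksgn w G * ksgn v G :: 'k)"
        unfolding G(1) by (rule ksgn_exchange_insert) (use G in auto)
      then have "- (ksgn v F * ksgn w (insert v G)) * c (insert v G) = ksgn w G * ksgn v G * c (insert v G)"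
        by simp
      then show "- (ksgn v F * (ksgn w (insert v (F - {w})) * c (insert v (F - {w}))))
          = ksgn w (F - {w}) * 1 * y (F - {w})"
        unfolding G_def[symmetric] y_def using G(3) by (simp add: mult.assoc)
    qed
    finally show ?thesis .
  qed
  ultimately show "\<exists>y. (\<forall>F. F \<notin> D \<longrightarrow> y F = 0) \<and> (\<forall>F\<in>D. card F = i \<longrightarrow> c F = koszul (\<lambda>_. 1) y F)"
    by (intro exI[of _ y]) auto
qed

section \<open>Products of edges and weights of vertex covers\<close>

definition vertex_cover :: "'v set \<Rightarrow> 'v set set \<Rightarrow> 'v set \<Rightarrow> bool" where
  "vertex_cover V E C \<longleftrightarrow> C \<subseteq> V \<and> (\<forall>i j. {i, j} \<in> E \<longrightarrow> i \<in> C \<or> j \<in> C)"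

text \<open>
  The monomial \<open>x\<^sup>h\<close> is divisible by a product of \<open>k\<close> edges, repetitions allowed.
\<close>

primrec edge_divisible :: "'v set set \<Rightarrow> nat \<Rightarrow> ('v \<Rightarrow> nat) \<Rightarrow> bool" where
  "edge_divisible E 0 h \<longleftrightarrow> True"
| "edge_divisible E (Suc k) h \<longleftrightarrow> (\<exists>i j. {i, j} \<in> E \<and> i \<noteq> j \<and> 1 \<le> h i \<and> 1 \<le> h j \<and>
     edge_divisible E k (h(i := h i - 1, j := h j - 1)))"

lemma edge_divisible_SucI:
  "{i, j} \<in> E \<Longrightarrow> i \<noteq> j \<Longrightarrow> 1 \<le> h i \<Longrightarrow> 1 \<le> h j \<Longrightarrow>
    edge_divisible E k (h(i := h i - 1, j := h j - 1)) \<Longrightarrow> edge_divisible E (Suc k) h"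
  unfolding edge_divisible.simps by blast

text \<open>
  Membership of \<open>x\<^sup>h\<close> in the \<open>k\<close>-th symbolic power: \<open>x\<^sup>h\<close> is in the \<open>k\<close>-th power of the prime
  generated by \<open>C\<close> iff \<open>C\<close> has weight at least \<open>k\<close>.
\<close>

definition cover_heavy :: "'v set \<Rightarrow> 'v set set \<Rightarrow> nat \<Rightarrow> ('v \<Rightarrow> nat) \<Rightarrow> bool" where
  "cover_heavy V E k h \<longleftrightarrow> (\<forall>C. vertex_cover V E C \<longrightarrow> k \<le> sum h C)"

lemma edge_divisible_mono:
  "edge_divisible E k h \<Longrightarrow> (\<And>v. h v \<le> h' v) \<Longrightarrow> edge_divisible E k h'"
proof (induction k arbitrary: h h')
  case (Suc k)
  then obtain i j where ij: "{i, j} \<in> E" "i \<noteq> j" "1 \<le> h i" "1 \<le> h j"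
    "edge_divisible E k (h(i := h i - 1, j := h j - 1))" by auto
  have "edge_divisible E k (h'(i := h' i - 1, j := h' j - 1))"
    by (rule Suc.IH[OF ij(5)]) (use Suc.prems(2) in \<open>auto intro: diff_le_mono\<close>)
  moreover have "1 \<le> h' i" "1 \<le> h' j" using ij(3,4) Suc.prems(2) le_trans by blast+
  ultimately show ?case using ij(1,2) by auto
qed simp

lemma cover_heavy_mono:
  "cover_heavy V E k h \<Longrightarrow> (\<And>v. h v \<le> h' v) \<Longrightarrow> cover_heavy V E k h'"
  unfolding cover_heavy_def by (meson le_trans sum_mono)

lemma edge_divisible_imp_cover_heavy:
  assumes "finite V" "edge_divisible E k h"
  shows "cover_heavy V E k h"
  unfolding cover_heavy_def
proof (intro allI impI)
  fix C assume C: "vertex_cover V E C"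
  then have finC: "finite C" using assms(1) finite_subset unfolding vertex_cover_def by blast
  show "k \<le> sum h C"
    using assms(2)
  proof (induction k arbitrary: h)
    case (Suc k)
    then obtain i j where ij: "{i, j} \<in> E" "i \<noteq> j" "1 \<le> h i" "1 \<le> h j"
      "edge_divisible E k (h(i := h i - 1, j := h j - 1))" by auto
    let ?h = "h(i := h i - 1, j := h j - 1)"
    have "k \<le> sum ?h C" by (rule Suc.IH[OF ij(5)])
    also have "sum ?h C < sum h C"
    proof (rule sum_strict_mono_ex1[OF finC])
      have "i \<in> C \<or> j \<in> C" using C ij(1) unfolding vertex_cover_def by blast
      then show "\<exists>x\<in>C. ?h x < h x" using ij(2-4) by auto
    qed auto
    finally show ?case by simp
  qed simp
qed

lemma edge_divisible_edge:
  "{i, j} \<in> E \<Longrightarrow> i \<noteq> j \<Longrightarrow> k \<le> g i \<Longrightarrow> k \<le> g j \<Longrightarrow> edge_divisible E k g"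
proof (induction k arbitrary: g)
  case (Suc k)
  have "edge_divisible E k (g(i := g i - 1, j := g j - 1))"
    by (rule Suc.IH) (use Suc.prems in auto)
  then show ?case using Suc.prems by (intro edge_divisible_SucI[of i j]) auto
qed simp

text \<open>
  Each unit of weight on the neighbourhood \<open>N\<close> of \<open>F\<close> can be matched with a vertex of \<open>F\<close>, if the
  weight on \<open>F\<close> is large. These edges do not interfere with those found outside \<open>F \<union> N\<close>.
\<close>

lemma edge_divisible_add_neighbours:
  assumes "finite N" "F \<inter> N = {}" and nb: "\<And>v. v \<in> N \<Longrightarrow> \<exists>w\<in>F. {v, w} \<in> E"
    and r: "edge_divisible E m r" "\<And>v. v \<in> F \<union> N \<Longrightarrow> r v = 0"
    and "\<And>v. r v \<le> g v" "j \<le> sum g N" "\<And>w. w \<in> F \<Longrightarrow> j \<le> g w"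
  shows "edge_divisible E (m + j) g"
  using assms(6-8)
proof (induction j arbitrary: g)
  case 0
  then show ?case using edge_divisible_mono[OF r(1)] by auto
next
  case (Suc j)
  have "sum g N \<noteq> 0" using Suc.prems(2) by simp
  then obtain v where v: "v \<in> N" "1 \<le> g v"
    using assms(1) by (metis One_nat_def Suc_leI neq0_conv sum.neutral)
  obtain w where w: "w \<in> F" "{v, w} \<in> E" using nb v by blast
  have vw: "v \<noteq> w" "w \<notin> N" using assms(2) v w by auto
  let ?g = "g(v := g v - 1, w := g w - 1)"
  have "sum ?g N = sum (g(v := g v - 1)) N" by (rule sum.cong) (use vw in auto)
  also have "\<dots> = sum g N - 1"
    using assms(1) v by (simp add: sum.remove[OF assms(1) v(1)])
  finally have "j \<le> sum ?g N" using Suc.prems(2) by simp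
  moreover have "r x \<le> ?g x" for x using Suc.prems(1)[of x] r(2)[of v] r(2)[of w] v w by auto
  moreover have "j \<le> ?g x" if "x \<in> F" for x
    using Suc.prems(3)[OF that] by auto
  ultimately have "edge_divisible E (m + j) ?g" by (intro Suc.IH)
  then have "edge_divisible E (Suc (m + j)) g"
    using v w vw Suc.prems(3)[OF w(1)] by (intro edge_divisible_SucI[of v w]) auto
  then show ?case by simp
qed

text \<open>
  Otherwise the vertices of weight zero form a cover.
\<close>

lemma edge_divisible_1:
  assumes "\<And>i j. {i, j} \<in> E \<Longrightarrow> i \<noteq> j \<and> i \<in> V" "cover_heavy V E 1 f"
  shows "\<exists>i j. {i, j} \<in> E \<and> 1 \<le> f i \<and> 1 \<le> f j"
proof (rule ccontr)
  assume no: "\<not> ?thesis"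
  have "{i, j} \<in> E \<Longrightarrow> i \<in> V \<and> j \<in> V" for i j using assms(1) by (metis insert_commute)
  then have "vertex_cover V E {v\<in>V. f v = 0}"
    using no unfolding vertex_cover_def by (auto simp: not_le)
  then have "1 \<le> sum f {v\<in>V. f v = 0}" using assms(2) unfolding cover_heavy_def by blast
  then show False by simp
qed

lemma edge_divisible_2I:
  assumes "{i, j} \<in> E" "{k, l} \<in> E" "i \<noteq> j" "k \<noteq> l"
    and "\<And>v. of_bool (v = i) + of_bool (v = j) + of_bool (v = k) + of_bool (v = l) \<le> f v"
  shows "edge_divisible E 2 f"
proof -
  have "1 \<le> f i" "1 \<le> f j" using assms(5)[of i] assms(5)[of j] by auto
  moreover have "1 \<le> (f(i := f i - 1, j := f j - 1)) k" "1 \<le> (f(i := f i - 1, j := f j - 1)) l"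
    using assms(3,4) assms(5)[of k] assms(5)[of l] by auto
  ultimately have "edge_divisible E (Suc (Suc 0)) f"
    using assms(1-4) by (intro edge_divisible_SucI[of i j] edge_divisible_SucI[of k l]) auto
  then show ?thesis by (simp only: numeral_2_eq_2)
qed

text \<open>
  If all covers have weight at least two, then for each vertex of weight one there is an edge in the
  support that avoids it. Since no two edges fit into \<open>f\<close>, these edges meet pairwise and close up to a
  triangle.
\<close>

lemma light_triangle_aux:
  assumes fin: "finite V" and E: "\<And>i j. {i, j} \<in> E \<Longrightarrow> i \<noteq> j \<and> i \<in> V"
    and heavy: "cover_heavy V E 2 f" and not2: "\<not> edge_divisible E 2 f"
    and ab: "{a, b} \<in> E" "f a = 1" "1 \<le> f b"
  shows "\<exists>a b c. a \<noteq> b \<and> b \<noteq> c \<and> a \<noteq> c \<and> {a, b} \<in> E \<and> {b, c} \<in> E \<and> {a, c} \<in> E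
     \<and> f a = 1 \<and> f b = 1 \<and> f c = 1"
proof -
  have E': "{i, j} \<in> E \<Longrightarrow> i \<in> V \<and> j \<in> V" for i j using E by (metis insert_commute)
  have avoid: "\<exists>x y. {x, y} \<in> E \<and> x \<noteq> v \<and> y \<noteq> v \<and> 1 \<le> f x \<and> 1 \<le> f y" if v: "v \<in> V" "f v = 1" for v
  proof (rule ccontr)
    assume no: "\<not> ?thesis"
    let ?C = "insert v {w\<in>V. f w = 0}"
    have "vertex_cover V E ?C"
      unfolding vertex_cover_def
    proof (intro conjI allI impI)
      fix i j assume ij: "{i, j} \<in> E"
      have "i = v \<or> j = v \<or> f i = 0 \<or> f j = 0" using no ij by (metis One_nat_def Suc_leI neq0_conv)
      then show "i \<in> ?C \<or> j \<in> ?C" using E'[OF ij] by blast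
    qed (use v in auto)
    then have "2 \<le> sum f ?C" using heavy unfolding cover_heavy_def by blast
    moreover have "sum f ?C = 1" using v fin by (simp add: sum.insert_if)
    ultimately show False by simp
  qed
  have two: False if "{i, j} \<in> E" "{k, l} \<in> E"
    "\<And>v. of_bool (v = i) + of_bool (v = j) + of_bool (v = k) + of_bool (v = l) \<le> f v" for i j k l
    using edge_divisible_2I[OF that(1,2) _ _ that(3)] E that(1,2) not2 by blast
  have ne: "a \<noteq> b" "a \<in> V" using E ab(1) by blast+
  obtain x y where xy: "{x, y} \<in> E" "x \<noteq> a" "y \<noteq> a" "1 \<le> f x" "1 \<le> f y"
    using avoid[of a] ne ab by blast
  have "x = b \<or> y = b"
  proof (rule ccontr)
    assume "\<not> ?thesis"
    then show False
      by (intro two[OF ab(1) xy(1)]) (use xy ab ne E[OF xy(1)] in \<open>auto simp: of_bool_def\<close>)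
  qed
  then obtain c where c: "{b, c} \<in> E" "c \<noteq> a" "1 \<le> f c"
    using xy by (metis insert_commute)
  have bc: "b \<noteq> c" "b \<in> V" using E c(1) by blast+
  have fb: "f b = 1"
  proof (rule ccontr)
    assume "f b \<noteq> 1"
    then have "2 \<le> f b" using ab(3) by simp
    then show False
      by (intro two[OF ab(1) c(1)]) (use ab c ne bc in \<open>auto simp: of_bool_def\<close>)
  qed
  obtain x y where xy: "{x, y} \<in> E" "x \<noteq> b" "y \<noteq> b" "1 \<le> f x" "1 \<le> f y"
    using avoid[of b] bc fb by blast
  have xny: "x \<noteq> y" using E xy(1) by blast
  have "x = a \<or> y = a"
  proof (rule ccontr)
    assume "\<not> ?thesis"
    then show False
      by (intro two[OF ab(1) xy(1)]) (use xy ab ne xny in \<open>auto simp: of_bool_def\<close>)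
  qed
  moreover have "x = c \<or> y = c"
  proof (rule ccontr)
    assume "\<not> ?thesis"
    then show False
      by (intro two[OF c(1) xy(1)]) (use xy c fb bc xny in \<open>auto simp: of_bool_def\<close>)
  qed
  ultimately have ac: "{a, c} \<in> E" using xy(1) xny c(2) by (metis insert_commute)
  have "f c = 1"
  proof (rule ccontr)
    assume "f c \<noteq> 1"
    then have "2 \<le> f c" using c(3) by simp
    then show False
      by (intro two[OF ac c(1)]) (use ab c ne bc fb in \<open>auto simp: of_bool_def\<close>)
  qed
  then show ?thesis using ab c ne bc fb ac by blast
qed

text \<open>
  Two copies of one edge do not fit into \<open>f\<close>, so one of its ends has weight one and serves as the
  starting vertex of the previous lemma.
\<close>

lemma light_triangle:
  assumes fin: "finite V" and E: "\<And>i j. {i, j} \<in> E \<Longrightarrow> i \<noteq> j \<and> i \<in> V"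
    and heavy: "cover_heavy V E 2 f" and not2: "\<not> edge_divisible E 2 f"
  shows "\<exists>a b c. a \<noteq> b \<and> b \<noteq> c \<and> a \<noteq> c \<and> {a, b} \<in> E \<and> {b, c} \<in> E \<and> {a, c} \<in> E
     \<and> f a = 1 \<and> f b = 1 \<and> f c = 1"
proof -
  have "cover_heavy V E 1 f" using heavy unfolding cover_heavy_def by fastforce
  then obtain a b where ab: "{a, b} \<in> E" "1 \<le> f a" "1 \<le> f b" using edge_divisible_1[OF E] by blast
  have "\<not> (2 \<le> f a \<and> 2 \<le> f b)"
    using edge_divisible_edge[OF ab(1), of 2 f] E[OF ab(1)] not2 by blast
  then consider "f a = 1" | "f b = 1" using ab by linarith
  then show ?thesis
  proof cases
    case 1
    then show ?thesis using light_triangle_aux[OF assms ab(1) _ ab(3)] by blast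
  next
    case 2
    have "{b, a} \<in> E" using ab(1) by (simp add: insert_commute)
    from light_triangle_aux[OF assms this 2 ab(2)] show ?thesis .
  qed
qed

text \<open>
  The vector \<open>g\<close> arises from \<open>f\<close> by raising it on \<open>F\<close>. A cover of small weight in \<open>g\<close> must avoid
  \<open>F\<close> and contain its neighbours \<open>N\<close>, which cost their weight \<open>n\<close>; on the other side, \<open>n\<close> edges can
  be found between \<open>F\<close> and \<open>N\<close>. So the discrepancy persists for \<open>k - n\<close> and the restriction \<open>r\<close> of \<open>g\<close> to the
  vertices outside \<open>F \<union> N\<close>. The case \<open>n = 0\<close> is excluded by the light cover of \<open>f\<close>, and
  \<open>k - n = 1\<close> because one edge is easily found. There remains \<open>k = 3\<close>, \<open>n = 1\<close>: the
  triangle comes from \<open>k - n = 2\<close>, and \<open>u\<close> is the vertex of \<open>N\<close> of weight one.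
\<close>

lemma ordinary_symbolic_discrepancy:
  assumes fin: "finite V" and E: "\<And>i j. {i, j} \<in> E \<Longrightarrow> i \<noteq> j \<and> i \<in> V"
    and k: "k = 2 \<or> k = 3" and FV: "F \<subseteq> V"
    and gF: "\<And>v. v \<in> F \<Longrightarrow> k \<le> g v" and gf: "\<And>v. v \<in> V - F \<Longrightarrow> g v = f v"
    and f: "\<not> cover_heavy V E k f" and g: "cover_heavy V E k g" "\<not> edge_divisible E k g"
  shows "k = 3 \<and> (\<exists>a b c u. {a, b, c, u} \<subseteq> V \<and> a \<noteq> b \<and> b \<noteq> c \<and> a \<noteq> c \<and> u \<notin> {a, b, c} \<and>
     {a, b} \<in> E \<and> {b, c} \<in> E \<and> {a, c} \<in> E \<and> f a = 1 \<and> f b = 1 \<and> f c = 1 \<and> f u = 1)"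
proof -
  have E': "{i, j} \<in> E \<Longrightarrow> i \<in> V \<and> j \<in> V" for i j using E by (metis insert_commute)
  define N where "N = {v. \<exists>w\<in>F. {v, w} \<in> E}"
  have NV: "N \<subseteq> V" using E' unfolding N_def by blast
  have finN: "finite N" using NV fin finite_subset by blast
  have nb: "\<And>v. v \<in> N \<Longrightarrow> \<exists>w\<in>F. {v, w} \<in> E" unfolding N_def by blast
  have FN: "F \<inter> N = {}"
  proof (rule ccontr)
    assume "F \<inter> N \<noteq> {}"
    then obtain v w where "v \<in> F" "w \<in> F" "{v, w} \<in> E" unfolding N_def by blast
    then show False using edge_divisible_edge[of v w E k g] E gF g(2) by blast
  qed
  define r where "r v = (if v \<in> V - F - N then g v else 0)" for v
  have rg: "r v \<le> g v" for v unfolding r_def by simp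
  have r0: "r v = 0" if "v \<in> F \<union> N" for v using that unfolding r_def by auto
  have ext: "edge_divisible E (m + j) g"
    if m: "edge_divisible E m r" "j \<le> sum g N" "j \<le> k" for m j
  proof (rule edge_divisible_add_neighbours[OF finN FN nb m(1) r0 rg m(2)])
    show "j \<le> g w" if "w \<in> F" for w using m(3) gF[OF that] by simp
  qed
  define n where "n = sum g N"
  have heavy: "cover_heavy V E (k - n) r"
    unfolding cover_heavy_def
  proof (intro allI impI)
    fix C assume C: "vertex_cover V E C"
    have "vertex_cover V E ((C - F) \<union> N)"
      unfolding vertex_cover_def
    proof (intro conjI allI impI)
      show "C - F \<union> N \<subseteq> V" using C NV unfolding vertex_cover_def by blast
      fix i j assume ij: "{i, j} \<in> E"
      have "{j, i} \<in> E" using ij by (simp add: insert_commute)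
      then show "i \<in> C - F \<union> N \<or> j \<in> C - F \<union> N"
        using C ij unfolding vertex_cover_def N_def by blast
    qed
    then have "k \<le> sum g ((C - F) \<union> N)" using g(1) unfolding cover_heavy_def by blast
    also have "(C - F) \<union> N = (C - F - N) \<union> N" by blast
    also have "sum g \<dots> = sum g (C - F - N) + n"
    proof -
      have "finite (C - F - N)" using C fin finite_subset unfolding vertex_cover_def by blast
      then show ?thesis unfolding n_def by (intro sum.union_disjoint finN) auto
    qed
    also have "sum g (C - F - N) = sum r (C - F - N)"
      by (rule sum.cong) (use C in \<open>auto simp: r_def vertex_cover_def\<close>)
    also have "\<dots> \<le> sum r C"
      by (rule sum_mono2) (use C fin finite_subset in \<open>auto simp: vertex_cover_def\<close>)
    finally show "k - n \<le> sum r C" by simp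
  qed
  have nk: "n < k" using ext[of 0 k] g(2) unfolding n_def by fastforce
  have notdiv: "\<not> edge_divisible E (k - n) r" using ext[of "k - n" n] nk g(2) unfolding n_def by auto
  have "n \<noteq> 0"
  proof
    assume "n = 0"
    obtain C where C: "vertex_cover V E C" "sum f C < k" using f unfolding cover_heavy_def by (auto simp: not_le)
    have "sum r C \<le> sum f C"
      by (rule sum_mono) (use gf in \<open>auto simp: r_def\<close>)
    then show False using heavy C \<open>n = 0\<close> unfolding cover_heavy_def by fastforce
  qed
  moreover have "k - n \<noteq> 1"
  proof
    assume 1: "k - n = 1"
    then obtain i j where "{i, j} \<in> E" "1 \<le> r i" "1 \<le> r j" using edge_divisible_1[OF E] heavy by metis
    then show False using edge_divisible_edge[of i j E 1 r] E notdiv 1 by metis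
  qed
  ultimately have kn: "k = 3" "n = 1" "k - n = 2" using k nk by auto
  obtain a b c where abc: "a \<noteq> b" "b \<noteq> c" "a \<noteq> c" "{a, b} \<in> E" "{b, c} \<in> E" "{a, c} \<in> E"
    "r a = 1" "r b = 1" "r c = 1"
    using light_triangle[OF fin E heavy[unfolded kn(3)] notdiv[unfolded kn(3)]] by blast
  have r1: "v \<in> V - F - N \<and> f v = 1" if "r v = 1" for v
    using that gf unfolding r_def by (metis DiffD1 zero_neq_one)
  obtain u where u: "u \<in> N" "g u \<noteq> 0"
    using kn(2) unfolding n_def by (metis sum.neutral zero_neq_one)
  have "g u \<le> n" unfolding n_def by (rule member_le_sum[OF u(1) _ finN]) auto
  then have "g u = 1" using u(2) kn(2) by simp
  moreover have "u \<in> V - F" using u(1) NV FN by blast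
  ultimately have "f u = 1" using gf[of u] by simp
  moreover have "u \<notin> {a, b, c}" using r1 abc u(1) by blast
  moreover have "{a, b, c, u} \<subseteq> V" using r1 abc u(1) NV by blast
  ultimately show ?thesis using kn(1) abc r1 by blast
qed

text \<open>
  The degree complexes in terms of exponents: on \<open>G\<close> the exponent is \<open>h\<close> and the set \<open>F\<close> is forced to
  contain \<open>G\<close>; on the other vertices membership in \<open>F\<close> raises the exponent by \<open>M\<close>.
\<close>

definition exponent_complex :: "'v set \<Rightarrow> nat \<Rightarrow> (('v \<Rightarrow> nat) \<Rightarrow> bool) \<Rightarrow> 'v set \<Rightarrow> ('v \<Rightarrow> nat) \<Rightarrow> 'v set set" where
  "exponent_complex V M P G h =
     {F. G \<subseteq> F \<and> F \<subseteq> V \<and> \<not> P (\<lambda>v. h v + (if v \<in> F - G then M else 0))}"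

text \<open>
  The combinatorial heart. If the families for ordinary and symbolic powers differ, then
  \<open>k = 3\<close>, and a cover of weight at most \<open>2\<close> has two vertices on a triangle \<open>abc\<close> of weight one
  and weight zero elsewhere, so it avoids the set \<open>T\<close> of the remaining vertices in the support of
  \<open>h\<close>. If \<open>T\<close> has a vertex outside \<open>G\<close>, this vertex is an apex. Otherwise \<open>h\<close> may be replaced by \<open>h'\<close>, which
  is \<open>1\<close> on \<open>abc\<close> and \<open>3\<close> on \<open>T\<close>. The discrepancy lemma excludes a difference for \<open>h'\<close>, as the vector
  \<open>t\<close> has no fourth vertex of weight one. The value \<open>3\<close> must be at least \<open>k\<close> and below the step
  \<open>4\<close>, which is why the powers are fourth powers.
\<close>

lemma symbolic_exponent_complex_cases:
  assumes fin: "finite V" and E: "\<And>i j. {i, j} \<in> E \<Longrightarrow> i \<noteq> j \<and> i \<in> V"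
    and k: "k = 2 \<or> k = 3"
    and hG: "\<And>v. v \<in> G \<Longrightarrow> h v < 4" and hV: "\<And>v. v \<notin> V \<Longrightarrow> h v = 0"
  defines "D \<equiv> exponent_complex V 4 (cover_heavy V E k) G h"
  shows "(\<exists>v. \<forall>F. F \<in> D \<longleftrightarrow> insert v F \<in> D) \<or>
    (\<exists>h'. (\<forall>v\<in>G. h' v < 4) \<and> (\<forall>v. v \<notin> V \<longrightarrow> h' v = 0) \<and>
      D = exponent_complex V 4 (edge_divisible E k) G h')"
proof (cases "cover_heavy V E k h")
  case True
  have "F \<notin> D" for F
    using cover_heavy_mono[OF True, of "\<lambda>v. h v + (if v \<in> F - G then 4 else 0)"]
    unfolding D_def exponent_complex_def by auto
  then show ?thesis by auto
next
  case light: False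
  let ?g = "\<lambda>h F v. h v + (if v \<in> F - G then 4 else 0 :: nat)"
  show ?thesis
  proof (cases "\<forall>F. G \<subseteq> F \<and> F \<subseteq> V \<and> cover_heavy V E k (?g h F) \<longrightarrow> edge_divisible E k (?g h F)")
    case True
    then have "D = exponent_complex V 4 (edge_divisible E k) G h"
      using edge_divisible_imp_cover_heavy[OF fin] unfolding D_def exponent_complex_def by blast
    then show ?thesis using hG hV by blast
  next
    case False
    then obtain F1 where F1: "G \<subseteq> F1" "F1 \<subseteq> V" "cover_heavy V E k (?g h F1)"
      "\<not> edge_divisible E k (?g h F1)" by blast
    have "k = 3 \<and> (\<exists>a b c u. {a, b, c, u} \<subseteq> V \<and> a \<noteq> b \<and> b \<noteq> c \<and> a \<noteq> c \<and> u \<notin> {a, b, c} \<and>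
     {a, b} \<in> E \<and> {b, c} \<in> E \<and> {a, c} \<in> E \<and> h a = 1 \<and> h b = 1 \<and> h c = 1 \<and> h u = 1)"
      by (rule ordinary_symbolic_discrepancy[OF fin E k _ _ _ light F1(3,4), of "F1 - G"])
        (use F1 k in auto)
    then obtain a b c u where k3: "k = 3" and abcV: "{a, b, c, u} \<subseteq> V"
      and abc: "a \<noteq> b" "b \<noteq> c" "a \<noteq> c" "{a, b} \<in> E" "{b, c} \<in> E" "{a, c} \<in> E"
        "h a = 1" "h b = 1" "h c = 1" by blast
    have finC: "finite C" if "vertex_cover V E C" for C
      using that fin finite_subset unfolding vertex_cover_def by blast
    \<comment> \<open>A cover contains two vertices of the triangle, which already weigh two.\<close>
    have off_triangle: "h v = 0" if C: "vertex_cover V E C" "sum h C < 3" "v \<in> C" "v \<notin> {a, b, c}" for C v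
    proof -
      have hit: "a \<in> C \<or> b \<in> C" "b \<in> C \<or> c \<in> C" "a \<in> C \<or> c \<in> C"
        using C(1) abc(4-6) by (simp_all add: vertex_cover_def)
      obtain p q where pq: "p \<in> {a, b, c}" "q \<in> {a, b, c}" "p \<noteq> q" "p \<in> C" "q \<in> C"
      proof (cases "a \<in> C")
        case True
        then show ?thesis using that[of a b] that[of a c] hit(2) abc(1-3) by simp blast
      next
        case False
        then show ?thesis using that[of b c] hit abc(1-3) by simp
      qed
      have "sum h {p, q, v} \<le> sum h C"
        by (rule sum_mono2[OF finC[OF C(1)]]) (use pq C in auto)
      moreover have "h p = 1" "h q = 1" "v \<noteq> p" "v \<noteq> q" using pq(1,2) C(4) abc(7-9) by blast+
      then have "sum h {p, q, v} = 2 + h v" using pq(3) by simp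
      ultimately show ?thesis using C(2) by simp
    qed
    have sum_h_le: "sum h C \<le> sum (?g h F) C" for C F by (rule sum_mono) simp
    have light_avoids: "v \<notin> F - G" if "vertex_cover V E C" "sum (?g h' F) C < 3" "v \<in> C" for h' F C v
    proof
      assume v: "v \<in> F - G"
      have "?g h' F v \<le> sum (?g h' F) C" by (rule member_le_sum) (use that finC in auto)
      then show False using that(2) v by simp
    qed
    define T where "T = {v\<in>V. h v \<noteq> 0} - {a, b, c}"
    show ?thesis
    proof (cases "T \<subseteq> G")
      case False
      then obtain v where v: "v \<in> T" "v \<notin> G" by blast
      have "F \<in> D \<longleftrightarrow> insert v F \<in> D" for F
      proof
        assume F: "F \<in> D"
        then obtain C where C: "vertex_cover V E C" "sum (?g h F) C < 3"
          unfolding D_def exponent_complex_def cover_heavy_def k3 by (auto simp: not_le)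
        have "sum h C < 3" using sum_h_le[of C F] C(2) by simp
        have "h v \<noteq> 0" "v \<notin> {a, b, c}" using v(1) by (simp_all add: T_def)
        then have "v \<notin> C" using off_triangle[OF C(1) \<open>sum h C < 3\<close>, of v] by satx
        then have "sum (?g h (insert v F)) C = sum (?g h F) C" by (intro sum.cong) auto
        then have "\<not> 3 \<le> sum (?g h (insert v F)) C" using C(2) by linarith
        then have "\<not> cover_heavy V E k (?g h (insert v F))"
          using C(1) unfolding cover_heavy_def k3 by blast
        then show "insert v F \<in> D" using F v(1) unfolding D_def exponent_complex_def T_def by auto
      next
        assume F: "insert v F \<in> D"
        have le: "?g h F x \<le> ?g h (insert v F) x" for x by auto
        have "\<not> cover_heavy V E k (?g h (insert v F))"
          using F unfolding D_def exponent_complex_def by blast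
        then have "\<not> cover_heavy V E k (?g h F)"
          using cover_heavy_mono[of V E k "?g h F" "?g h (insert v F)", OF _ le] by blast
        then show "F \<in> D" using F v(2) unfolding D_def exponent_complex_def by auto
      qed
      then show ?thesis by blast
    next
      case TG: True
      define t where "t v = (if v \<in> {a, b, c} then 1 else 0 :: nat)" for v
      \<comment> \<open>Weight 3 on T forbids covers that meet T, exactly as membership in F does.\<close>
      define h' where "h' v = (if v \<in> T then 3 else t v)" for v
      have T0: "h v = 0" if "v \<notin> T" "v \<notin> {a, b, c}" for v
        using that hV unfolding T_def by blast
      have t_le: "t v \<le> h v" for v using abc unfolding t_def by auto
      have t_light: "\<not> cover_heavy V E k t" using light cover_heavy_mono[of V E k t h] t_le by blast
      have "F \<in> D \<longleftrightarrow> F \<in> exponent_complex V 4 (edge_divisible E k) G h'" for F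
      proof (cases "G \<subseteq> F \<and> F \<subseteq> V")
        case False
        then show ?thesis unfolding D_def exponent_complex_def by auto
      next
        case FG: True
        have same: "sum (?g h F) C = sum (?g h' F) C" if "\<And>v. v \<in> C \<Longrightarrow> v \<notin> T" for C
          by (rule sum.cong) (use that T0 abc in \<open>auto simp: h'_def t_def\<close>)
        have "cover_heavy V E k (?g h F) \<longleftrightarrow> edge_divisible E k (?g h' F)"
        proof
          assume heavy: "cover_heavy V E k (?g h F)"
          have "cover_heavy V E k (?g h' F)"
            unfolding cover_heavy_def
          proof (intro allI impI, rule ccontr)
            fix C assume C: "vertex_cover V E C" "\<not> k \<le> sum (?g h' F) C"
            have "v \<notin> T" if "v \<in> C" for v
            proof
              assume "v \<in> T"
              have "?g h' F v \<le> sum (?g h' F) C" by (rule member_le_sum) (use that finC C in auto)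
              then show False using C(2) k3 \<open>v \<in> T\<close> by (simp add: h'_def)
            qed
            then have "sum (?g h F) C = sum (?g h' F) C" by (rule same)
            moreover have "k \<le> sum (?g h F) C"
              using heavy C(1) unfolding cover_heavy_def by blast
            ultimately show False using C(2) by simp
          qed
          then show "edge_divisible E k (?g h' F)"
          proof (rule contrapos_pp)
            assume nd: "\<not> edge_divisible E k (?g h' F)"
            show "\<not> cover_heavy V E k (?g h' F)"
            proof
              assume heavy': "cover_heavy V E k (?g h' F)"
              have "k = 3 \<and> (\<exists>a' b' c' u'. {a', b', c', u'} \<subseteq> V \<and> a' \<noteq> b' \<and> b' \<noteq> c' \<and> a' \<noteq> c' \<and>
                 u' \<notin> {a', b', c'} \<and> {a', b'} \<in> E \<and> {b', c'} \<in> E \<and> {a', c'} \<in> E \<and>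
                 t a' = 1 \<and> t b' = 1 \<and> t c' = 1 \<and> t u' = 1)"
              proof (rule ordinary_symbolic_discrepancy[OF fin E k _ _ _ t_light heavy' nd])
                show "F - G \<union> T \<subseteq> V" using FG unfolding T_def by blast
                show "k \<le> ?g h' F v" if "v \<in> F - G \<union> T" for v
                  using that k3 by (auto simp: h'_def)
                show "?g h' F v = t v" if "v \<in> V - (F - G \<union> T)" for v
                  using that by (auto simp: h'_def)
              qed
              then obtain a' b' c' u' where d: "a' \<noteq> b'" "b' \<noteq> c'" "a' \<noteq> c'" "u' \<notin> {a', b', c'}"
                "t a' = 1" "t b' = 1" "t c' = 1" "t u' = 1" by blast
              have t1: "x \<in> {a, b, c}" if "t x = 1" for x
                by (rule ccontr) (use that in \<open>simp add: t_def\<close>)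
              have "{a', b', c', u'} \<subseteq> {a, b, c}" using t1 d(5-8) by simp
              then have "card {a', b', c', u'} \<le> card {a, b, c}" by (intro card_mono) simp_all
              moreover have "card {a', b', c', u'} = 4" using d(1-3) d(4) by (auto simp: card_insert_if)
              moreover have "card {a, b, c} = 3" using abc(1-3) by simp
              ultimately show False by simp
            qed
          qed
        next
          assume div: "edge_divisible E k (?g h' F)"
          show "cover_heavy V E k (?g h F)"
            unfolding cover_heavy_def
          proof (intro allI impI, rule ccontr)
            fix C assume C: "vertex_cover V E C" "\<not> k \<le> sum (?g h F) C"
            have lt: "sum h C < 3" using sum_h_le[of C F] C(2) k3 by simp
            have "v \<notin> T" if "v \<in> C" for v
              using off_triangle[OF C(1) lt that] unfolding T_def by force
            then have "sum (?g h F) C = sum (?g h' F) C" by (rule same)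
            moreover have "k \<le> sum (?g h' F) C"
              using edge_divisible_imp_cover_heavy[OF fin div] C(1) unfolding cover_heavy_def by blast
            ultimately show False using C(2) by simp
          qed
        qed
        then show ?thesis using FG unfolding D_def exponent_complex_def by auto
      qed
      then have "D = exponent_complex V 4 (edge_divisible E k) G h'" by blast
      moreover have "\<forall>v\<in>G. h' v < 4" unfolding h'_def t_def by auto
      moreover have "\<forall>v. v \<notin> V \<longrightarrow> h' v = 0"
      proof (intro allI impI)
        fix v assume "v \<notin> V"
        then have "v \<notin> T" "v \<notin> {a, b, c}" using abcV by (auto simp: T_def)
        then show "h' v = 0" by (simp add: h'_def t_def)
      qed
      ultimately show ?thesis by blast
    qed
  qed
qed

section \<open>Comparing the two powers degree by degree\<close>

text \<open>
  A vertex with \<open>a v < M\<close> has to lie in \<open>F\<close>, since outside \<open>F\<close> its exponent would be negative. These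
  vertices form \<open>G\<close>.
\<close>

lemma degree_complex_eq_exponent_complex:
  fixes a :: "'v::linorder \<Rightarrow>\<^sub>0 nat"
  assumes fin: "finite V" and "0 < M" and a: "keys a \<subseteq> V"
  defines "G \<equiv> {v\<in>V. lookup a v < M}"
    and "h \<equiv> \<lambda>v. if lookup a v < M then lookup a v else lookup a v - M"
  shows "degree_complex M V {m. P (lookup m)} a = exponent_complex V M P G h"
proof (rule Set.set_eqI)
  fix F
  show "F \<in> degree_complex M V {m. P (lookup m)} a \<longleftrightarrow> F \<in> exponent_complex V M P G h"
  proof (cases "F \<subseteq> V \<and> G \<subseteq> F")
    case True
    have "lookup (complement_exponent M V F) v \<le> lookup a v" for v
      using True by (auto simp: lookup_complement_exponent[OF fin] G_def not_less)
    then obtain e where e: "a = e + complement_exponent M V F"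
      by (metis poly_mapping_le_iff_ex_add)
    have av: "lookup a v = 0" if "v \<notin> V" for v
      using that a by (auto simp: in_keys_iff)
    have "lookup e v = h v + (if v \<in> F - G then M else 0)" for v
    proof -
      have "lookup a v = lookup e v + (if v \<in> V - F then M else 0)"
        unfolding e by (simp add: lookup_add lookup_complement_exponent[OF fin])
      then show ?thesis using True av[of v] \<open>0 < M\<close>
        by (cases "v \<in> V"; cases "v \<in> F") (auto simp: h_def G_def)
    qed
    then have le: "lookup e = (\<lambda>v. h v + (if v \<in> F - G then M else 0))" by blast
    have "F \<in> degree_complex M V {m. P (lookup m)} a \<longleftrightarrow> \<not> P (lookup e)"
      using True unfolding degree_complex_def e by (auto simp: add.commute[of e])
    also have "\<dots> \<longleftrightarrow> F \<in> exponent_complex V M P G h"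
      unfolding le exponent_complex_def using True by simp
    finally show ?thesis .
  next
    case False
    have "G \<subseteq> F" if "F \<subseteq> V" "a = complement_exponent M V F + e" for e
    proof
      fix v assume "v \<in> G"
      then have "v \<in> V" "lookup a v < M" by (auto simp: G_def)
      then show "v \<in> F" unfolding that(2)
        by (auto simp: lookup_add lookup_complement_exponent[OF fin] split: if_splits)
    qed
    then show ?thesis using False unfolding degree_complex_def exponent_complex_def by blast
  qed
qed

text \<open>
  Conversely every pair \<open>(G, h)\<close> with \<open>h < M\<close> on \<open>G\<close> comes from a multidegree.
\<close>

lemma ex_degree_of_exponents:
  fixes h :: "'v::linorder \<Rightarrow> nat"
  assumes fin: "finite V" and "0 < M" and G: "G \<subseteq> V" "\<And>v. v \<in> G \<Longrightarrow> h v < M" and hV: "\<And>v. v \<notin> V \<Longrightarrow> h v = 0"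
  shows "\<exists>a. keys a \<subseteq> V \<and>
    degree_complex M V {m. P (lookup m)} a = exponent_complex V M P G h"
proof -
  define a where "a = Abs_poly_mapping (\<lambda>v. h v + (if v \<in> V - G then M else 0))"
  have "finite {v. h v + (if v \<in> V - G then M else 0) \<noteq> 0}"
  proof (rule finite_subset[OF _ fin], rule subsetI)
    fix v assume "v \<in> {v. h v + (if v \<in> V - G then M else 0) \<noteq> 0}"
    then show "v \<in> V" using hV[of v] by (cases "v \<in> V") simp_all
  qed
  then have la: "lookup a v = h v + (if v \<in> V - G then M else 0)" for v
    unfolding a_def by simp
  have keys: "keys a \<subseteq> V"
  proof
    fix v assume "v \<in> keys a"
    then have "lookup a v \<noteq> 0" by (simp add: in_keys_iff)
    then show "v \<in> V" using hV[of v] unfolding la by (cases "v \<in> V") auto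
  qed
  have lt: "lookup a v < M \<longleftrightarrow> v \<in> G \<or> v \<notin> V" for v
    unfolding la using G hV[of v] \<open>0 < M\<close> by auto
  have GE: "{v\<in>V. lookup a v < M} = G" using lt G by auto
  have hE: "(\<lambda>v. if lookup a v < M then lookup a v
      else lookup a v - M) = h"
    unfolding lt by (rule ext) (use G in \<open>auto simp: la\<close>)
  have "degree_complex M V {m. P (lookup m)} a = exponent_complex V M P G h"
    using degree_complex_eq_exponent_complex[OF fin \<open>0 < M\<close> keys, of P] unfolding GE hE .
  then show ?thesis using keys by blast
qed

definition ordinary_exponents :: "'v set set \<Rightarrow> nat \<Rightarrow> ('v \<Rightarrow>\<^sub>0 nat) set" where
  "ordinary_exponents E k = {m. edge_divisible E k (lookup m)}"

definition symbolic_exponents :: "'v set \<Rightarrow> 'v set set \<Rightarrow> nat \<Rightarrow> ('v \<Rightarrow>\<^sub>0 nat) set" where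
  "symbolic_exponents V E k = {m. cover_heavy V E k (lookup m)}"

lemma up_closed_ordinary_exponents: "up_closed (ordinary_exponents E k)"
  unfolding up_closed_def ordinary_exponents_def
proof (intro ballI allI CollectI)
  fix m d :: "'a \<Rightarrow>\<^sub>0 nat" assume "m \<in> {m. edge_divisible E k (lookup m)}"
  then have "edge_divisible E k (lookup m)" by simp
  then show "edge_divisible E k (lookup (d + m))"
    by (rule edge_divisible_mono) (simp add: lookup_add)
qed

lemma up_closed_symbolic_exponents: "up_closed (symbolic_exponents V E k)"
  unfolding up_closed_def symbolic_exponents_def
proof (intro ballI allI CollectI)
  fix m d :: "'a \<Rightarrow>\<^sub>0 nat" assume "m \<in> {m. cover_heavy V E k (lookup m)}"
  then have "cover_heavy V E k (lookup m)" by simp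
  then show "cover_heavy V E k (lookup (d + m))"
    by (rule cover_heavy_mono) (simp add: lookup_add)
qed

text \<open>
  Every multidegree for the symbolic power is either acyclic or has the same complex as some
  multidegree for the ordinary power, where the cohomology vanishes by assumption.
\<close>

theorem koszul_vanishes_symbolic:
  fixes V :: "'v::linorder set"
  assumes fin: "finite V" and E: "\<And>i j. {i, j} \<in> E \<Longrightarrow> i \<noteq> j \<and> i \<in> V" and k: "k = 2 \<or> k = 3"
    and van: "carrier_ring.koszul_vanishes (polys V) (var_power 4) V
      (monomial_ideal V (ordinary_exponents E k) :: ('v, 'k::comm_ring_1) mpoly set) i"
  shows "carrier_ring.koszul_vanishes (polys V) (var_power 4) V
      (monomial_ideal V (symbolic_exponents V E k) :: ('v, 'k) mpoly set) i"
proof (rule koszul_vanishes_of_cochain_vanishes[OF fin up_closed_symbolic_exponents])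
  fix a :: "'v \<Rightarrow>\<^sub>0 nat" assume a: "keys a \<subseteq> V"
  define G where "G = {v\<in>V. lookup a v < 4}"
  define h where "h v = (if lookup a v < 4 then lookup a v
    else lookup a v - 4)" for v
  let ?D = "exponent_complex V 4 (cover_heavy V E k) G h"
  have D: "degree_complex 4 V (symbolic_exponents V E k) a = ?D"
    unfolding symbolic_exponents_def G_def h_def
    by (rule degree_complex_eq_exponent_complex[OF fin _ a]) simp
  have "h v < 4" if "v \<in> G" for v using that by (simp add: G_def h_def)
  moreover have "h v = 0" if "v \<notin> V" for v
  proof -
    have "v \<notin> keys a" using that a by blast
    then show ?thesis by (simp add: h_def in_keys_iff)
  qed
  ultimately consider (cone) v where "\<And>F. F \<in> ?D \<longleftrightarrow> insert v F \<in> ?D"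
    | (degree) h' where "\<forall>v\<in>G. h' v < 4" "\<forall>v. v \<notin> V \<longrightarrow> h' v = 0"
        "?D = exponent_complex V 4 (edge_divisible E k) G h'"
    using symbolic_exponent_complex_cases[OF fin E k, where G = G and h = h] by metis
  then show "cochain_vanishes TYPE('k) (degree_complex 4 V (symbolic_exponents V E k) a) i"
  proof cases
    case cone
    show ?thesis unfolding D
    proof (rule cochain_vanishes_cone[OF _ cone])
      show "finite F" if "F \<in> ?D" for F
        using that fin finite_subset unfolding exponent_complex_def by blast
    qed
  next
    case degree
    have "G \<subseteq> V" by (auto simp: G_def)
    then obtain a' where a': "keys a' \<subseteq> V"
      "degree_complex 4 V (ordinary_exponents E k) a' = ?D"
      using ex_degree_of_exponents[OF fin, of 4 G h' "edge_divisible E k"] degree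
      unfolding ordinary_exponents_def by auto
    show ?thesis unfolding D a'(2)[symmetric]
      by (rule cochain_vanishes_of_koszul_vanishes[OF fin up_closed_ordinary_exponents van a'(1)])
  qed
qed

section \<open>Regular sequences on the quotient module\<close>

text \<open>
  The ideal obtained by adjoining \<open>gs\<close> successively consists of \<open>L\<close> plus the linear combinations of
  \<open>gs\<close>, which is how submodules \<open>(f\<^sub>1, \<dots>, f\<^sub>r) M\<close> are described.
\<close>

lemma (in carrier_ring) mem_foldl_adjoin:
  assumes L: "ideal_in L" and "set gs \<subseteq> R"
  shows "ideal_in (foldl adjoin L gs)"
    and "L \<subseteq> foldl adjoin L gs"
    and "q \<in> foldl adjoin L gs \<longleftrightarrow> (\<exists>r. (\<forall>j. r j \<in> R) \<and> q - (\<Sum>j<length gs. gs ! j * r j) \<in> L)"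
proof -
  show id: "ideal_in (foldl adjoin L gs)"
    using assms(2) by (induction gs rule: rev_induct) (auto simp: L intro: ideal_in_adjoin)
  show "L \<subseteq> foldl adjoin L gs"
    by (induction gs rule: rev_induct) (use subset_adjoin in auto)
  show "q \<in> foldl adjoin L gs \<longleftrightarrow> (\<exists>r. (\<forall>j. r j \<in> R) \<and> q - (\<Sum>j<length gs. gs ! j * r j) \<in> L)"
    using assms(2)
  proof (induction gs arbitrary: q rule: rev_induct)
    case Nil
    show ?case using zero_closed by auto
  next
    case (snoc g gs)
    let ?s = "\<lambda>r. \<Sum>j<length gs. gs ! j * r j"
    have s: "(\<Sum>j<length (gs @ [g]). (gs @ [g]) ! j * r j) = ?s r + g * r (length gs)" for r
      by (simp add: nth_append)
    have sets: "set gs \<subseteq> R" "g \<in> R" using snoc.prems by auto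
    show ?case
    proof
      assume "q \<in> foldl adjoin L (gs @ [g])"
      then obtain a t where at: "q = a + g * t" "a \<in> foldl adjoin L gs" "t \<in> R"
        by (auto simp: adjoin_def)
      then obtain r where r: "\<forall>j. r j \<in> R" "a - ?s r \<in> L" using snoc.IH[OF sets(1)] by blast
      have "?s (r(length gs := t)) = ?s r" by (intro sum.cong) auto
      then have "q - (?s (r(length gs := t)) + g * (r(length gs := t)) (length gs)) \<in> L"
        using r(2) at(1) by (simp add: algebra_simps)
      then show "\<exists>r. (\<forall>j. r j \<in> R) \<and> q - (\<Sum>j<length (gs @ [g]). (gs @ [g]) ! j * r j) \<in> L"
        unfolding s using r(1) at(3) by (intro exI[of _ "r(length gs := t)"]) auto
    next
      assume "\<exists>r. (\<forall>j. r j \<in> R) \<and> q - (\<Sum>j<length (gs @ [g]). (gs @ [g]) ! j * r j) \<in> L"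
      then obtain r where r: "\<forall>j. r j \<in> R" "q - (?s r + g * r (length gs)) \<in> L" unfolding s by blast
      have "q - g * r (length gs) \<in> foldl adjoin L gs"
        using snoc.IH[OF sets(1)] r by (auto simp: algebra_simps)
      from adjoinI[OF this, of "r (length gs)" g] r(1)
      show "q \<in> foldl adjoin L (gs @ [g])" by simp
    qed
  qed
qed

lemma (in carrier_ring) regseq_iff:
  "regseq L fs \<longleftrightarrow> (\<forall>i<length fs. \<forall>p\<in>R. fs ! i * p \<in> foldl adjoin L (take i fs) \<longrightarrow>
      p \<in> foldl adjoin L (take i fs)) \<and> foldl adjoin L fs \<noteq> R"
proof (induction fs arbitrary: L)
  case (Cons f fs)
  show ?case unfolding regseq.simps Cons.IH
    by (auto simp: less_Suc_eq_0_disj)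
qed simp

lemma mpoly_ring_simps [simp]:
  "carrier (mpoly_ring V) = polys V"
  "p \<otimes>\<^bsub>mpoly_ring V\<^esub> q = p * q" "\<one>\<^bsub>mpoly_ring V\<^esub> = 1"
  "\<zero>\<^bsub>mpoly_ring V\<^esub> = 0" "p \<oplus>\<^bsub>mpoly_ring V\<^esub> q = p + q"
  by (simp_all add: mpoly_ring_def polys_def)

lemma cring_mpoly_ring: "cring (mpoly_ring V :: ('v, 'k::comm_ring_1) mpoly ring)"
proof -
  interpret carrier_ring "polys V :: ('v, 'k) mpoly set" by (rule carrier_ring_polys)
  show ?thesis
  proof (rule cringI)
    show "abelian_group (mpoly_ring V :: ('v, 'k) mpoly ring)"
    proof (rule abelian_groupI)
      fix p :: "('v, 'k) mpoly" assume "p \<in> carrier (mpoly_ring V)"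
      then show "\<exists>q\<in>carrier (mpoly_ring V). q \<oplus>\<^bsub>mpoly_ring V\<^esub> p = \<zero>\<^bsub>mpoly_ring V\<^esub>"
        by (intro bexI[of _ "- p"]) auto
    qed (auto simp: add_ac)
    show "Group.comm_monoid (mpoly_ring V :: ('v, 'k) mpoly ring)"
      by (rule Group.comm_monoidI) (auto simp: mult_ac)
  qed (auto simp: distrib_right)
qed

lemma ideal_mpoly_ring_iff:
  "ideal J (mpoly_ring V :: ('v, 'k::comm_ring_1) mpoly ring) \<longleftrightarrow> carrier_ring.ideal_in (polys V) J"
proof -
  interpret carrier_ring "polys V :: ('v, 'k) mpoly set" by (rule carrier_ring_polys)
  interpret S: cring "mpoly_ring V :: ('v, 'k) mpoly ring" by (rule cring_mpoly_ring)
  show ?thesis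
  proof
    assume "ideal J (mpoly_ring V)"
    then interpret J: ideal J "mpoly_ring V" .
    show "ideal_in J"
      unfolding ideal_in_def
      using J.a_subset J.zero_closed J.a_closed J.I_l_closed by auto
  next
    assume J: "ideal_in J"
    note Jd = ideal_inD[OF J]
    show "ideal J (mpoly_ring V)"
    proof (rule idealI[OF S.ring_axioms])
      show "subgroup J (add_monoid (mpoly_ring V))"
      proof
        show "J \<subseteq> carrier (add_monoid (mpoly_ring V))" using Jd(1) by simp
        show "x \<otimes>\<^bsub>add_monoid (mpoly_ring V)\<^esub> y \<in> J" if "x \<in> J" "y \<in> J" for x y
          using that Jd(3) by simp
        show "\<one>\<^bsub>add_monoid (mpoly_ring V)\<^esub> \<in> J" using Jd(2) by simp
        fix x assume x: "x \<in> J"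
        then have "x \<in> polys V" using Jd(1) by auto
        then have "\<ominus>\<^bsub>mpoly_ring V\<^esub> x = - x" by (intro S.minus_equality) auto
        then show "inv\<^bsub>add_monoid (mpoly_ring V)\<^esub> x \<in> J"
          using Jd(5)[OF x] by (simp add: a_inv_def)
      qed
    next
      fix a x :: "('v, 'k) mpoly" assume "a \<in> J" "x \<in> carrier (mpoly_ring V)"
      then show "x \<otimes>\<^bsub>mpoly_ring V\<^esub> a \<in> J" "a \<otimes>\<^bsub>mpoly_ring V\<^esub> x \<in> J"
        using Jd(4)[of x a] by (simp_all add: mult.commute[of a])
    qed
  qed
qed

context
  fixes V :: "'v set" and J :: "('v, 'k::comm_ring_1) mpoly set"
  assumes J: "carrier_ring.ideal_in (polys V) J"
begin

interpretation P: carrier_ring "polys V :: ('v, 'k) mpoly set" by (rule carrier_ring_polys)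
interpretation S: cring "mpoly_ring V :: ('v, 'k) mpoly ring" by (rule cring_mpoly_ring)
interpretation I: ideal J "mpoly_ring V" using J by (simp add: ideal_mpoly_ring_iff)

abbreviation (input) coset where "coset p \<equiv> J +>\<^bsub>mpoly_ring V\<^esub> p"

lemma coset_eq_iff:
  assumes "p \<in> polys V" "q \<in> polys V"
  shows "coset p = coset q \<longleftrightarrow> p - q \<in> J"
proof -
  have coset: "coset p = {j + p | j. j \<in> J}" for p
    by (auto simp: a_r_coset_def')
  note Jd = P.ideal_inD[OF J]
  show ?thesis
  proof
    assume "coset p = coset q"
    moreover have "p \<in> coset p" using Jd(2) unfolding coset by force
    ultimately obtain j where "p = j + q" "j \<in> J" unfolding coset by blast
    then show "p - q \<in> J" by simp
  next
    assume pq: "p - q \<in> J"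
    have "\<exists>j'. j + p = j' + q \<and> j' \<in> J" if "j \<in> J" for j
      using Jd(3)[OF that pq] by (intro exI[of _ "j + (p - q)"]) simp
    moreover have "\<exists>j'. j + q = j' + p \<and> j' \<in> J" if "j \<in> J" for j
      using Jd(6)[OF that pq] by (intro exI[of _ "j - (p - q)"]) simp
    ultimately show "coset p = coset q" unfolding coset by auto
  qed
qed

lemma carrier_quotient_module: "carrier (quotient_module (mpoly_ring V) J) = coset ` polys V"
  by (auto simp: quotient_module_def FactRing_def A_RCOSETS_def')

lemma smult_quotient_module:
  assumes "f \<in> polys V" "p \<in> polys V"
  shows "f \<odot>\<^bsub>quotient_module (mpoly_ring V) J\<^esub> coset p = coset (f * p)"
  using I.rcoset_mult_add[of f p] assms by (simp add: quotient_module_def FactRing_def)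

lemma abelian_monoid_quotient_module: "abelian_monoid (quotient_module (mpoly_ring V) J)"
proof -
  interpret Q: ring "mpoly_ring V Quot J" by (rule I.quotient_is_ring)
  show ?thesis
    by (rule abelian_monoidI) (simp_all add: quotient_module_def Q.a_ac)
qed

lemma finsum_quotient_module:
  fixes n :: nat
  assumes "\<And>j. j < n \<Longrightarrow> p j \<in> polys V"
  shows "finsum (quotient_module (mpoly_ring V) J) (\<lambda>j. coset (p j)) {..<n} = coset (\<Sum>j<n. p j)"
proof -
  let ?M = "quotient_module (mpoly_ring V) J"
  interpret M: abelian_monoid ?M by (rule abelian_monoid_quotient_module)
  show ?thesis
    using assms
  proof (induction n)
    case 0
    have "coset 0 = J" by (simp add: a_r_coset_def')
    moreover have "\<zero>\<^bsub>?M\<^esub> = J" by (simp add: quotient_module_def FactRing_def)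
    ultimately show ?case by simp
  next
    case (Suc n)
    have c: "coset (p j) \<in> carrier ?M" if "j < Suc n" for j
      using Suc.prems[OF that] by (simp add: carrier_quotient_module)
    have "finsum ?M (\<lambda>j. coset (p j)) {..<Suc n} =
       coset (p n) \<oplus>\<^bsub>?M\<^esub> finsum ?M (\<lambda>j. coset (p j)) {..<n}"
      unfolding lessThan_Suc by (rule M.finsum_insert) (use c in auto)
    also have "finsum ?M (\<lambda>j. coset (p j)) {..<n} = coset (\<Sum>j<n. p j)"
      using Suc by simp
    also have "coset (p n) \<oplus>\<^bsub>?M\<^esub> coset (\<Sum>j<n. p j) = coset (p n + (\<Sum>j<n. p j))"
      using I.a_rcos_sum[of "p n" "\<Sum>j<n. p j"] Suc.prems P.sum_closed[of "{..<n}" p]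
      by (simp add: quotient_module_def FactRing_def)
    finally show ?case by (simp add: add.commute)
  qed
qed

text \<open>
  Submodules of \<open>R/J\<close> generated by \<open>gs\<close> are the images of the ideals \<open>(J, gs)\<close>, so regularity on
  \<open>R/J\<close> can be tested on representatives.
\<close>

lemma list_smult_quotient_module:
  assumes gs: "set gs \<subseteq> polys V"
  shows "list_smult (quotient_module (mpoly_ring V) J) gs = coset ` foldl P.adjoin J gs"
proof -
  let ?M = "quotient_module (mpoly_ring V) J"
  note F = P.mem_foldl_adjoin[OF J gs]
  have gj: "gs ! j \<in> polys V" if "j < length gs" for j using gs that by auto
  have sum: "(\<Oplus>\<^bsub>?M\<^esub>j\<in>{..<length gs}. gs ! j \<odot>\<^bsub>?M\<^esub> coset (r j)) = coset (\<Sum>j<length gs. gs ! j * r j)"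
    if "\<And>j. r j \<in> polys V" for r
  proof -
    have "(\<Oplus>\<^bsub>?M\<^esub>j\<in>{..<length gs}. gs ! j \<odot>\<^bsub>?M\<^esub> coset (r j))
        = (\<Oplus>\<^bsub>?M\<^esub>j\<in>{..<length gs}. coset (gs ! j * r j))"
      by (rule abelian_monoid.finsum_cong'[OF abelian_monoid_quotient_module refl])
        (use gj that in \<open>auto simp: smult_quotient_module carrier_quotient_module\<close>)
    then show ?thesis using finsum_quotient_module[of "length gs" "\<lambda>j. gs ! j * r j"] gj that by simp
  qed
  have sum_mem: "(\<Sum>j<length gs. gs ! j * r j) \<in> polys V" if "\<And>j. r j \<in> polys V" for r
    using gj that by (intro P.sum_closed) auto
  show ?thesis
  proof (intro equalityI subsetI)
    fix A assume "A \<in> list_smult ?M gs"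
    then obtain x where x: "x \<in> {..<length gs} \<rightarrow> carrier ?M"
      "A = (\<Oplus>\<^bsub>?M\<^esub>j\<in>{..<length gs}. gs ! j \<odot>\<^bsub>?M\<^esub> x j)" unfolding list_smult_def by auto
    have "\<exists>r. r \<in> polys V \<and> (j < length gs \<longrightarrow> x j = coset r)" for j
    proof (cases "j < length gs")
      case True
      then show ?thesis using x(1) unfolding carrier_quotient_module by auto
    next
      case False
      then show ?thesis using P.zero_closed by blast
    qed
    then obtain r where r: "\<And>j. r j \<in> polys V" "\<And>j. j < length gs \<Longrightarrow> x j = coset (r j)" by metis
    have "A = (\<Oplus>\<^bsub>?M\<^esub>j\<in>{..<length gs}. gs ! j \<odot>\<^bsub>?M\<^esub> coset (r j))"
      unfolding x(2)
      by (rule abelian_monoid.finsum_cong'[OF abelian_monoid_quotient_module refl])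
        (use gj r in \<open>auto simp: smult_quotient_module carrier_quotient_module\<close>)
    then have "A = coset (\<Sum>j<length gs. gs ! j * r j)" using sum r(1) by simp
    moreover have "(\<Sum>j<length gs. gs ! j * r j) \<in> foldl P.adjoin J gs"
      unfolding F(3) using r(1) P.ideal_inD(2)[OF J] by (intro exI[of _ r]) auto
    ultimately show "A \<in> coset ` foldl P.adjoin J gs" by blast
  next
    fix A assume "A \<in> coset ` foldl P.adjoin J gs"
    then obtain q where q: "q \<in> foldl P.adjoin J gs" "A = coset q" by blast
    then obtain r where r: "\<forall>j. r j \<in> polys V" "q - (\<Sum>j<length gs. gs ! j * r j) \<in> J"
      using F(3) by blast
    have "q \<in> polys V" using q(1) P.ideal_inD(1)[OF F(1)] by blast
    then have "A = coset (\<Sum>j<length gs. gs ! j * r j)"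
      unfolding q(2) using coset_eq_iff r sum_mem by blast
    also have "\<dots> = (\<Oplus>\<^bsub>?M\<^esub>j\<in>{..<length gs}. gs ! j \<odot>\<^bsub>?M\<^esub> coset (r j))"
      using sum r(1) by simp
    finally show "A \<in> list_smult ?M gs"
      unfolding list_smult_def using r(1)
      by (intro CollectI exI[of _ "\<lambda>j. coset (r j)"]) (auto simp: carrier_quotient_module)
  qed
qed

lemma coset_mem_list_smult:
  assumes "set gs \<subseteq> polys V" "p \<in> polys V"
  shows "coset p \<in> list_smult (quotient_module (mpoly_ring V) J) gs \<longleftrightarrow> p \<in> foldl P.adjoin J gs"
proof
  note F = P.mem_foldl_adjoin[OF J assms(1)]
  assume "coset p \<in> list_smult (quotient_module (mpoly_ring V) J) gs"
  then obtain q where q: "q \<in> foldl P.adjoin J gs" "coset p = coset q"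
    unfolding list_smult_quotient_module[OF assms(1)] by blast
  then have "q \<in> polys V" using P.ideal_inD(1)[OF F(1)] by blast
  then have "p - q \<in> foldl P.adjoin J gs" using q(2) coset_eq_iff[OF assms(2)] F(2) by blast
  from P.ideal_inD(3)[OF F(1) this q(1)] show "p \<in> foldl P.adjoin J gs" by simp
qed (simp add: list_smult_quotient_module[OF assms(1)])

lemma regular_sequence_quotient_module_iff:
  assumes fs: "set fs \<subseteq> polys V"
  shows "regular_sequence (quotient_module (mpoly_ring V) J) fs \<longleftrightarrow> P.regseq J fs"
proof -
  let ?M = "quotient_module (mpoly_ring V) J"
  have take: "set (take i fs) \<subseteq> polys V" for i using fs set_take_subset by fastforce
  have "(\<forall>x\<in>carrier ?M. fs ! i \<odot>\<^bsub>?M\<^esub> x \<in> list_smult ?M (take i fs) \<longrightarrow> x \<in> list_smult ?M (take i fs)) \<longleftrightarrow>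
    (\<forall>p\<in>polys V. fs ! i * p \<in> foldl P.adjoin J (take i fs) \<longrightarrow> p \<in> foldl P.adjoin J (take i fs))"
    if "i < length fs" for i
  proof -
    have "fs ! i \<in> polys V" using fs that by auto
    then show ?thesis
      unfolding carrier_quotient_module
      by (auto simp: smult_quotient_module coset_mem_list_smult[OF take])
  qed
  moreover have "list_smult ?M fs = carrier ?M \<longleftrightarrow> foldl P.adjoin J fs = polys V"
  proof
    assume eq: "list_smult ?M fs = carrier ?M"
    have "p \<in> foldl P.adjoin J fs" if "p \<in> polys V" for p
      using coset_mem_list_smult[OF fs that] that unfolding eq carrier_quotient_module by blast
    then show "foldl P.adjoin J fs = polys V"
      using P.ideal_inD(1)[OF P.mem_foldl_adjoin(1)[OF J fs]] by blast
  next
    assume "foldl P.adjoin J fs = polys V"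
    then show "list_smult ?M fs = carrier ?M"
      by (simp add: list_smult_quotient_module[OF fs] carrier_quotient_module)
  qed
  ultimately show ?thesis unfolding regular_sequence_def P.regseq_iff by auto
qed

end

section \<open>Powers of edge ideals as monomial ideals\<close>

lemma poly_eq_sum_monomials:
  "p = (\<Sum>m\<in>keys p. single m (lookup p m))"
  for p :: "('v, 'k::comm_ring_1) mpoly"
proof (rule poly_mapping_eqI)
  fix m
  have "lookup (\<Sum>m\<in>keys p. single m (lookup p m)) m
      = (\<Sum>m'\<in>keys p. if m' = m then lookup p m' else 0)"
    unfolding lookup_sum by (intro sum.cong refl) (simp add: lookup_single when_def)
  also have "\<dots> = lookup p m" by (simp add: sum.delta in_keys_iff)
  finally show "lookup p m = lookup
      (\<Sum>m\<in>keys p. single m (lookup p m)) m" by simp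
qed

text \<open>
  It is enough to check monomials, since a polynomial is the sum of its terms.
\<close>

lemma monomial_ideal_subsetI:
  fixes L :: "('v, 'k::comm_ring_1) mpoly set"
  assumes L: "carrier_ring.ideal_in (polys V) L"
    and mon: "\<And>m c. m \<in> U \<Longrightarrow> keys m \<subseteq> V \<Longrightarrow> single m c \<in> L"
  shows "monomial_ideal V U \<subseteq> L"
proof
  interpret carrier_ring "polys V :: ('v, 'k) mpoly set" by (rule carrier_ring_polys)
  fix p :: "('v, 'k) mpoly" assume p: "p \<in> monomial_ideal V U"
  have "(\<Sum>m\<in>keys p. single m (lookup p m)) \<in> L"
    by (intro ideal_in_sum[OF L] mon) (use p in \<open>auto simp: monomial_ideal_def polys_def\<close>)
  then show "p \<in> L" by (subst poly_eq_sum_monomials)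
qed

lemma single_in_monomial_ideal:
  "m \<in> U \<Longrightarrow> keys m \<subseteq> V \<Longrightarrow> single m c \<in> monomial_ideal V U"
  unfolding monomial_ideal_def using single_in_polys[of m V c] by simp

lemma single_one_in_monomial_ideal_iff:
  "single m (1::'k::comm_ring_1) \<in> monomial_ideal V U \<longleftrightarrow> m \<in> U \<and> keys m \<subseteq> V"
  unfolding monomial_ideal_def polys_def by auto

primrec exponent_power :: "('v \<Rightarrow>\<^sub>0 nat) set \<Rightarrow> nat \<Rightarrow> ('v \<Rightarrow>\<^sub>0 nat) set" where
  "exponent_power U 0 = UNIV"
| "exponent_power U (Suc k) = {a + b | a b. a \<in> exponent_power U k \<and> b \<in> U}"

lemma up_closed_exponent_power:
  assumes "up_closed U" shows "up_closed (exponent_power U k)"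
proof (cases k)
  case (Suc j)
  have "\<exists>a' b'. d + (a + b) = a' + b' \<and> a' \<in> exponent_power U j \<and> b' \<in> U"
    if "a \<in> exponent_power U j" "b \<in> U" for a b d
    using that assms unfolding up_closed_def
    by (intro exI[of _ a] exI[of _ "d + b"]) (simp add: add.left_commute)
  then show ?thesis using Suc by (auto simp: up_closed_def)
qed (simp add: up_closed_def)

lemma ideal_prod_monomial_ideal:
  assumes U: "up_closed U" "up_closed W"
  shows "ideal_prod (mpoly_ring V) (monomial_ideal V U) (monomial_ideal V W)
     = (monomial_ideal V {a + b | a b. a \<in> U \<and> b \<in> W} :: ('v, 'k::comm_ring_1) mpoly set)"
    (is "?P = monomial_ideal V ?UW")
proof
  interpret carrier_ring "polys V :: ('v, 'k) mpoly set" by (rule carrier_ring_polys)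
  interpret S: cring "mpoly_ring V :: ('v, 'k) mpoly ring" by (rule cring_mpoly_ring)
  have "ideal (monomial_ideal V U) (mpoly_ring V :: ('v, 'k) mpoly ring)"
    "ideal (monomial_ideal V W) (mpoly_ring V :: ('v, 'k) mpoly ring)"
    using ideal_in_monomial_ideal U by (simp_all add: ideal_mpoly_ring_iff)
  then have P: "ideal_in ?P" using S.ideal_prod_is_ideal by (simp add: ideal_mpoly_ring_iff[symmetric])
  show "?P \<subseteq> monomial_ideal V ?UW"
  proof
    fix p assume "p \<in> ?P"
    then show "p \<in> monomial_ideal V ?UW"
    proof (induction rule: ideal_prod.induct)
      case (prod i j)
      have "i * j \<in> polys V" using prod by (auto simp: monomial_ideal_def)
      moreover have "keys (i * j) \<subseteq> ?UW"
        using keys_mult[of i j] prod unfolding monomial_ideal_def by blast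
      ultimately show ?case by (simp add: monomial_ideal_def)
    next
      case (sum s1 s2)
      then show ?case using Poly_Mapping.keys_add[of s1 s2] by (auto simp: monomial_ideal_def)
    qed
  qed
  show "monomial_ideal V ?UW \<subseteq> ?P"
  proof (rule monomial_ideal_subsetI[OF P])
    fix m c assume m: "m \<in> ?UW" "keys m \<subseteq> V"
    then obtain a b where ab: "m = a + b" "a \<in> U" "b \<in> W" by blast
    have "single a c \<otimes>\<^bsub>mpoly_ring V\<^esub> single b (1::'k) \<in> ?P"
      by (rule ideal_prod.prod)
        (use ab m in \<open>auto intro!: single_in_monomial_ideal simp: keys_add_exponents\<close>)
    then show "single m c \<in> ?P" using ab(1) by (simp add: mult_single)
  qed
qed

lemma ideal_power_monomial_ideal:
  assumes "up_closed U"
  shows "ideal_power (mpoly_ring V) (monomial_ideal V U) k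
     = (monomial_ideal V (exponent_power U k) :: ('v, 'k::comm_ring_1) mpoly set)"
proof (induction k)
  case 0
  show ?case by (simp add: ideal_power_def ideals_set_def monomial_ideal_def nat_pow_def)
next
  case (Suc k)
  have "ideal_power (mpoly_ring V) (monomial_ideal V U) (Suc k)
    = ideal_prod (mpoly_ring V) (ideal_power (mpoly_ring V) (monomial_ideal V U) k)
        (monomial_ideal V U :: ('v, 'k) mpoly set)"
    by (simp add: ideal_power_def ideals_set_def nat_pow_def)
  then show ?case
    unfolding Suc by (simp add: ideal_prod_monomial_ideal[OF up_closed_exponent_power[OF assms] assms])
qed

lemma genideal_mpoly_ring_eqI:
  fixes L :: "('v, 'k::comm_ring_1) mpoly set"
  assumes "carrier_ring.ideal_in (polys V) L" "gens \<subseteq> L"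
    and "\<And>L'. carrier_ring.ideal_in (polys V) L' \<Longrightarrow> gens \<subseteq> L' \<Longrightarrow> L \<subseteq> L'"
  shows "genideal (mpoly_ring V) gens = L"
  unfolding genideal_def ideal_mpoly_ring_iff using assms by blast

text \<open>
  For \<open>k = 1\<close> these are the monomials in the ideal generated by the variables in \<open>C\<close>, for general
  \<open>k\<close> those in its \<open>k\<close>-th power.
\<close>

definition cover_exponents :: "'v set \<Rightarrow> nat \<Rightarrow> ('v \<Rightarrow>\<^sub>0 nat) set" where
  "cover_exponents C k = {m. k \<le> sum (lookup m) C}"

lemma up_closed_cover_exponents: "up_closed (cover_exponents C k)"
  unfolding up_closed_def cover_exponents_def by (auto simp: lookup_add sum.distrib)

lemma exponent_eq_add_single:
  "1 \<le> lookup m v \<Longrightarrow> m = (m - single v 1) + single v (1::nat)"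
  by (rule poly_mapping_eqI) (auto simp: lookup_add lookup_minus lookup_single when_def)

lemma exponent_power_cover:
  assumes "finite C"
  shows "exponent_power (cover_exponents C 1) k = cover_exponents C k"
proof (induction k)
  case 0
  show ?case by (simp add: cover_exponents_def)
next
  case (Suc k)
  show ?case
  proof (intro equalityI subsetI)
    fix m assume "m \<in> exponent_power (cover_exponents C 1) (Suc k)"
    then show "m \<in> cover_exponents C (Suc k)"
      using Suc by (auto simp: cover_exponents_def lookup_add sum.distrib)
  next
    fix m assume m: "m \<in> cover_exponents C (Suc k)"
    then have "sum (lookup m) C \<noteq> 0" by (simp add: cover_exponents_def)
    then obtain v where v: "v \<in> C" "1 \<le> lookup m v"
      by (metis One_nat_def Suc_leI neq0_conv sum.neutral)
    define m' where "m' = m - single v 1"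
    have m': "m = m' + single v 1" unfolding m'_def by (rule exponent_eq_add_single[OF v(2)])
    have s: "sum (lookup (single v (1::nat))) C = 1"
      using v(1) assms by (simp add: lookup_single when_def sum.delta)
    have "k \<le> sum (lookup m') C"
      using m s unfolding m' cover_exponents_def by (simp add: lookup_add sum.distrib)
    then have "m' \<in> exponent_power (cover_exponents C 1) k" using Suc by (simp add: cover_exponents_def)
    moreover have "single v 1 \<in> cover_exponents C 1" using s by (simp add: cover_exponents_def)
    ultimately show "m \<in> exponent_power (cover_exponents C 1) (Suc k)" using m' by auto
  qed
qed

lemma idl_vars_eq_monomial_ideal:
  assumes "finite C" "C \<subseteq> V"
  shows "genideal (mpoly_ring V) (mpoly_var ` C) = (monomial_ideal V (cover_exponents C 1) :: ('v, 'k::comm_ring_1) mpoly set)"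
proof (rule genideal_mpoly_ring_eqI[OF ideal_in_monomial_ideal[OF up_closed_cover_exponents]])
  show "mpoly_var ` C \<subseteq> monomial_ideal V (cover_exponents C 1)"
    unfolding mpoly_var_def
    by (auto intro!: single_in_monomial_ideal simp: cover_exponents_def)
      (use assms in \<open>auto simp: lookup_single when_def sum.delta\<close>)
next
  interpret carrier_ring "polys V :: ('v, 'k) mpoly set" by (rule carrier_ring_polys)
  fix L :: "('v, 'k) mpoly set" assume L: "ideal_in L" "mpoly_var ` C \<subseteq> L"
  show "monomial_ideal V (cover_exponents C 1) \<subseteq> L"
  proof (rule monomial_ideal_subsetI[OF L(1)])
    fix m and c :: 'k assume m: "m \<in> cover_exponents C 1" "keys m \<subseteq> V"
    then have "sum (lookup m) C \<noteq> 0" by (simp add: cover_exponents_def)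
    then obtain v where v: "v \<in> C" "1 \<le> lookup m v"
      by (metis One_nat_def Suc_leI neq0_conv sum.neutral)
    define m' where "m' = m - single v 1"
    have m': "m = m' + single v 1" unfolding m'_def by (rule exponent_eq_add_single[OF v(2)])
    have "single m' c * mpoly_var v \<in> L"
      using L(2) v(1) m(2) unfolding m'
      by (intro ideal_inD(4)[OF L(1)] single_in_polys) (auto simp: keys_add_exponents)
    then show "single m c \<in> L" by (simp add: m' mpoly_var_def mult_single)
  qed
qed

lemma edge_ideal_eq_monomial_ideal:
  assumes E: "\<And>i j. {i, j} \<in> E \<Longrightarrow> i \<noteq> j \<and> i \<in> V"
  shows "edge_ideal V E = (monomial_ideal V (ordinary_exponents E 1) :: ('v, 'k::comm_ring_1) mpoly set)"
  unfolding edge_ideal_def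
proof (rule genideal_mpoly_ring_eqI[OF ideal_in_monomial_ideal[OF up_closed_ordinary_exponents]])
  have E': "{i, j} \<in> E \<Longrightarrow> i \<in> V \<and> j \<in> V" for i j using E by (metis insert_commute)
  show "{mpoly_var i * mpoly_var j |i j. {i, j} \<in> E} \<subseteq> (monomial_ideal V (ordinary_exponents E 1) :: ('v, 'k) mpoly set)"
  proof safe
    fix i j assume ij: "{i, j} \<in> E"
    have "single i 1 + single j (1::nat) \<in> ordinary_exponents E 1"
      unfolding ordinary_exponents_def
      using edge_divisible_edge[OF ij, of 1] E[OF ij] by (auto simp: lookup_add)
    then have "single (single i 1 + single j (1::nat)) (1::'k)
       \<in> monomial_ideal V (ordinary_exponents E 1)"
      by (rule single_in_monomial_ideal) (use E'[OF ij] in \<open>auto simp: keys_add_exponents\<close>)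
    then show "mpoly_var i * mpoly_var j \<in> (monomial_ideal V (ordinary_exponents E 1) :: ('v, 'k) mpoly set)"
      by (simp add: mpoly_var_def mult_single)
  qed
next
  interpret carrier_ring "polys V :: ('v, 'k) mpoly set" by (rule carrier_ring_polys)
  fix L :: "('v, 'k) mpoly set" assume L: "ideal_in L" "{mpoly_var i * mpoly_var j |i j. {i, j} \<in> E} \<subseteq> L"
  show "monomial_ideal V (ordinary_exponents E 1) \<subseteq> L"
  proof (rule monomial_ideal_subsetI[OF L(1)])
    fix m and c :: 'k assume m: "m \<in> ordinary_exponents E 1" "keys m \<subseteq> V"
    then obtain i j where ij: "{i, j} \<in> E" "i \<noteq> j" "1 \<le> lookup m i" "1 \<le> lookup m j"
      by (auto simp: ordinary_exponents_def)
    define m' where "m' = m - single i 1 - single j 1"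
    have m': "m = m' + (single i 1 + single j 1)"
      unfolding m'_def using ij(2-4)
      by (intro poly_mapping_eqI) (auto simp: lookup_add lookup_minus lookup_single when_def)
    have v: "mpoly_var i * mpoly_var j \<in> L" using L(2) ij(1) by blast
    have "single m' c \<in> polys V"
      using m(2) unfolding m' by (intro single_in_polys) (simp add: keys_add_exponents)
    from ideal_inD(4)[OF L(1) this v] show "single m c \<in> L" by (simp add: m' mpoly_var_def mult_single)
  qed
qed

lemma exponent_power_edges:
  "exponent_power (ordinary_exponents E 1) k = ordinary_exponents E k"
proof (induction k)
  case 0
  show ?case by (simp add: ordinary_exponents_def)
next
  case (Suc k)
  show ?case
  proof (intro equalityI subsetI)
    fix m assume "m \<in> exponent_power (ordinary_exponents E 1) (Suc k)"
    then obtain a b where ab: "m = a + b" "a \<in> ordinary_exponents E k" "b \<in> ordinary_exponents E 1"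
      using Suc by auto
    then obtain i j where ij: "{i, j} \<in> E" "i \<noteq> j" "1 \<le> lookup b i" "1 \<le> lookup b j"
      by (auto simp: ordinary_exponents_def)
    let ?h = "lookup m"
    have "edge_divisible E k (lookup a)" using ab(2) by (simp add: ordinary_exponents_def)
    then have "edge_divisible E k (?h(i := ?h i - 1, j := ?h j - 1))"
      by (rule edge_divisible_mono) (use ij ab(1) in \<open>auto simp: lookup_add\<close>)
    then have "edge_divisible E (Suc k) ?h"
      using ij ab(1) by (intro edge_divisible_SucI[of i j]) (auto simp: lookup_add)
    then show "m \<in> ordinary_exponents E (Suc k)" by (simp add: ordinary_exponents_def)
  next
    fix m assume "m \<in> ordinary_exponents E (Suc k)"
    then obtain i j where ij: "{i, j} \<in> E" "i \<noteq> j" "1 \<le> lookup m i" "1 \<le> lookup m j"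
      "edge_divisible E k ((lookup m)(i := lookup m i - 1, j := lookup m j - 1))"
      by (auto simp: ordinary_exponents_def)
    define b where "b = single i 1 + single j (1::nat)"
    define m' where "m' = m - b"
    have m': "m = m' + b"
      unfolding m'_def b_def using ij(2-4)
      by (intro poly_mapping_eqI) (auto simp: lookup_add lookup_minus lookup_single when_def)
    have "lookup m' = (lookup m)(i := lookup m i - 1, j := lookup m j - 1)"
      unfolding m'_def b_def using ij(2)
      by (intro ext) (auto simp: lookup_add lookup_minus lookup_single when_def)
    then have "m' \<in> ordinary_exponents E k" using ij(5) by (simp add: ordinary_exponents_def)
    moreover have "b \<in> ordinary_exponents E 1"
      unfolding ordinary_exponents_def b_def
      using edge_divisible_edge[OF ij(1,2), of 1] by (auto simp: lookup_add)
    ultimately show "m \<in> exponent_power (ordinary_exponents E 1) (Suc k)" using m' Suc by auto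
  qed
qed

text \<open>
  Modulo the ideal a polynomial agrees with the sum of its terms that avoid \<open>C\<close>. These sums are closed
  under multiplication and have no zero divisors, because the polynomial ring is a domain.
\<close>

lemma prime_monomial_ideal_cover:
  fixes V :: "'v::linorder set"
  shows "primeideal (monomial_ideal V (cover_exponents C 1) :: ('v, 'k::field) mpoly set) (mpoly_ring V)"
proof (rule primeidealI)
  interpret carrier_ring "polys V :: ('v, 'k) mpoly set" by (rule carrier_ring_polys)
  let ?P = "monomial_ideal V (cover_exponents C 1) :: ('v, 'k) mpoly set"
  have P: "ideal_in ?P" by (rule ideal_in_monomial_ideal[OF up_closed_cover_exponents])
  show "ideal ?P (mpoly_ring V)" using P by (simp add: ideal_mpoly_ring_iff)
  show "cring (mpoly_ring V :: ('v, 'k) mpoly ring)" by (rule cring_mpoly_ring)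
  have "(1 :: ('v, 'k) mpoly) \<notin> ?P" by (simp add: monomial_ideal_def cover_exponents_def)
  then show "carrier (mpoly_ring V) \<noteq> ?P" using one_closed by auto
  fix p q :: "('v, 'k) mpoly"
  assume pq: "p \<in> carrier (mpoly_ring V)" "q \<in> carrier (mpoly_ring V)" "p \<otimes>\<^bsub>mpoly_ring V\<^esub> q \<in> ?P"
  define good where "good m \<longleftrightarrow> sum (lookup m) C = 0" for m :: "'v \<Rightarrow>\<^sub>0 nat"
  \<comment> \<open>The part of p that does not involve the variables in C.\<close>
  define rest where "rest p = (\<Sum>m\<in>{m\<in>keys p. good m}. single m (lookup p m))"
    for p :: "('v, 'k) mpoly"
  have lookup_rest: "lookup (rest p) m = (if good m then lookup p m else 0)" for p m
  proof -
    have "lookup (rest p) m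
      = (\<Sum>m'\<in>{m\<in>keys p. good m}. if m' = m then lookup p m' else 0)"
      unfolding rest_def lookup_sum by (intro sum.cong refl) (simp add: lookup_single when_def)
    then show ?thesis by (auto simp: sum.delta in_keys_iff)
  qed
  have diff: "p - rest p \<in> ?P" and restV: "rest p \<in> polys V" if "p \<in> polys V" for p
  proof -
    show "rest p \<in> polys V"
      unfolding rest_def by (intro sum_closed single_in_polys) (use that in \<open>auto simp: polys_def\<close>)
    then have "p - rest p \<in> polys V" using that by simp
    moreover have "m \<in> cover_exponents C 1" if "m \<in> keys (p - rest p)" for m
      using that by (auto simp: in_keys_iff lookup_minus lookup_rest good_def cover_exponents_def split: if_splits)
    ultimately show "p - rest p \<in> ?P" unfolding monomial_ideal_def by auto
  qed
  have P_if_rest_0: "p \<in> ?P" if "rest p = 0" "p \<in> polys V" for p using diff[OF that(2)] that(1) by simp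
  have "rest p * rest q \<in> ?P"
  proof -
    have V: "p \<in> polys V" "q \<in> polys V" using pq by auto
    have "p * q \<in> ?P" using pq(3) by simp
    moreover have "q * (p - rest p) \<in> ?P" by (rule ideal_inD(4)[OF P V(2) diff[OF V(1)]])
    moreover have "rest p * (q - rest q) \<in> ?P"
      by (rule ideal_inD(4)[OF P restV[OF V(1)] diff[OF V(2)]])
    ultimately have "p * q - q * (p - rest p) - rest p * (q - rest q) \<in> ?P"
      using ideal_inD(6)[OF P] by blast
    then show ?thesis by (simp add: algebra_simps)
  qed
  moreover have "good m" if m: "m \<in> keys (rest p * rest q)" for m
  proof -
    obtain a b where "m = a + b" "a \<in> keys (rest p)" "b \<in> keys (rest q)"
      using keys_mult[of "rest p" "rest q"] m by blast
    then show ?thesis by (auto simp: in_keys_iff lookup_rest good_def lookup_add sum.distrib split: if_splits)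
  qed
  ultimately have "keys (rest p * rest q) = {}"
    unfolding monomial_ideal_def cover_exponents_def good_def by fastforce
  then have "rest p = 0 \<or> rest q = 0" by simp
  then show "p \<in> ?P \<or> q \<in> ?P" using P_if_rest_0 pq by auto
qed

text \<open>
  If \<open>x\<^sub>i x\<^sub>j\<close> lies in a prime, then so does \<open>x\<^sub>i\<close> or \<open>x\<^sub>j\<close>. Thus the variables in a prime over the
  edge ideal form a vertex cover.
\<close>

lemma prime_contains_cover_prime:
  fixes V :: "'v set" and Q :: "('v, 'k::comm_ring_1) mpoly set"
  assumes fin: "finite V" and E: "\<And>i j. {i, j} \<in> E \<Longrightarrow> i \<noteq> j \<and> i \<in> V"
    and Q: "primeideal Q (mpoly_ring V)" "edge_ideal V E \<subseteq> Q"
  defines "C \<equiv> {v\<in>V. mpoly_var v \<in> Q}"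
  shows "vertex_cover V E C" and "monomial_ideal V (cover_exponents C 1) \<subseteq> Q"
proof -
  interpret Q: primeideal Q "mpoly_ring V" by (rule Q(1))
  have E': "{i, j} \<in> E \<Longrightarrow> i \<in> V \<and> j \<in> V" for i j using E by (metis insert_commute)
  have var: "mpoly_var v \<in> (polys V :: ('v, 'k) mpoly set)" if "v \<in> V" for v
    unfolding mpoly_var_def by (intro single_in_polys) (use that in auto)
  show "vertex_cover V E C"
    unfolding vertex_cover_def
  proof (intro conjI allI impI)
    show "C \<subseteq> V" by (auto simp: C_def)
    fix i j assume ij: "{i, j} \<in> E"
    have "{mpoly_var i * mpoly_var j |i j. {i, j} \<in> E} \<subseteq> (carrier (mpoly_ring V) :: ('v, 'k) mpoly set)"
    proof safe
      fix i j assume "{i, j} \<in> E"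
      then show "mpoly_var i * mpoly_var j \<in> (carrier (mpoly_ring V) :: ('v, 'k) mpoly set)"
        using carrier_ring.mult_closed[OF carrier_ring_polys var var] E' by simp
    qed
    then have "{mpoly_var i * mpoly_var j |i j. {i, j} \<in> E} \<subseteq> (edge_ideal V E :: ('v, 'k) mpoly set)"
      unfolding edge_ideal_def by (rule Q.genideal_self)
    then have "mpoly_var i * mpoly_var j \<in> Q" using Q(2) ij by blast
    then have "mpoly_var i \<in> Q \<or> mpoly_var j \<in> Q"
      using Q.I_prime[of "mpoly_var i" "mpoly_var j"] var E'[OF ij] by simp
    then show "i \<in> C \<or> j \<in> C" using E'[OF ij] by (auto simp: C_def)
  qed
  have C: "finite C" "C \<subseteq> V" using fin by (auto simp: C_def)
  have "mpoly_var ` C \<subseteq> Q" by (auto simp: C_def)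
  then show "monomial_ideal V (cover_exponents C 1) \<subseteq> Q"
    unfolding idl_vars_eq_monomial_ideal[OF C, symmetric]
    by (rule Q.genideal_minimal[OF Q.is_ideal])
qed

lemma edge_ideal_subset_cover_prime:
  assumes E: "\<And>i j. {i, j} \<in> E \<Longrightarrow> i \<noteq> j \<and> i \<in> V" and "finite V" "vertex_cover V E C"
  shows "edge_ideal V E \<subseteq> (monomial_ideal V (cover_exponents C 1) :: ('v, 'k::comm_ring_1) mpoly set)"
proof -
  have "ordinary_exponents E 1 \<subseteq> cover_exponents C 1"
    using edge_divisible_imp_cover_heavy[OF assms(2), of E 1] assms(3)
    unfolding ordinary_exponents_def cover_exponents_def cover_heavy_def by auto
  then have "(monomial_ideal V (ordinary_exponents E 1) :: ('v, 'k) mpoly set)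
      \<subseteq> monomial_ideal V (cover_exponents C 1)"
    unfolding monomial_ideal_def by auto
  moreover have "edge_ideal V E = (monomial_ideal V (ordinary_exponents E 1) :: ('v, 'k) mpoly set)"
    by (rule edge_ideal_eq_monomial_ideal) (rule E)
  ultimately show ?thesis by simp
qed

lemma mpoly_var_in_cover_prime_iff:
  assumes "finite C" "C \<subseteq> V"
  shows "(mpoly_var v :: ('v, 'k::comm_ring_1) mpoly) \<in> monomial_ideal V (cover_exponents C 1) \<longleftrightarrow> v \<in> C"
  unfolding mpoly_var_def single_one_in_monomial_ideal_iff cover_exponents_def
  using assms by (auto simp: lookup_single when_def sum.delta)

text \<open>
  The minimal primes are generated by the minimal vertex covers. Only two consequences are stated:
  each minimal prime comes from some cover, and each cover contains one that gives a minimal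
  prime.
\<close>

lemma minimal_primes_edge_ideal:
  fixes V :: "'v::linorder set" and P :: "('v, 'k::field) mpoly set"
  assumes fin: "finite V" and E: "\<And>i j. {i, j} \<in> E \<Longrightarrow> i \<noteq> j \<and> i \<in> V"
  shows "P \<in> minimal_primes (mpoly_ring V) (edge_ideal V E) \<Longrightarrow>
      \<exists>C. vertex_cover V E C \<and> P = monomial_ideal V (cover_exponents C 1)"
    and "vertex_cover V E C \<Longrightarrow> \<exists>C0\<subseteq>C. vertex_cover V E C0 \<and>
      monomial_ideal V (cover_exponents C0 1) \<in> minimal_primes (mpoly_ring V :: ('v, 'k) mpoly ring) (edge_ideal V E)"
proof -
  have finC: "finite C" if "vertex_cover V E C" for C
    using that fin finite_subset unfolding vertex_cover_def by blast
  show "\<exists>C. vertex_cover V E C \<and> P = monomial_ideal V (cover_exponents C 1)"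
    if P: "P \<in> minimal_primes (mpoly_ring V) (edge_ideal V E)"
  proof -
    let ?C = "{v\<in>V. mpoly_var v \<in> P}"
    have prime: "primeideal P (mpoly_ring V)" "edge_ideal V E \<subseteq> P"
      using P by (auto simp: minimal_primes_def)
    note C = prime_contains_cover_prime[OF fin E prime]
    have "primeideal (monomial_ideal V (cover_exponents ?C 1) :: ('v, 'k) mpoly set) (mpoly_ring V)"
      by (rule prime_monomial_ideal_cover)
    then have "P = monomial_ideal V (cover_exponents ?C 1)"
      using P C(2) edge_ideal_subset_cover_prime[OF E fin C(1)] unfolding minimal_primes_def by blast
    then show ?thesis using C(1) by blast
  qed
  show "\<exists>C0\<subseteq>C. vertex_cover V E C0 \<and>
      monomial_ideal V (cover_exponents C0 1) \<in> minimal_primes (mpoly_ring V :: ('v, 'k) mpoly ring) (edge_ideal V E)"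
    if C: "vertex_cover V E C"
  proof -
    let ?A = "{C0. C0 \<subseteq> C \<and> vertex_cover V E C0}"
    have "finite ?A" using finC[OF C] by simp
    moreover have "?A \<noteq> {}" using C by auto
    ultimately have "\<exists>m\<in>?A. \<forall>b\<in>?A. b \<subseteq> m \<longrightarrow> m = b" by (rule finite_has_minimal)
    then obtain C0 where C0': "C0 \<in> ?A" "\<forall>b\<in>?A. b \<subseteq> C0 \<longrightarrow> C0 = b" ..
    then have C0: "C0 \<subseteq> C" "vertex_cover V E C0" by auto
    have minimal: "C1 = C0" if C1: "vertex_cover V E C1" "C1 \<subseteq> C0" for C1
      using C0'(2)[rule_format, of C1] C1 C0(1) by auto
    have C0V: "finite C0" "C0 \<subseteq> V" using finC[OF C0(2)] C0(2) by (auto simp: vertex_cover_def)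
    let ?P = "monomial_ideal V (cover_exponents C0 1) :: ('v, 'k) mpoly set"
    have "Q = ?P" if Q: "primeideal Q (mpoly_ring V)" "edge_ideal V E \<subseteq> Q" "Q \<subseteq> ?P" for Q
    proof -
      let ?CQ = "{v\<in>V. mpoly_var v \<in> Q}"
      note CQ = prime_contains_cover_prime[OF fin E Q(1,2)]
      have "?CQ \<subseteq> C0" using Q(3) mpoly_var_in_cover_prime_iff[OF C0V, where ?'k = 'k] by blast
      then have "?CQ = C0" using minimal[of ?CQ] CQ(1) by blast
      then show ?thesis using CQ(2) Q(3) by auto
    qed
    then have "?P \<in> minimal_primes (mpoly_ring V) (edge_ideal V E)"
      unfolding minimal_primes_def
      using prime_monomial_ideal_cover[where C = C0 and V = V and ?'k = 'k]
        edge_ideal_subset_cover_prime[OF E fin C0(2), where ?'k = 'k] by blast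
    then show ?thesis using C0(1,2) by blast
  qed
qed

text \<open>
  Weights of covers increase with the cover, so that the condition for minimal covers implies that
  for all covers.
\<close>

theorem symbolic_power_edge_ideal:
  fixes V :: "'v::linorder set"
  assumes fin: "finite V" and E: "\<And>i j. {i, j} \<in> E \<Longrightarrow> i \<noteq> j \<and> i \<in> V"
  shows "symbolic_power (mpoly_ring V) (edge_ideal V E) k
    = (monomial_ideal V (symbolic_exponents V E k) :: ('v, 'k::field) mpoly set)"
proof -
  have finC: "finite C" if "vertex_cover V E C" for C
    using that fin finite_subset unfolding vertex_cover_def by blast
  have power: "ideal_power (mpoly_ring V) (monomial_ideal V (cover_exponents C 1)) k
      = (monomial_ideal V (cover_exponents C k) :: ('v, 'k) mpoly set)" if "vertex_cover V E C" for C
    using ideal_power_monomial_ideal[OF up_closed_cover_exponents] exponent_power_cover[OF finC[OF that]]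
    by metis
  show ?thesis
  proof (intro equalityI subsetI)
    fix f :: "('v, 'k) mpoly" assume f: "f \<in> monomial_ideal V (symbolic_exponents V E k)"
    have "f \<in> ideal_power (mpoly_ring V) P k" if P: "P \<in> minimal_primes (mpoly_ring V) (edge_ideal V E)" for P
    proof -
      obtain C where C: "vertex_cover V E C" "P = monomial_ideal V (cover_exponents C 1)"
        using minimal_primes_edge_ideal(1)[OF fin E P] by blast
      have "symbolic_exponents V E k \<subseteq> cover_exponents C k"
        using C(1) by (auto simp: symbolic_exponents_def cover_exponents_def cover_heavy_def)
      then have "f \<in> monomial_ideal V (cover_exponents C k)" using f unfolding monomial_ideal_def by auto
      then show ?thesis using power[OF C(1)] by (simp only: C(2))
    qed
    then show "f \<in> symbolic_power (mpoly_ring V) (edge_ideal V E) k"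
      using f by (auto simp: symbolic_power_def monomial_ideal_def)
  next
    fix f :: "('v, 'k) mpoly" assume f: "f \<in> symbolic_power (mpoly_ring V) (edge_ideal V E) k"
    have "k \<le> sum (lookup m) C" if m: "m \<in> keys f" and C: "vertex_cover V E C" for m C
    proof -
      obtain C0 where C0: "C0 \<subseteq> C" "vertex_cover V E C0"
        "monomial_ideal V (cover_exponents C0 1) \<in> minimal_primes (mpoly_ring V :: ('v, 'k) mpoly ring) (edge_ideal V E)"
        using minimal_primes_edge_ideal(2)[OF fin E C] by blast
      then have "f \<in> monomial_ideal V (cover_exponents C0 k)"
        using f power[OF C0(2)] by (auto simp: symbolic_power_def)
      then have "k \<le> sum (lookup m) C0"
        using m by (auto simp: monomial_ideal_def cover_exponents_def)
      also have "\<dots> \<le> sum (lookup m) C"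
        by (rule sum_mono2[OF finC[OF C] C0(1)]) simp
      finally show ?thesis .
    qed
    then show "f \<in> monomial_ideal V (symbolic_exponents V E k)"
      using f by (auto simp: symbolic_power_def monomial_ideal_def symbolic_exponents_def cover_heavy_def)
  qed
qed

lemma ideal_power_edge_ideal:
  assumes "\<And>i j. {i, j} \<in> E \<Longrightarrow> i \<noteq> j \<and> i \<in> V"
  shows "ideal_power (mpoly_ring V) (edge_ideal V E) k
    = (monomial_ideal V (ordinary_exponents E k) :: ('v, 'k::comm_ring_1) mpoly set)"
proof -
  have "edge_ideal V E = (monomial_ideal V (ordinary_exponents E 1) :: ('v, 'k) mpoly set)"
    by (rule edge_ideal_eq_monomial_ideal) (rule assms)
  then show ?thesis
    by (simp only: ideal_power_monomial_ideal[OF up_closed_ordinary_exponents] exponent_power_edges)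
qed

section \<open>The depth inequality\<close>

lemma homogeneous_maximal_ideal_eq:
  "finite V \<Longrightarrow> homogeneous_maximal_ideal V = monomial_ideal V (cover_exponents V 1)"
  unfolding homogeneous_maximal_ideal_def by (rule idl_vars_eq_monomial_ideal) auto

lemma power_in_maximal_ideal_power:
  assumes "f \<in> monomial_ideal V (cover_exponents V 1)"
  shows "f ^ m \<in> monomial_ideal V (cover_exponents V m)"
proof (induction m)
  case 0
  show ?case by (simp add: monomial_ideal_def cover_exponents_def polys_def)
next
  case (Suc m)
  have "f * f ^ m \<in> polys V"
    using assms Suc carrier_ring.mult_closed[OF carrier_ring_polys] by (auto simp: monomial_ideal_def)
  moreover have "e \<in> cover_exponents V (Suc m)" if e: "e \<in> keys (f * f ^ m)" for e
  proof -
    obtain a b where ab: "e = a + b" "a \<in> keys f" "b \<in> keys (f ^ m)"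
      using keys_mult[of f "f ^ m"] e by blast
    have "1 \<le> sum (lookup a) V" using ab(2) assms by (auto simp: monomial_ideal_def cover_exponents_def)
    moreover have "m \<le> sum (lookup b) V" using ab(3) Suc by (auto simp: monomial_ideal_def cover_exponents_def)
    ultimately show ?thesis by (simp add: ab(1) cover_exponents_def lookup_add sum.distrib)
  qed
  ultimately show ?case unfolding monomial_ideal_def by auto
qed

text \<open>
  A monomial of degree greater than \<open>M |V|\<close> has an exponent of at least \<open>M\<close>, so high powers of the
  maximal ideal lie in the ideal generated by the powers \<open>x\<^sub>v\<^sup>M\<close>.
\<close>

lemma power_in_var_power_ideal:
  fixes f :: "('v, 'k::comm_ring_1) mpoly"
  assumes fin: "finite V" and f: "f \<in> monomial_ideal V (cover_exponents V 1)"
  shows "\<exists>m g. (\<forall>v\<in>V. g v \<in> polys V) \<and> f ^ m = (\<Sum>v\<in>V. g v * var_power M v)"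
proof -
  interpret carrier_ring "polys V :: ('v, 'k) mpoly set" by (rule carrier_ring_polys)
  define W where "W = {\<Sum>v\<in>V. g v * var_power M v | g :: 'v \<Rightarrow> ('v, 'k) mpoly. \<forall>v\<in>V. g v \<in> polys V}"
  have WI: "(\<Sum>v\<in>V. g v * var_power M v) \<in> W" if "\<And>v. v \<in> V \<Longrightarrow> g v \<in> polys V" for g
    using that unfolding W_def by blast
  have W: "ideal_in W"
    unfolding ideal_in_def
  proof (intro conjI ballI)
    show "W \<subseteq> polys V" unfolding W_def by (auto intro!: sum_closed mult_closed var_power_in_polys)
    show "0 \<in> W" using WI[of "\<lambda>_. 0"] by simp
  next
    fix a b :: "('v, 'k) mpoly" assume "a \<in> W" "b \<in> W"
    then obtain g h where gh: "a = (\<Sum>v\<in>V. g v * var_power M v)" "b = (\<Sum>v\<in>V. h v * var_power M v)"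
      "\<forall>v\<in>V. g v \<in> polys V" "\<forall>v\<in>V. h v \<in> polys V" unfolding W_def by blast
    have "(\<Sum>v\<in>V. (g v + h v) * var_power M v) \<in> W" by (rule WI) (use gh in auto)
    then show "a + b \<in> W" by (simp add: gh(1,2) distrib_right sum.distrib)
  next
    fix r a :: "('v, 'k) mpoly" assume r: "r \<in> polys V" and "a \<in> W"
    then obtain g where g: "a = (\<Sum>v\<in>V. g v * var_power M v)" "\<forall>v\<in>V. g v \<in> polys V"
      unfolding W_def by blast
    have "(\<Sum>v\<in>V. (r * g v) * var_power M v) \<in> W" by (rule WI) (use g r in auto)
    then show "r * a \<in> W" by (simp add: g(1) sum_distrib_left mult.assoc)
  qed
  have "monomial_ideal V (cover_exponents V (M * card V + 1)) \<subseteq> W"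
  proof (rule monomial_ideal_subsetI[OF W])
    fix e :: "'v \<Rightarrow>\<^sub>0 nat" and c :: 'k
    assume e: "e \<in> cover_exponents V (M * card V + 1)" "keys e \<subseteq> V"
    have "\<exists>v\<in>V. M \<le> lookup e v"
    proof (rule ccontr)
      assume "\<not> ?thesis"
      then have "sum (lookup e) V \<le> (\<Sum>v\<in>V. M)" by (intro sum_mono) auto
      then show False using e(1) by (simp add: cover_exponents_def mult.commute)
    qed
    then obtain v where v: "v \<in> V" "M \<le> lookup e v" by blast
    define e' where "e' = e - single v M"
    have e': "e = e' + single v M"
      unfolding e'_def using v(2)
      by (intro poly_mapping_eqI) (auto simp: lookup_add lookup_minus lookup_single when_def)
    have s: "single e' c \<in> polys V"
      using e(2) unfolding e' by (intro single_in_polys) (simp add: keys_add_exponents)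
    have "(\<Sum>w\<in>V. (if w = v then single e' c else 0) * var_power M w) \<in> W"
      by (rule WI) (use s in auto)
    also have "(\<Sum>w\<in>V. (if w = v then single e' c else 0) * var_power M w)
        = (\<Sum>w\<in>V. if w = v then single e' c * var_power M w else 0)"
      by (intro sum.cong refl) simp
    also have "\<dots> = single e' c * var_power M v"
      using fin v(1) by (simp add: sum.delta)
    also have "\<dots> = single e c" by (simp add: var_power_def mult_single e')
    finally show "single e c \<in> W" .
  qed
  then have "f ^ (M * card V + 1) \<in> W" using power_in_maximal_ideal_power[OF f] by blast
  then show ?thesis unfolding W_def by blast
qed

theorem theorem1p7:
  fixes n k :: nat
    and E :: "nat set set"
    and S :: "(nat, 'k::field) mpoly ring"
    and I \<mm> :: "(nat, 'k) mpoly set"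
  assumes "simple_graph {1..n} E"
    and "S = mpoly_ring {1..n}"
    and "I = edge_ideal {1..n} E"
    and "\<mm> = homogeneous_maximal_ideal {1..n}"
    and "k = 2 \<or> k = 3"
  shows "depth \<mm> (quotient_module S (symbolic_power S I k))
           \<ge> depth \<mm> (quotient_module S (ideal_power S I k))"
proof -
  define V where "V = {1..n}"
  have fin: "finite V" by (simp add: V_def)
  have E: "i \<noteq> j \<and> i \<in> V" if "{i, j} \<in> E" for i j
  proof -
    have "{i, j} \<subseteq> V" "card {i, j} = 2" using assms(1) that by (auto simp: simple_graph_def V_def)
    then show ?thesis by (cases "i = j") auto
  qed
  interpret carrier_ring "polys V :: (nat, 'k) mpoly set" by (rule carrier_ring_polys)
  let ?J = "monomial_ideal V (ordinary_exponents E k) :: (nat, 'k) mpoly set"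
  let ?J' = "monomial_ideal V (symbolic_exponents V E k) :: (nat, 'k) mpoly set"
  have S: "S = mpoly_ring V" using assms(2) by (simp only: V_def)
  have powers: "ideal_power S I k = ?J" "symbolic_power S I k = ?J'"
    unfolding assms(2,3) V_def[symmetric]
     apply (rule ideal_power_edge_ideal, rule E, assumption)
    apply (rule symbolic_power_edge_ideal[OF fin], rule E, assumption)
    done
  have m: "\<mm> = monomial_ideal V (cover_exponents V 1)"
    unfolding assms(4) V_def[symmetric] by (rule homogeneous_maximal_ideal_eq[OF fin])
  have J: "ideal_in ?J" "ideal_in ?J'"
    by (intro ideal_in_monomial_ideal up_closed_ordinary_exponents up_closed_symbolic_exponents)+
  have mI: "ideal_in \<mm>"
    unfolding m by (rule ideal_in_monomial_ideal[OF up_closed_cover_exponents])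
  have m_proper: "\<mm> \<noteq> polys V"
  proof -
    have "(1 :: (nat, 'k) mpoly) \<notin> \<mm>" unfolding m by (simp add: monomial_ideal_def cover_exponents_def)
    then show ?thesis by auto
  qed
  have xm: "var_power 4 v \<in> \<mm>" if "v \<in> V" for v
    unfolding m var_power_def
    by (rule single_in_monomial_ideal)
      (use fin that in \<open>auto simp: cover_exponents_def lookup_single when_def sum.delta\<close>)
  have J'm: "?J' \<subseteq> \<mm>"
  proof -
    have "vertex_cover V E V" using E by (auto simp: vertex_cover_def)
    then have "symbolic_exponents V E k \<subseteq> cover_exponents V 1"
      using assms(5) by (auto simp: symbolic_exponents_def cover_exponents_def cover_heavy_def)
    then show ?thesis unfolding m monomial_ideal_def by auto
  qed
  show ?thesis
    unfolding depth_def[of _ "quotient_module S (ideal_power S I k)"]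
  proof (rule SUP_least)
    fix fs assume "fs \<in> {fs. set fs \<subseteq> \<mm> \<and> regular_sequence (quotient_module S (ideal_power S I k)) fs}"
    then have fs: "set fs \<subseteq> \<mm>" "regular_sequence (quotient_module (mpoly_ring V) ?J) fs"
      unfolding powers(1) unfolding S by simp_all
    have fsV: "set fs \<subseteq> polys V" using fs(1) ideal_inD(1)[OF mI] by blast
    have rs: "regseq ?J fs" using regular_sequence_quotient_module_iff[OF J(1) fsV] fs(2) by blast
    have vanJ: "koszul_vanishes (var_power 4) V ?J i" if "i < length fs" for i
    proof (rule regseq_imp_koszul_vanishes[OF fin _ rs J(1) that])
      show "var_power 4 v \<in> polys V" if "v \<in> V" for v using that by (rule var_power_in_polys)
      fix f assume "f \<in> set fs"
      then have "f \<in> monomial_ideal V (cover_exponents V 1)" using fs(1) m by blast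
      then show "f \<in> polys V \<and> (\<exists>m g. (\<forall>v\<in>V. g v \<in> polys V) \<and> f ^ m = (\<Sum>v\<in>V. g v * var_power 4 v))"
        using power_in_var_power_ideal[OF fin] fsV \<open>f \<in> set fs\<close> by blast
    qed
    have "\<exists>fs'. length fs' = length fs \<and> set fs' \<subseteq> \<mm> \<and> regseq ?J' fs'"
    proof (rule koszul_vanishes_imp_regseq[OF fin _ _ mI m_proper _ J(2) J'm])
      show "var_power 4 v \<in> polys V" if "v \<in> V" for v using that by (rule var_power_in_polys)
      show "var_power 4 v \<in> \<mm>" if "v \<in> V" for v using that by (rule xm)
      show "koszul_vanishes (var_power 4) V ?J' i" if i: "i < length fs" for i
      proof (rule koszul_vanishes_symbolic[OF fin _ assms(5) vanJ[OF i]])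
        show "i \<noteq> j \<and> i \<in> V" if "{i, j} \<in> E" for i j using that by (rule E)
      qed
      show "\<exists>f\<in>\<mm>. \<forall>p\<in>polys V. f * p \<in> L \<longrightarrow> p \<in> L"
        if "ideal_in L" "\<And>z. z \<in> polys V \<Longrightarrow> (\<And>f. f \<in> \<mm> \<Longrightarrow> f * z \<in> L) \<Longrightarrow> z \<in> L" for L
        by (rule ex_nonzerodivisor[OF noetherian_polys[OF fin] that(1) mI that(2)])
    qed
    then obtain fs' where fs': "length fs' = length fs" "set fs' \<subseteq> \<mm>" "regseq ?J' fs'" by blast
    have "set fs' \<subseteq> polys V" using fs'(2) ideal_inD(1)[OF mI] by blast
    then have "regular_sequence (quotient_module S (symbolic_power S I k)) fs'"
      using regular_sequence_quotient_module_iff[OF J(2)] fs'(3)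
      unfolding powers(2) unfolding S by blast
    then show "enat (length fs) \<le> depth \<mm> (quotient_module S (symbolic_power S I k))"
      unfolding depth_def using fs'(1,2) by (intro SUP_upper2[of fs']) auto
  qed
qed

end
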